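(* Let $s>\frac52$ and let $w_0=(\rho_0,u_0,v_0)\in H^{s-1}(\mathbb{R})\times H^s(\mathbb{R})\times H^s(\mathbb{R})$. Let $T=T(w_0)>0$ be the lifespan of the solution $w=(\rho,u,v)$, with initial data $w_0$, of $$\begin{cases}\rho_t+(\rho uv)_x=0,\\ m_t+uvm_x+3vu_xm+\rho^2u=0,\\ n_t+uvn_x+3v_xun-\rho^2v=0,\\ m=u-u_{xx},\quad n=v-v_{xx}.\end{cases}$$ If there exists $\beta\in(0,\infty)$ such that $$\left\|(\rho_0,u_0,u_{0,x},u_{0,xx},v_0,v_{0,x},v_{0,xx})(1+\beta+|x|)^\beta\right\|_{L^\infty}\le C_0,$$ then $$\left\|(\rho,u,u_x,u_{xx},v,v_x,v_{xx})(1+\beta+|x|)^\beta\right\|_{L^\infty}\le C_1$$ uniformly for $t$ in the interval $[0,T_0]$ for some $T_0<T$. In particular, if the initial data satisfy $$\left\|(\rho_0,\rho_{0,x},u_0,u_{0,x},u_{0,xx},v_0,v_{0,x},v_{0,xx})(1+\beta+|x|)^\beta\right\|_{L^\infty}\le C_0,$$ then $$\left\|(\rho,\rho_x,u,u_x,u_{xx},v,v_x,v_{xx})(1+\beta+|x|)^\beta\right\|_{L^\infty}\le C_1$$ uniformly for $t$ in the interval $[0,T_0]$ for some $T_0<T$. Here the constant $C_1$ depends on $M$, $C_\beta$, $C_0$.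
   Context: The solution is $w\in C([0,T);H^{s-1}\times H^s\times H^s)$ on $\mathbb{R}$. The $L^\infty$ norm of a tuple is the sum of the $L^\infty$ norms of its components. $M=\sup_{t\in[0,T_0]}\left(\|\rho(t,\cdot)\|_{H^{s-1}}+\|u(t,\cdot)\|_{H^s}+\|v(t,\cdot)\|_{H^s}\right)$. $C_\beta$ is a constant depending only on $\beta$ such that $\varphi_N(x)\int_{\mathbb{R}}\frac{e^{-|x-y|}}{\varphi_N(y)}dy\le C_\beta$ for all $x\in\mathbb{R}$ and $N\in\mathbb{R}^+$, where $\varphi_N(x)=(1+\beta+|x|)^\beta$ for $0\le|x|<N$ and $\varphi_N(x)=(1+\beta+N)^\beta$ for $|x|\ge N$. *)

theory Defs
  imports "HOL-Probability.Probability"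
begin

text \<open>
  Elements of Lebesgue and Sobolev spaces on the real line are represented by functions; all
  notions below are invariant under changes on null sets.
\<close>

section \<open>The Fourier transform on L2 and Sobolev spaces\<close>

definition square_integrable :: "(real \<Rightarrow> 'b::{banach, second_countable_topology}) \<Rightarrow> bool" where
  "square_integrable f \<longleftrightarrow>
     f \<in> borel_measurable lborel \<and> integrable lborel (\<lambda>x. (norm (f x))\<^sup>2)"

definition truncated_fourier :: "real \<Rightarrow> (real \<Rightarrow> real) \<Rightarrow> real \<Rightarrow> complex" where
  "truncated_fourier R f \<xi> =
     complex_of_real (1 / sqrt (2 * pi)) *
       (LINT x:{-R..R}|lborel. exp (- \<i> * complex_of_real (x * \<xi>)) * complex_of_real (f x))"

text \<open>Plancherel's definition: the transform is the limit in L2 of the truncated integrals.\<close>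

definition has_fourier_L2 :: "(real \<Rightarrow> real) \<Rightarrow> (real \<Rightarrow> complex) \<Rightarrow> bool" where
  "has_fourier_L2 f g \<longleftrightarrow>
     square_integrable f \<and> square_integrable g \<and>
     ((\<lambda>R. \<integral>\<^sup>+\<xi>. ennreal ((cmod (truncated_fourier R f \<xi> - g \<xi>))\<^sup>2) \<partial>lborel) \<longlongrightarrow> 0) at_top"

definition fourier_L2 :: "(real \<Rightarrow> real) \<Rightarrow> real \<Rightarrow> complex" where
  "fourier_L2 f = (SOME g. has_fourier_L2 f g)"

text \<open>The space of order \<open>r \<ge> 0\<close> (for negative order it is not contained in L2).\<close>

definition in_sobolev :: "real \<Rightarrow> (real \<Rightarrow> real) \<Rightarrow> bool" where
  "in_sobolev r f \<longleftrightarrow>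
     (\<exists>g. has_fourier_L2 f g \<and> integrable lborel (\<lambda>\<xi>. (1 + \<xi>\<^sup>2) powr r * (cmod (g \<xi>))\<^sup>2))"

definition sobolev_norm :: "real \<Rightarrow> (real \<Rightarrow> real) \<Rightarrow> real" where
  "sobolev_norm r f = sqrt (LINT \<xi>|lborel. (1 + \<xi>\<^sup>2) powr r * (cmod (fourier_L2 f \<xi>))\<^sup>2)"

definition time_interval :: "ereal \<Rightarrow> real set" where
  "time_interval T = {t. 0 \<le> t \<and> ereal t < T}"

definition continuous_in_sobolev :: "ereal \<Rightarrow> real \<Rightarrow> (real \<Rightarrow> real \<Rightarrow> real) \<Rightarrow> bool" where
  "continuous_in_sobolev T r f \<longleftrightarrow>
     (\<forall>t\<in>time_interval T. in_sobolev r (f t) \<and>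
        ((\<lambda>\<tau>. sobolev_norm r (\<lambda>x. f \<tau> x - f t x)) \<longlongrightarrow> 0) (at t within time_interval T))"

section \<open>Test functions and weak derivatives\<close>

primrec C_k :: "nat \<Rightarrow> ('a::euclidean_space \<Rightarrow> real) \<Rightarrow> bool" where
  "C_k 0 f \<longleftrightarrow> continuous_on UNIV f"
| "C_k (Suc k) f \<longleftrightarrow>
     (\<exists>f'. (\<forall>x. (f has_derivative f' x) (at x)) \<and> (\<forall>h. C_k k (\<lambda>x. f' x h)))"

definition test_function :: "'a::euclidean_space set \<Rightarrow> ('a \<Rightarrow> real) \<Rightarrow> bool" where
  "test_function S \<psi> \<longleftrightarrow>
     (\<forall>k. C_k k \<psi>) \<and> (\<exists>K. compact K \<and> K \<subseteq> S \<and> (\<forall>x. x \<notin> K \<longrightarrow> \<psi> x = 0))"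

definition locally_integrable :: "(real \<Rightarrow> real) \<Rightarrow> bool" where
  "locally_integrable f \<longleftrightarrow> (\<forall>a b. set_integrable lborel {a..b} f)"

definition has_weak_deriv :: "(real \<Rightarrow> real) \<Rightarrow> (real \<Rightarrow> real) \<Rightarrow> bool" where
  "has_weak_deriv f g \<longleftrightarrow>
     locally_integrable f \<and> locally_integrable g \<and>
     (\<forall>\<psi>. test_function UNIV \<psi> \<longrightarrow>
        (LINT x|lborel. f x * deriv \<psi> x) = - (LINT x|lborel. g x * \<psi> x))"

definition weak_deriv :: "(real \<Rightarrow> real) \<Rightarrow> real \<Rightarrow> real" where
  "weak_deriv f = (SOME g. has_weak_deriv f g)"

section \<open>Solutions of the system\<close>

text \<open>\<open>q\<^sub>t + f\<^sub>x + g = 0\<close> in the sense of distributions on the open strip.\<close>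

definition weak_balance_law ::
    "ereal \<Rightarrow> (real \<Rightarrow> real \<Rightarrow> real) \<Rightarrow> (real \<Rightarrow> real \<Rightarrow> real) \<Rightarrow> (real \<Rightarrow> real \<Rightarrow> real) \<Rightarrow> bool" where
  "weak_balance_law T q f g \<longleftrightarrow>
     (\<forall>\<psi> :: real \<times> real \<Rightarrow> real. test_function ({t. 0 < t \<and> ereal t < T} \<times> UNIV) \<psi> \<longrightarrow>
        (LINT t|lborel. LINT x|lborel.
             q t x * deriv (\<lambda>\<tau>. \<psi> (\<tau>, x)) t + f t x * deriv (\<lambda>y. \<psi> (t, y)) x
             - g t x * \<psi> (t, x)) = 0)"

definition momentum :: "(real \<Rightarrow> real \<Rightarrow> real) \<Rightarrow> real \<Rightarrow> real \<Rightarrow> real" where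
  "momentum u t x = u t x - weak_deriv (weak_deriv (u t)) x"

text \<open>
  Since \<open>m\<close> and \<open>n\<close> are merely of class \<open>H\<^sup>s\<^sup>-\<^sup>2\<close>, the distribution \<open>uvm\<^sub>x\<close> is read as
  \<open>(uvm)\<^sub>x - (uv)\<^sub>xm\<close>, and likewise \<open>uvn\<^sub>x\<close>.
\<close>

definition is_solution ::
    "real \<Rightarrow> ereal \<Rightarrow> (real \<Rightarrow> real) \<Rightarrow> (real \<Rightarrow> real) \<Rightarrow> (real \<Rightarrow> real) \<Rightarrow>
     (real \<Rightarrow> real \<Rightarrow> real) \<Rightarrow> (real \<Rightarrow> real \<Rightarrow> real) \<Rightarrow> (real \<Rightarrow> real \<Rightarrow> real) \<Rightarrow> bool" where
  "is_solution s T \<rho>0 u0 v0 \<rho> u v \<longleftrightarrow>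
     continuous_in_sobolev T (s - 1) \<rho> \<and>
     continuous_in_sobolev T s u \<and>
     continuous_in_sobolev T s v \<and>
     (AE x in lborel. \<rho> 0 x = \<rho>0 x \<and> u 0 x = u0 x \<and> v 0 x = v0 x) \<and>
     weak_balance_law T \<rho> (\<lambda>t x. \<rho> t x * u t x * v t x) (\<lambda>t x. 0) \<and>
     weak_balance_law T (momentum u) (\<lambda>t x. u t x * v t x * momentum u t x)
       (\<lambda>t x. - weak_deriv (\<lambda>y. u t y * v t y) x * momentum u t x
              + 3 * v t x * weak_deriv (u t) x * momentum u t x + (\<rho> t x)\<^sup>2 * u t x) \<and>
     weak_balance_law T (momentum v) (\<lambda>t x. u t x * v t x * momentum v t x)
       (\<lambda>t x. - weak_deriv (\<lambda>y. u t y * v t y) x * momentum v t x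
              + 3 * weak_deriv (v t) x * u t x * momentum v t x - (\<rho> t x)\<^sup>2 * v t x)"

definition lifespan ::
    "real \<Rightarrow> (real \<Rightarrow> real) \<Rightarrow> (real \<Rightarrow> real) \<Rightarrow> (real \<Rightarrow> real) \<Rightarrow> ereal" where
  "lifespan s \<rho>0 u0 v0 = Sup {T. 0 < T \<and> (\<exists>\<rho> u v. is_solution s T \<rho>0 u0 v0 \<rho> u v)}"

definition sobolev_bound ::
    "real \<Rightarrow> real \<Rightarrow> (real \<Rightarrow> real \<Rightarrow> real) \<Rightarrow> (real \<Rightarrow> real \<Rightarrow> real) \<Rightarrow> (real \<Rightarrow> real \<Rightarrow> real) \<Rightarrow> real" where
  "sobolev_bound s T0 \<rho> u v =
     (SUP t\<in>{0..T0}. sobolev_norm (s - 1) (\<rho> t) + sobolev_norm s (u t) + sobolev_norm s (v t))"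

section \<open>Weights\<close>

definition Linf_norm :: "(real \<Rightarrow> real) \<Rightarrow> ereal" where
  "Linf_norm f = esssup lborel (\<lambda>x. ereal \<bar>f x\<bar>)"

definition weighted_Linf_norm :: "real \<Rightarrow> (real \<Rightarrow> real) list \<Rightarrow> ereal" where
  "weighted_Linf_norm \<beta> fs = (\<Sum>f\<leftarrow>fs. Linf_norm (\<lambda>x. f x * (1 + \<beta> + \<bar>x\<bar>) powr \<beta>))"

definition truncated_weight :: "real \<Rightarrow> real \<Rightarrow> real \<Rightarrow> real" where
  "truncated_weight \<beta> N x =
     (if \<bar>x\<bar> < N then (1 + \<beta> + \<bar>x\<bar>) powr \<beta> else (1 + \<beta> + N) powr \<beta>)"

definition is_weight_constant :: "real \<Rightarrow> real \<Rightarrow> bool" where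
  "is_weight_constant \<beta> C \<longleftrightarrow>
     (\<forall>N>0. \<forall>x. truncated_weight \<beta> N x *
        (LINT y|lborel. exp (- \<bar>x - y\<bar>) / truncated_weight \<beta> N y) \<le> C)"

end

theory Submission
  imports Defs
begin

text \<open>
  The momenta \<open>m\<close>, \<open>n\<close> and the density \<open>\<rho>\<close> (together with \<open>\<rho>\<^sub>x\<close>) are transported by the velocity
  \<open>uv\<close>: along a characteristic \<open>X' = uv(t, X)\<close> they satisfy linear differential equations whose
  coefficients are bounded by Sobolev embedding. On a short time interval the characteristics move so
  little that the weight changes at most by a factor of two, and the unknowns grow at most by a
  factor of two; hence weighted bounds of the data persist with an absolute constant, without
  Gronwall's inequality and without truncating the weight. Finally \<open>u \<plusminus> u\<^sub>x\<close> are the one-sided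
  convolutions of \<open>m\<close> with \<open>e\<^sup>-\<^sup>|\<^sup>x\<^sup>|\<close>, which is where \<open>C\<^sub>\<beta>\<close> enters.

  The equations hold in the sense of distributions and \<open>m\<close> is merely continuous. Testing with
  products turns them into exact balance laws on space-time rectangles, and the equation along a
  characteristic is obtained by differentiating the mean value over \<open>[X - r, X + r]\<close> and letting
  \<open>r\<close> tend to \<open>0\<close>.
\<close>

section \<open>Smooth test functions\<close>

text \<open>The statement leaves \<open>T0\<close> free, so the interval may shrink with the
  solution and with \<beta> while the bounds keep absolute factors. What is absorbed is the maximum
  of |q| along one characteristic over a compact time interval; it is finite by continuity, whereas
  the weighted supremum over the line is not known to be finite beforehand. The order of the
  estimates follows the coupling. \<rho> satisfies a linear equation of its own; its weighted bound
  then enters as a known source, through \<rho>^2 u and \<rho>^2 v in the equations of the momenta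
  and through (uv)_xx \<rho> in that of \<rho>_x. At s > 5/2 Sobolev embedding makes \<rho> of class
  C^1 and u, v of class C^2, uniformly in x and continuously in t, so that m and n are continuous
  functions that need not be differentiable. In the recovery of u and u_x from m the point x is
  fixed, and the level |x| + 1 of truncation is adapted to it: there the truncated weight is the
  full one, and elsewhere it lies below the full one.\<close>

lemma C_k_Suc_imp: "C_k (Suc k) f \<Longrightarrow> C_k k f"
proof (induction k arbitrary: f)
  case 0
  then show ?case
    by (auto intro!: continuous_at_imp_continuous_on intro: has_derivative_continuous)
next
  case (Suc k)
  then show ?case by (metis C_k.simps(2))
qed

lemma C_k_continuous: "C_k k f \<Longrightarrow> continuous_on UNIV f"
  by (induction k) (auto simp del: C_k.simps(2) dest: C_k_Suc_imp)

lemma C_k_const [simp]: "C_k k (\<lambda>x. c)"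
proof (induction k arbitrary: c)
  case (Suc k)
  then show ?case by (auto intro!: exI[of _ "\<lambda>x h. 0"])
qed auto

lemma C_k_add: "C_k k f \<Longrightarrow> C_k k g \<Longrightarrow> C_k k (\<lambda>x. f x + g x)"
proof (induction k arbitrary: f g)
  case 0 then show ?case by (auto intro: continuous_on_add)
next
  case (Suc k)
  obtain f' where f: "\<And>x. (f has_derivative f' x) (at x)" "\<And>h. C_k k (\<lambda>x. f' x h)"
    using Suc.prems(1) by auto
  obtain g' where g: "\<And>x. (g has_derivative g' x) (at x)" "\<And>h. C_k k (\<lambda>x. g' x h)"
    using Suc.prems(2) by auto
  show ?case unfolding C_k.simps
    by (rule exI[of _ "\<lambda>x h. f' x h + g' x h"]) (auto intro!: has_derivative_add f g Suc.IH)
qed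

lemma C_k_mult: "C_k k f \<Longrightarrow> C_k k g \<Longrightarrow> C_k k (\<lambda>x. f x * g x)"
proof (induction k arbitrary: f g)
  case 0 then show ?case by (auto intro: continuous_on_mult)
next
  case (Suc k)
  obtain f' where f: "\<And>x. (f has_derivative f' x) (at x)" "\<And>h. C_k k (\<lambda>x. f' x h)"
    using Suc.prems(1) by auto
  obtain g' where g: "\<And>x. (g has_derivative g' x) (at x)" "\<And>h. C_k k (\<lambda>x. g' x h)"
    using Suc.prems(2) by auto
  show ?case unfolding C_k.simps
    by (rule exI[of _ "\<lambda>x h. f x * g' x h + f' x h * g x"])
      (auto intro!: has_derivative_mult f g Suc.IH C_k_add C_k_Suc_imp[OF Suc.prems(1)] C_k_Suc_imp[OF Suc.prems(2)])
qed

text \<open>\<open>L\<close> will be multiplication by a real number, for rescaled steps, or a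
  coordinate projection, for test functions in the plane.\<close>

lemma C_k_compose_affine:
  fixes L :: "'a::euclidean_space \<Rightarrow> 'b::euclidean_space"
  assumes "bounded_linear L"
  shows "C_k k f \<Longrightarrow> C_k k (\<lambda>x. f (L x + d))"
proof (induction k arbitrary: f)
  case 0
  then show ?case
    by (auto intro!: continuous_on_compose2[of UNIV f] continuous_on_add continuous_on_const
        linear_continuous_on[OF assms])
next
  case (Suc k)
  obtain f' where f: "\<And>x. (f has_derivative f' x) (at x)" "\<And>h. C_k k (\<lambda>x. f' x h)"
    using Suc.prems(1) by auto
  have "((\<lambda>x. f (L x + d)) has_derivative (\<lambda>h. f' (L x + d) (L h))) (at x)" for x
    by (rule has_derivative_compose[where f="\<lambda>x. L x + d" and g=f])
      (auto intro!: derivative_eq_intros f bounded_linear_imp_has_derivative[OF assms])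
  then show ?case unfolding C_k.simps
    by (intro exI[of _ "\<lambda>x h. f' (L x + d) (L h)"]) (auto intro!: Suc.IH f)
qed

lemma C_k_affine_real: "C_k k f \<Longrightarrow> C_k k (\<lambda>x::real. f (c * x + d))" for f :: "real \<Rightarrow> real"
  by (rule C_k_compose_affine) (auto intro: bounded_linear_mult_right)

lemma C_k_Suc_realI:
  fixes f f' :: "real \<Rightarrow> real"
  assumes "\<And>x. DERIV f x :> f' x" "C_k k f'"
  shows "C_k (Suc k) f"
  unfolding C_k.simps
  by (rule exI[of _ "\<lambda>x h. f' x * h"])
    (use assms in \<open>auto simp: has_field_derivative_def intro!: C_k_mult\<close>)

text \<open>A linear map on the reals is multiplication by its value at 1; hence the derivative
  hidden in the existential of \<open>C_k\<close> is \<open>deriv f\<close>.\<close>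

lemma C_k_Suc_realD:
  fixes f :: "real \<Rightarrow> real"
  assumes "C_k (Suc k) f"
  shows "f differentiable at x" "C_k k (deriv f)" "DERIV f x :> deriv f x"
proof -
  obtain f' where f: "\<And>x. (f has_derivative f' x) (at x)" "\<And>h. C_k k (\<lambda>x. f' x h)"
    using assms by auto
  have D: "DERIV f x :> f' x 1" for x
  proof -
    interpret bounded_linear "f' x" using f(1) by (rule has_derivative_bounded_linear)
    have "f' x h = f' x 1 * h" for h using scaleR[of h 1] by simp
    then have "f' x = (*) (f' x 1)" by (rule ext)
    with f(1)[of x] show ?thesis by (simp add: has_field_derivative_def)
  qed
  then have "deriv f = (\<lambda>x. f' x 1)" by (auto intro: DERIV_imp_deriv)
  then show "f differentiable at x" "C_k k (deriv f)" "DERIV f x :> deriv f x"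
    using f D by (auto simp: real_differentiable_def)
qed

section \<open>A smooth step function built from exp(-1/x)\<close>

text \<open>The exponent n is carried along because the derivatives of exp(-1/x) are combinations of
  these functions: the family is closed under differentiation, so smoothness follows for all n at
  once by induction on the order.\<close>

definition flat :: "nat \<Rightarrow> real \<Rightarrow> real" where
  "flat n x = (if x > 0 then (1 / x) ^ n * exp (- (1 / x)) else 0)"

lemma flat_tendsto_0: "(flat n \<longlongrightarrow> 0) (at 0)"
proof -
  have "((\<lambda>x::real. x ^ n / exp x) \<longlongrightarrow> 0) at_top" by (rule tendsto_power_div_exp_0)
  then have "((\<lambda>x::real. (inverse x) ^ n / exp (inverse x)) \<longlongrightarrow> 0) (at_right 0)"
    by (rule filterlim_compose[OF _ filterlim_inverse_at_top_right])
  then have R: "(flat n \<longlongrightarrow> 0) (at_right 0)"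
    by (rule tendsto_cong[THEN iffD1, rotated])
      (auto simp: eventually_at_filter flat_def exp_minus field_simps)
  have L: "(flat n \<longlongrightarrow> 0) (at_left 0)"
    by (rule tendsto_eventually) (auto simp: eventually_at_filter flat_def)
  show ?thesis using L R by (simp add: filterlim_split_at)
qed

lemma flat_deriv: "DERIV (flat n) x :> - real n * flat (Suc n) x + flat (n + 2) x"
proof -
  consider "x > 0" | "x < 0" | "x = 0" by linarith
  then show ?thesis
  proof cases
    case 1
    have "DERIV (\<lambda>x. (1 / x) ^ n * exp (- (1 / x))) x :> - real n * flat (Suc n) x + flat (n + 2) x"
    proof -
      have D: "DERIV (\<lambda>x. 1 / x) x :> - ((1 / x) * (1 / x))"
        using 1 by (auto intro!: derivative_eq_intros simp: field_simps)
      have "DERIV (\<lambda>x. (1 / x) ^ n * exp (- (1 / x))) x :>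
          (real n * (- ((1 / x) * (1 / x)) * (1 / x) ^ (n - Suc 0))) * exp (- (1 / x))
          + (exp (- (1 / x)) * - (- ((1 / x) * (1 / x)))) * (1 / x) ^ n"
        by (intro DERIV_mult DERIV_power D DERIV_fun_exp DERIV_minus)
      \<comment> \<open>For n = 0 the exponent \<open>n - Suc 0\<close> is cut off at 0, but the
        factor \<open>real n\<close> removes that term.\<close>
      moreover have "(real n * (- (y * y) * y ^ (n - Suc 0))) * E + (E * - (- (y * y))) * y ^ n
          = - real n * (y ^ Suc n * E) + y ^ (n + 2) * E" for y E :: real
        by (cases n) (simp_all add: algebra_simps)
      ultimately show ?thesis using 1 by (simp only: flat_def if_True)
    qed
    then show ?thesis
      by (rule DERIV_cong_ev[THEN iffD1, rotated 3])
        (use 1 eventually_nhds_in_open[of "{0<..}" x] in \<open>auto simp: flat_def elim!: eventually_mono\<close>)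
  next
    case 2
    have "DERIV (\<lambda>x. 0) x :> - real n * flat (Suc n) x + flat (n + 2) x"
      using 2 by (auto simp: flat_def)
    then show ?thesis
      by (rule DERIV_cong_ev[THEN iffD1, rotated 3])
        (use 2 eventually_nhds_in_open[of "{..<0}" x] in \<open>auto simp: flat_def elim!: eventually_mono\<close>)
  next
    case 3
    \<comment> \<open>The difference quotient of \<open>flat n\<close> at 0 is
      \<open>flat (Suc n)\<close> itself, so differentiability at 0 is the limit already
      established.\<close>
    have "((\<lambda>y. (flat n y - flat n 0) / (y - 0)) \<longlongrightarrow> 0) (at 0)"
      by (rule tendsto_cong[THEN iffD1, rotated, OF flat_tendsto_0[of "Suc n"]])
        (auto simp: eventually_at_filter flat_def)
    then show ?thesis using 3 by (simp add: has_field_derivative_iff flat_def)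
  qed
qed

lemma C_k_flat: "C_k k (flat n)"
proof (induction k arbitrary: n)
  case 0
  show ?case using flat_deriv by (auto intro!: continuous_at_imp_continuous_on DERIV_isCont)
next
  case (Suc k)
  show ?case
    by (rule C_k_Suc_realI[OF flat_deriv]) (intro C_k_add C_k_mult C_k_const Suc.IH)
qed

text \<open>The step takes place in \<open>[1, 2]\<close>, away from \<open>0\<close>, so that its rescalings at the end points of an interval
  are supported inside the open interval.\<close>

lemma smooth_step_exists:
  obtains S J :: "real \<Rightarrow> real" where
    "\<And>k. C_k k S" "\<And>x. DERIV S x :> J x" "continuous_on UNIV J" "\<And>x. 0 \<le> J x"
    "\<And>x. x \<notin> {1..2} \<Longrightarrow> J x = 0" "\<And>x. x \<le> 1 \<Longrightarrow> S x = 0" "\<And>x. 2 \<le> x \<Longrightarrow> S x = 1"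
    "\<And>x. 0 \<le> S x" "\<And>x. S x \<le> 1"
proof -
  \<comment> \<open>B is positive exactly between 1 and 2; the step \<open>S\<close> is its
    normalised primitive and \<open>J\<close> the normalised bump.\<close>
  define B where "B x = flat 0 (x - 1) * flat 0 (2 - x)" for x
  have Bk: "C_k k B" for k
    using C_k_mult[OF C_k_affine_real[OF C_k_flat[of k 0], of 1 "-1"] C_k_affine_real[OF C_k_flat[of k 0], of "-1" 2]]
    by (simp add: B_def[abs_def])
  have B0: "B x \<ge> 0" for x by (auto simp: B_def flat_def)
  have Bpos: "B x > 0" if "1 < x" "x < 2" for x using that by (auto simp: B_def flat_def)
  have Bz: "B x = 0" if "x \<le> 1 \<or> 2 \<le> x" for x using that by (auto simp: B_def flat_def)
  have Bc: "isCont B x" for x using C_k_continuous[OF Bk[of 0]] by (simp add: continuous_on_eq_continuous_at)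
  obtain F where F: "\<And>x. DERIV F x :> B x"
    using einterval_antiderivative[of "-\<infinity>" \<infinity> B] Bc
    by (auto simp: has_real_derivative_iff_has_vector_derivative)
  have mono: "F x \<le> F y" if "x \<le> y" for x y
    by (rule DERIV_nonneg_imp_nondecreasing[OF that]) (meson F B0)
  have Fcont: "continuous_on X F" for X
    using F by (meson DERIV_isCont continuous_at_imp_continuous_on)
  have lo: "F x = F 1" if "x \<le> 1" for x
  proof (cases "x = 1")
    case False
    have "F 1 = F x"
    proof (rule DERIV_isconst2[of x 1 F 1])
      show "DERIV F y :> 0" if "x < y" "y < 1" for y using F[of y] Bz[of y] that by simp
    qed (use that False Fcont in auto)
    then show ?thesis by simp
  qed simp
  have hi: "F x = F 2" if "x \<ge> 2" for x
  proof (cases "x = 2")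
    case False
    show ?thesis
    proof (rule DERIV_isconst2[of 2 x F x])
      show "DERIV F y :> 0" if "2 < y" "y < x" for y using F[of y] Bz[of y] that by simp
    qed (use that False Fcont in auto)
  qed simp
  \<comment> \<open>B vanishes at 1 and 2, so strict growth is taken on an inner interval and
    carried outwards by monotonicity.\<close>
  have "F (5/4) < F (7/4)"
  proof (rule DERIV_pos_imp_increasing[where f=F])
    show "\<exists>y. DERIV F x :> y \<and> 0 < y" if "5/4 \<le> x" "x \<le> 7/4" for x
      using F[of x] Bpos[of x] that by auto
  qed simp
  then have pos: "F 2 - F 1 > 0" using mono[of 1 "5/4"] mono[of "7/4" 2] by simp
  define S where "S x = (F x - F 1) / (F 2 - F 1)" for x
  define J where "J x = B x / (F 2 - F 1)" for x
  have SD: "DERIV S x :> J x" for x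
    unfolding S_def J_def using DERIV_cdivide[OF DERIV_diff[OF F DERIV_const]] by simp
  have Jk: "C_k k J" for k
    using C_k_mult[OF Bk[of k] C_k_const[of k "1 / (F 2 - F 1)"]] by (simp add: J_def[abs_def])
  have Sk: "C_k k S" for k
    by (rule C_k_Suc_imp[OF C_k_Suc_realI[OF SD Jk]])
  have S01: "0 \<le> S x \<and> S x \<le> 1" for x
  proof -
    have "F 1 \<le> F x" using lo[of x] mono[of 1 x] by (metis linorder_linear order_refl)
    moreover have "F x \<le> F 2" using hi[of x] mono[of x 2] by (metis linorder_linear order_refl)
    ultimately show ?thesis using pos by (simp add: S_def)
  qed
  show ?thesis
  proof (rule that[OF Sk SD C_k_continuous[OF Jk[of 0]]])
    show "0 \<le> J x" for x using pos B0[of x] by (simp add: J_def)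
    show "J x = 0" if "x \<notin> {1..2}" for x using Bz[of x] that by (auto simp: J_def)
    show "S x = 0" if "x \<le> 1" for x unfolding S_def by (subst lo[OF that]) simp
    show "S x = 1" if "2 \<le> x" for x unfolding S_def by (subst hi[OF that]) (use pos in simp)
    show "0 \<le> S x" "S x \<le> 1" for x using S01[of x] by auto
  qed
qed

section \<open>Approximate indicators and the du Bois-Reymond lemma\<close>

text \<open>The half-lines {..c} are stable under intersection and generate the Borel sets, so by
  Dynkin's argument the integral vanishes over every Borel set. Truncation to [-n, n] makes w
  integrable, as the passage to complements requires.\<close>

lemma AE_zero_if_interval_integrals_zero:
  fixes w :: "real \<Rightarrow> real"
  assumes w: "\<And>a b. set_integrable lborel {a..b} w"
    and z: "\<And>a b. a < b \<Longrightarrow> (LINT x:{a..b}|lborel. w x) = 0"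
  shows "AE x in lborel. w x = 0"
proof -
  have n0: "AE x in lborel. indicator {-real n..real n} x * w x = 0" for n :: nat
  proof (rule sigma_finite_measure.density_zero[OF lborel.sigma_finite_measure_axioms])
    define v where "v x = indicator {-real n..real n} x * w x" for x
    have vi: "integrable lborel v"
      using w[of "-real n" "real n"] by (simp add: set_integrable_def v_def[abs_def])
    then show "integrable lborel (\<lambda>x. indicator {-real n..real n} x * w x)" by (simp add: v_def[abs_def])
    have tot: "(LINT x:{..c}|lborel. v x) = 0" for c
    proof -
      have "(LINT x:{..c}|lborel. v x) = (LINT x:{-real n..min c (real n)}|lborel. w x)"
        unfolding set_lebesgue_integral_def v_def
        by (intro Bochner_Integration.integral_cong) (auto simp: indicator_def)
      also have "\<dots> = 0"
      proof (cases "-real n < min c (real n)")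
        case False
        \<comment> \<open>Such an interval is empty or consists of the point -n alone.\<close>
        have "AE x in lborel. indicator {-real n..min c (real n)} x *\<^sub>R w x = 0"
          using AE_lborel_singleton[of "-real n"]
          by eventually_elim (use False in \<open>auto simp: indicator_def\<close>)
        then show ?thesis unfolding set_lebesgue_integral_def by (rule integral_eq_zero_AE)
      qed (use z in auto)
      finally show ?thesis .
    qed
    have int: "set_integrable lborel B v" if "B \<in> sets borel" for B
      unfolding set_integrable_def using that vi by (intro integrable_mult_indicator) auto
    have U: "(LINT x|lborel. v x) = 0"
      using tot[of "real n"] unfolding set_lebesgue_integral_def
      by (subst Bochner_Integration.integral_cong[OF refl, of _ _ "\<lambda>x. indicator {..real n} x *\<^sub>R v x"])
        (auto simp: v_def indicator_def)
    have st: "Int_stable (range (atMost :: real \<Rightarrow> _))" by (auto simp: Int_stable_def)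
    have sub: "range (atMost :: real \<Rightarrow> _) \<subseteq> Pow UNIV" by simp
    have "A \<in> sigma_sets UNIV (range atMost) \<Longrightarrow> (LINT x:A|lborel. v x) = 0" for A :: "real set"
    proof (induction A rule: sigma_sets_induct_disjoint[OF st sub, consumes 1, case_names basic empty compl union])
      case (basic A) then show ?case using tot by auto
    next
      case empty show ?case by (simp add: set_lebesgue_integral_def)
    next
      case (compl A)
      then have A: "A \<in> sets borel" unfolding borel_eq_atMost by simp
      have "(LINT x:UNIV|lborel. v x) = (LINT x:A|lborel. v x) + (LINT x:UNIV - A|lborel. v x)"
        using set_integral_Un[of A "UNIV - A" lborel v] int A by (simp add: Un_absorb1 set_integral_Un)
      then show ?case using compl U by (simp add: set_lebesgue_integral_def[of _ UNIV])
    next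
      case (union A)
      then have A: "A i \<in> sets borel" for i unfolding borel_eq_atMost by auto
      have "(LINT x:(\<Union>i. A i)|lborel. v x) = (\<Sum>i. (LINT x:A i|lborel. v x))"
        by (rule lebesgue_integral_countable_add)
          (use A union int in \<open>auto simp: disjoint_family_on_def\<close>)
      then show ?case using union by simp
    qed
    then show "A \<in> sets lborel \<Longrightarrow> (LINT x:A|lborel. indicator {-real n..real n} x * w x) = 0" for A
      unfolding v_def by (simp add: borel_eq_atMost)
  qed
  have "AE x in lborel. \<forall>n::nat. indicator {-real n..real n} x * w x = 0"
    unfolding AE_all_countable using n0 by blast
  then show ?thesis
  proof eventually_elim
    case (elim x)
    obtain n where "\<bar>x\<bar> \<le> real n" using real_arch_simple by blast
    then show ?case using elim[rule_format, of n] by (auto simp: indicator_def)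
  qed
qed

text \<open>Off the compact set that carries the function, it vanishes in a whole neighbourhood of
  each point, so the derivative vanishes there too. Products with \<open>deriv \<psi>\<close> are
  thus confined to the same set as products with \<psi>.\<close>

lemma test_function_realD:
  fixes \<psi> :: "real \<Rightarrow> real"
  assumes "test_function S \<psi>"
  shows "DERIV \<psi> x :> deriv \<psi> x" "continuous_on UNIV \<psi>" "continuous_on UNIV (deriv \<psi>)"
    "\<exists>R>0. \<forall>x. \<bar>x\<bar> \<ge> R \<longrightarrow> \<psi> x = 0 \<and> deriv \<psi> x = 0"
    "x \<notin> S \<Longrightarrow> \<psi> x = 0" "x \<notin> S \<Longrightarrow> deriv \<psi> x = 0"
proof -
  obtain K where K: "compact K" "K \<subseteq> S" "\<And>x. x \<notin> K \<Longrightarrow> \<psi> x = 0" and k: "\<And>k. C_k k \<psi>"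
    using assms by (auto simp: test_function_def)
  show D: "DERIV \<psi> x :> deriv \<psi> x" for x using C_k_Suc_realD(3)[OF k] .
  show "continuous_on UNIV \<psi>" using C_k_continuous[OF k] .
  show "continuous_on UNIV (deriv \<psi>)" using C_k_continuous[OF C_k_Suc_realD(2)[OF k]] .
  have z: "\<psi> x = 0 \<and> deriv \<psi> x = 0" if "x \<notin> K" for x
  proof
    show "\<psi> x = 0" using K that by auto
    have "open (- K)" using K(1) by (auto dest: compact_imp_closed)
    then have "\<forall>\<^sub>F y in nhds x. \<psi> y = 0"
      using eventually_nhds_in_open[of "-K" x] that K(3) by (auto elim!: eventually_mono)
    then have "DERIV \<psi> x :> 0 \<longleftrightarrow> DERIV (\<lambda>x. 0) x :> (0::real)"
      by (intro DERIV_cong_ev) auto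
    then show "deriv \<psi> x = 0" by (simp add: DERIV_imp_deriv)
  qed
  then show "x \<notin> S \<Longrightarrow> \<psi> x = 0" "x \<notin> S \<Longrightarrow> deriv \<psi> x = 0" using K(2) by auto
  obtain B where B: "\<And>x. x \<in> K \<Longrightarrow> norm x \<le> B" "B > 0"
    using compact_imp_bounded[OF K(1)] by (auto simp: bounded_pos)
  have "\<psi> x = 0 \<and> deriv \<psi> x = 0" if "\<bar>x\<bar> \<ge> B + 1" for x
    using z[of x] B(1)[of x] that by force
  then show "\<exists>R>0. \<forall>x. \<bar>x\<bar> \<ge> R \<longrightarrow> \<psi> x = 0 \<and> deriv \<psi> x = 0"
    using B(2) by (intro exI[of _ "B + 1"]) auto
qed

text \<open>The construction is a rising step near a plus a falling step near b, minus one. Its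
  derivative is a unit mass concentrating at a minus one concentrating at b, which yields
  \<open>f a - f b\<close>, while the functions themselves fill up the interval.\<close>

lemma approximate_indicator:
  fixes a b :: real
  assumes "a < b"
  obtains \<theta> where
    "\<And>n::nat. test_function {a<..<b} (\<theta> n)"
    "\<And>n x. \<bar>\<theta> n x\<bar> \<le> 1"
    "\<And>x. a < x \<Longrightarrow> x < b \<Longrightarrow> (\<lambda>n. \<theta> n x) \<longlonglongrightarrow> 1"
    "\<And>f B. continuous_on UNIV f \<Longrightarrow> (\<And>x. \<bar>f x\<bar> \<le> B) \<Longrightarrow>
        (\<lambda>n. LINT x|lborel. f x * deriv (\<theta> n) x) \<longlonglongrightarrow> f a - f b"
    "\<And>g. set_integrable lborel {a..b} g \<Longrightarrow>
        (\<lambda>n. LINT x|lborel. g x * \<theta> n x) \<longlonglongrightarrow> (LINT x:{a..b}|lborel. g x)"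
proof -
  obtain S J :: "real \<Rightarrow> real" where S: "\<And>k. C_k k S" and SD: "\<And>x. DERIV S x :> J x"
    and Jc: "continuous_on UNIV J" and J0: "\<And>x. 0 \<le> J x" and Jz: "\<And>x. x \<notin> {1..2} \<Longrightarrow> J x = 0"
    and S1: "\<And>x. x \<le> 1 \<Longrightarrow> S x = 0" and S2: "\<And>x. 2 \<le> x \<Longrightarrow> S x = 1"
    and S01: "\<And>x. 0 \<le> S x" "\<And>x. S x \<le> 1"
    using smooth_step_exists by metis
  \<comment> \<open>The two arguments of \<open>S\<close> in \<theta> add up to m (b - a) \<ge> 4,
    so at every point one of the two steps has already reached 1 and the other alone decides the
    value.\<close>
  obtain n0 :: nat where "4 / (b - a) \<le> real n0" using real_arch_simple by blast
  then have n0: "4 \<le> real n0 * (b - a)" using assms by (simp add: field_simps)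
  define m where "m n = real (Suc (n + n0))" for n
  have m0: "m n > 0" for n by (simp add: m_def)
  have m_lim: "filterlim m at_top sequentially"
    unfolding m_def using filterlim_sequentially_Suc[THEN iffD2, OF
        filterlim_tendsto_add_at_top[OF tendsto_const[of "real n0"] filterlim_real_sequentially]]
    by (simp add: ac_simps)
  have mba: "4 \<le> m n * (b - a)" for n
  proof -
    have "real n0 * (b - a) \<le> m n * (b - a)" using assms by (intro mult_right_mono) (auto simp: m_def)
    then show ?thesis using n0 by linarith
  qed
  define \<theta> where "\<theta> n x = S (m n * x + (- (m n * a))) + (S ((- m n) * x + m n * b) + -1)" for n x
  define \<theta>' where "\<theta>' n x = m n * J (m n * (x - a)) - m n * J (m n * (b - x))" for n x
  have J_meas [measurable]: "J \<in> borel_measurable borel"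
    using Jc by (rule borel_measurable_continuous_onI)
  have Jint: "has_bochner_integral lborel (\<lambda>x. indicator {1..2} x *\<^sub>R J x) (S 2 - S 1)"
    by (rule has_bochner_integral_FTC_Icc[where F=S])
      (use continuous_on_subset[OF Jc] has_field_derivative_at_within[OF SD] in
        \<open>simp_all add: has_real_derivative_iff_has_vector_derivative\<close>)
  have "(\<lambda>x. indicator {1..2} x *\<^sub>R J x) = J" using Jz by (auto simp: indicator_def fun_eq_iff)
  with Jint have Ji: "integrable lborel J" "(LINT x|lborel. J x) = 1"
    using S1[of 1] S2[of 2] by (auto simp: has_bochner_integral_iff)
  have \<theta>D: "DERIV (\<theta> n) x :> \<theta>' n x" for n x
    unfolding \<theta>_def \<theta>'_def
    by (auto intro!: derivative_eq_intros DERIV_chain2[where f=S, OF SD] simp: algebra_simps)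
  then have d: "deriv (\<theta> n) = \<theta>' n" for n by (auto intro: DERIV_imp_deriv)
  have test: "test_function {a<..<b} (\<theta> n)" for n
      unfolding test_function_def
    proof (intro conjI allI exI)
      show "C_k k (\<theta> n)" for k
        unfolding \<theta>_def by (intro C_k_add C_k_const C_k_affine_real S)
      show "compact {a + 1 / m n..b - 1 / m n}" by simp
      have "0 < 1 / m n" using m0[of n] by simp
      then show "{a + 1 / m n..b - 1 / m n} \<subseteq> {a<..<b}"
        unfolding subset_iff atLeastAtMost_iff greaterThanLessThan_iff by linarith
      show "x \<notin> {a + 1 / m n..b - 1 / m n} \<longrightarrow> \<theta> n x = 0" for x
      proof
        assume "x \<notin> {a + 1 / m n..b - 1 / m n}"
        then consider "m n * (x - a) \<le> 1" | "m n * (b - x) \<le> 1"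
          using m0[of n] by (fastforce simp: field_simps)
        then show "\<theta> n x = 0"
        proof cases
          case 1
          then have "m n * (b - x) \<ge> 2" using mba[of n] by (simp add: algebra_simps)
          with 1 show ?thesis unfolding \<theta>_def
            by (subst S1, simp add: algebra_simps, subst S2, auto simp: algebra_simps)
        next
          case 2
          then have "m n * (x - a) \<ge> 2" using mba[of n] by (simp add: algebra_simps)
          with 2 show ?thesis unfolding \<theta>_def
            by (subst S2, simp add: algebra_simps, subst S1, auto simp: algebra_simps)
        qed
      qed
    qed
  have le1: "\<bar>\<theta> n x\<bar> \<le> 1" for n x
      using S01[of "m n * x + (- (m n * a))"] S01[of "(- m n) * x + m n * b"] unfolding \<theta>_def by linarith
  have minf: "filterlim (\<lambda>n. m n * c) at_top sequentially" if "c > 0" for c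
      using filterlim_tendsto_pos_mult_at_top[OF tendsto_const[of c] that m_lim] by (simp add: mult.commute)
  have to1: "(\<lambda>n. \<theta> n x) \<longlonglongrightarrow> 1" if "a < x" "x < b" for x
    proof (rule tendsto_eventually)
      have "\<forall>\<^sub>F n in sequentially. 2 \<le> m n * (x - a) \<and> 2 \<le> m n * (b - x)"
        using minf[of "x - a"] minf[of "b - x"] that by (auto simp: filterlim_at_top eventually_conj_iff)
      then show "\<forall>\<^sub>F n in sequentially. \<theta> n x = 1"
      proof eventually_elim
        case (elim n)
        then show ?case unfolding \<theta>_def
          by (subst S2, simp add: algebra_simps, subst S2, auto simp: algebra_simps)
      qed
    qed
  show ?thesis
  proof (rule that[OF test le1 to1])
    show "(\<lambda>n. LINT x|lborel. g x * \<theta> n x) \<longlonglongrightarrow> (LINT x:{a..b}|lborel. g x)"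
      if g: "set_integrable lborel {a..b} g" for g
    proof -
      have gi: "integrable lborel (\<lambda>x. indicator {a..b} x *\<^sub>R g x)" using g by (simp add: set_integrable_def)
      have [measurable]: "\<theta> n \<in> borel_measurable borel" for n
        using test_function_realD(2)[OF test] by (rule borel_measurable_continuous_onI)
      have z: "\<theta> n x = 0" if "x \<notin> {a<..<b}" for n x using test_function_realD(5)[OF test that] .
      have "(\<lambda>n. LINT x|lborel. (indicator {a..b} x *\<^sub>R g x) * \<theta> n x) \<longlonglongrightarrow> (LINT x:{a..b}|lborel. g x)"
        unfolding set_lebesgue_integral_def
      proof (rule integral_dominated_convergence[OF _ _ integrable_norm[OF gi]])
        show "AE x in lborel. (\<lambda>n. (indicator {a..b} x *\<^sub>R g x) * \<theta> n x) \<longlonglongrightarrow> indicator {a..b} x *\<^sub>R g x"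
          using AE_lborel_singleton[of a] AE_lborel_singleton[of b]
        proof eventually_elim
          case (elim x)
          then show ?case
            using tendsto_mult[OF tendsto_const[of "g x"] to1[of x]] by (cases "x \<in> {a..b}") auto
        qed
        show "AE x in lborel. norm ((indicator {a..b} x *\<^sub>R g x) * \<theta> n x) \<le> norm (indicator {a..b} x *\<^sub>R g x)" for n
          using le1 by (auto simp: abs_mult mult_left_le)
        show "(\<lambda>x. (indicator {a..b} x *\<^sub>R g x) * \<theta> n x) \<in> borel_measurable lborel" for n
          using borel_measurable_integrable[OF gi] by measurable
      qed (use borel_measurable_integrable[OF gi] in simp)
      moreover have "(\<lambda>x. (indicator {a..b} x *\<^sub>R g x) * \<theta> n x) = (\<lambda>x. g x * \<theta> n x)" for n
      proof
        show "(indicator {a..b} x *\<^sub>R g x) * \<theta> n x = g x * \<theta> n x" for x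
          using z[of x n] by (cases "x \<in> {a<..<b}") auto
      qed
      ultimately show ?thesis by (simp only:)
    qed
    show "(\<lambda>n. LINT x|lborel. f x * deriv (\<theta> n) x) \<longlonglongrightarrow> f a - f b"
      if f: "continuous_on UNIV f" and B: "\<And>x. \<bar>f x\<bar> \<le> B" for f B
    proof -
      have [measurable]: "f \<in> borel_measurable borel"
        using f by (rule borel_measurable_continuous_onI)
      have B0: "0 \<le> B" using B[of 0] by linarith
      have fJ: "integrable lborel (\<lambda>y. f (c + d * y) * J y)" for c d
        by (rule Bochner_Integration.integrable_bound[where f="\<lambda>y. B * J y"])
          (use Ji B B0 J0 in \<open>auto simp: abs_mult intro!: AE_I2 mult_mono intro: order_trans[OF B]\<close>)
      \<comment> \<open>After the substitution x = c + d y / m the kernel is the fixed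
        \<open>J\<close> of mass one, and only the argument of f moves.\<close>
      have lim: "(\<lambda>n. LINT y|lborel. f (c + d / m n * y) * J y) \<longlonglongrightarrow> f c" for c d
      proof -
        have "(\<lambda>n. LINT y|lborel. f (c + d / m n * y) * J y) \<longlonglongrightarrow> (LINT y|lborel. f c * J y)"
        proof (rule integral_dominated_convergence[where w="\<lambda>y. B * J y"])
          have "(\<lambda>n. f (c + d / m n * y)) \<longlonglongrightarrow> f (c + 0 * y)" for y
          proof (rule isCont_tendsto_compose[where g=f])
            show "isCont f (c + 0 * y)" using f by (simp add: continuous_on_eq_continuous_at)
            have "(\<lambda>n. d / m n) \<longlonglongrightarrow> 0" by (rule tendsto_divide_0[OF tendsto_const filterlim_at_top_imp_at_infinity[OF m_lim]])
            then show "(\<lambda>n. c + d / m n * y) \<longlonglongrightarrow> c + 0 * y" by (intro tendsto_intros)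
          qed
          then show "AE y in lborel. (\<lambda>n. f (c + d / m n * y) * J y) \<longlonglongrightarrow> f c * J y"
            by (auto intro!: tendsto_mult)
        qed (use Ji B B0 J0 in \<open>auto simp: abs_mult intro!: AE_I2 mult_mono intro: order_trans[OF B]\<close>)
        then show ?thesis using Ji by simp
      qed
      have "(LINT x|lborel. f x * deriv (\<theta> n) x)
          = (LINT y|lborel. f (a + 1 / m n * y) * J y) - (LINT y|lborel. f (b + (-1) / m n * y) * J y)" for n
      proof -
        define G1 where "G1 x = m n * (f x * J (m n * (x - a)))" for x
        define G2 where "G2 x = m n * (f x * J (m n * (b - x)))" for x
        have e1: "(\<lambda>y. G1 (a + 1 / m n * y)) = (\<lambda>y. m n * (f (a + 1 / m n * y) * J y))"
          using m0[of n] by (simp add: G1_def[abs_def])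
        have e2: "(\<lambda>y. G2 (b + (-1) / m n * y)) = (\<lambda>y. m n * (f (b + (-1) / m n * y) * J y))"
          using m0[of n] by (simp add: G2_def[abs_def])
        have i1: "integrable lborel G1"
          using lborel_integrable_real_affine_iff[of "1 / m n" G1 a] m0[of n] fJ[of a "1 / m n"]
          unfolding e1 by simp
        have i2: "integrable lborel G2"
          using lborel_integrable_real_affine_iff[of "(-1) / m n" G2 b] m0[of n] fJ[of b "(-1) / m n"]
          unfolding e2 by simp
        have "(LINT x|lborel. G1 x) = (LINT y|lborel. f (a + 1 / m n * y) * J y)"
          using lborel_integral_real_affine[of "1 / m n" G1 a] m0[of n] unfolding e1 by simp
        moreover have "(LINT x|lborel. G2 x) = (LINT y|lborel. f (b + (-1) / m n * y) * J y)"
          using lborel_integral_real_affine[of "(-1) / m n" G2 b] m0[of n] unfolding e2 by simp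
        moreover have "(LINT x|lborel. f x * deriv (\<theta> n) x) = (LINT x|lborel. G1 x - G2 x)"
          by (simp add: d \<theta>'_def G1_def G2_def algebra_simps)
        ultimately show ?thesis using i1 i2 by simp
      qed
      then show ?thesis using tendsto_diff[OF lim[of a 1] lim[of b "-1"]] by simp
    qed
  qed
qed

text \<open>The approximate indicators of [a, b] are inserted: the left side tends to
  \<open>f a - f b\<close>, the right side to minus the integral of g.\<close>

lemma weak_derivative_FTC:
  fixes f g :: "real \<Rightarrow> real"
  assumes ab: "a < b" and f: "continuous_on {a..b} f" and g: "continuous_on {a..b} g"
    and weak: "\<And>\<theta>. test_function {a<..<b} \<theta> \<Longrightarrow>
      (LINT x|lborel. f x * deriv \<theta> x) = - (LINT x|lborel. g x * \<theta> x)"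
  shows "f b - f a = integral {a..b} g"
proof (rule approximate_indicator[OF ab])
  fix \<theta> :: "nat \<Rightarrow> real \<Rightarrow> real"
  assume \<theta>: "\<And>n. test_function {a<..<b} (\<theta> n)"
    and lim_f: "\<And>f B. continuous_on UNIV f \<Longrightarrow> (\<And>x. \<bar>f x\<bar> \<le> B) \<Longrightarrow>
        (\<lambda>n. LINT x|lborel. f x * deriv (\<theta> n) x) \<longlonglongrightarrow> f a - f b"
    and lim_g: "\<And>g. set_integrable lborel {a..b} g \<Longrightarrow>
        (\<lambda>n. LINT x|lborel. g x * \<theta> n x) \<longlonglongrightarrow> (LINT x:{a..b}|lborel. g x)"
  \<comment> \<open>The limit for \<open>deriv (\<theta> n)\<close> concerns bounded continuous
    functions on the whole line; extending f by its end values costs nothing because the derivative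
    vanishes off (a, b).\<close>
  define f' where "f' x = f (max a (min b x))" for x
  have "continuous_on UNIV (\<lambda>x. max a (min b x))" by (intro continuous_intros)
  then have f'c: "continuous_on UNIV f'"
    unfolding f'_def by (rule continuous_on_compose2[OF f]) (use ab in auto)
  obtain B where B: "\<And>x. x \<in> {a..b} \<Longrightarrow> \<bar>f x\<bar> \<le> B"
    using compact_imp_bounded[OF compact_continuous_image[OF f compact_Icc]]
    by (metis bounded_iff image_eqI real_norm_def)
  have f'B: "\<bar>f' x\<bar> \<le> B" for x unfolding f'_def by (rule B) (use ab in auto)
  have "(\<lambda>x. f' x * deriv (\<theta> n) x) = (\<lambda>x. f x * deriv (\<theta> n) x)" for n
  proof
    show "f' x * deriv (\<theta> n) x = f x * deriv (\<theta> n) x" for x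
      using test_function_realD(6)[OF \<theta>, of x n] by (cases "x \<in> {a<..<b}") (auto simp: f'_def)
  qed
  then have "(\<lambda>n. - (LINT x|lborel. g x * \<theta> n x)) \<longlonglongrightarrow> f' a - f' b"
    using lim_f[OF f'c f'B] by (simp only: weak[OF \<theta>])
  moreover have gi: "set_integrable lborel {a..b} g" using borel_integrable_atLeastAtMost'[OF g] .
  ultimately have "- (LINT x:{a..b}|lborel. g x) = f' a - f' b"
    using LIMSEQ_unique[OF _ tendsto_minus[OF lim_g[OF gi]]] by metis
  then show ?thesis
    using ab set_borel_integral_eq_integral(2)[OF gi] by (simp add: f'_def)
qed

lemma AE_zero_if_weakly_zero:
  fixes w :: "real \<Rightarrow> real"
  assumes w: "locally_integrable w"
    and z: "\<And>\<theta>. test_function UNIV \<theta> \<Longrightarrow> (LINT x|lborel. w x * \<theta> x) = 0"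
  shows "AE x in lborel. w x = 0"
proof (rule AE_zero_if_interval_integrals_zero)
  show wi: "set_integrable lborel {a..b} w" for a b using w by (simp add: locally_integrable_def)
  show "(LINT x:{a..b}|lborel. w x) = 0" if "a < b" for a b
  proof (rule approximate_indicator[OF that])
    fix \<theta> :: "nat \<Rightarrow> real \<Rightarrow> real"
    assume \<theta>: "\<And>n. test_function {a<..<b} (\<theta> n)"
      and lim: "\<And>g. set_integrable lborel {a..b} g \<Longrightarrow>
        (\<lambda>n. LINT x|lborel. g x * \<theta> n x) \<longlonglongrightarrow> (LINT x:{a..b}|lborel. g x)"
    have "(LINT x|lborel. w x * \<theta> n x) = 0" for n
      by (rule z) (use \<theta>[of n] in \<open>auto simp: test_function_def\<close>)
    then show ?thesis using lim[OF wi] by (simp add: LIMSEQ_const_iff)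
  qed
qed

section \<open>Weak derivatives\<close>

text \<open>Passes from Lebesgue integrals over the line, in which the weak formulations are stated,
  to Henstock-Kurzweil integrals over an interval, to which the fundamental theorem applies.\<close>

lemma compact_support_integral:
  fixes h :: "real \<Rightarrow> real"
  assumes h: "continuous_on {a..b} h" and z: "\<And>x. x \<notin> {a..b} \<Longrightarrow> h x = 0"
  shows "integrable lborel h" "(LINT x|lborel. h x) = integral {a..b} h"
proof -
  have e: "(\<lambda>x. indicator {a..b} x *\<^sub>R h x) = h" using z by (auto simp: indicator_def fun_eq_iff)
  have i: "set_integrable lborel {a..b} h" using borel_integrable_atLeastAtMost'[OF h] .
  then show "integrable lborel h" unfolding set_integrable_def e .
  show "(LINT x|lborel. h x) = integral {a..b} h"
    using set_borel_integral_eq_integral(2)[OF i] unfolding set_lebesgue_integral_def e .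
qed

lemma locally_integrable_AE_continuous:
  fixes f F :: "real \<Rightarrow> real"
  assumes "f \<in> borel_measurable borel" "AE x in lborel. f x = F x" "continuous_on UNIV F"
  shows "locally_integrable f"
  unfolding locally_integrable_def
proof (intro allI)
  fix a b
  have F: "set_integrable lborel {a..b} F"
    using borel_integrable_atLeastAtMost'[OF continuous_on_subset[OF assms(3)]] by blast
  have [measurable]: "F \<in> borel_measurable borel" "f \<in> borel_measurable borel"
    using assms borel_measurable_continuous_onI by auto
  show "set_integrable lborel {a..b} f"
    by (rule set_integrable_cong_AE[THEN iffD1, OF _ _ _ _ F]) (use assms(2) in \<open>auto\<close>)
qed

lemma locally_integrable_times_continuous:
  fixes g \<psi> :: "real \<Rightarrow> real"
  assumes g: "locally_integrable g" and \<psi>: "continuous_on UNIV \<psi>" and z: "\<And>x. \<bar>x\<bar> \<ge> R \<Longrightarrow> \<psi> x = 0"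
  shows "integrable lborel (\<lambda>x. g x * \<psi> x)"
proof -
  obtain B where B: "\<And>x. x \<in> {-R..R} \<Longrightarrow> \<bar>\<psi> x\<bar> \<le> B"
    using compact_imp_bounded[OF compact_continuous_image[OF continuous_on_subset[OF \<psi> subset_UNIV] compact_Icc]]
    by (metis bounded_iff image_eqI real_norm_def)
  have [measurable]: "\<psi> \<in> borel_measurable borel" using \<psi> by (rule borel_measurable_continuous_onI)
  have gi: "integrable lborel (\<lambda>x. indicator {-R..R} x *\<^sub>R g x)"
    using g by (simp add: locally_integrable_def set_integrable_def)
  have "integrable lborel (\<lambda>x. (indicator {-R..R} x *\<^sub>R g x) * \<psi> x)"
  proof (rule Bochner_Integration.integrable_bound)
    show "integrable lborel (\<lambda>x. B * (indicator {-R..R} x *\<^sub>R g x))" using gi by simp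
    show "(\<lambda>x. (indicator {-R..R} x *\<^sub>R g x) * \<psi> x) \<in> borel_measurable lborel"
      using borel_measurable_integrable[OF gi] by measurable
    have "\<bar>g x\<bar> * \<bar>\<psi> x\<bar> \<le> \<bar>B\<bar> * \<bar>g x\<bar>" if "x \<in> {-R..R}" for x
      using mult_left_mono[of "\<bar>\<psi> x\<bar>" "\<bar>B\<bar>" "\<bar>g x\<bar>"] B[OF that] by (simp add: ac_simps)
    then show "AE x in lborel. norm ((indicator {-R..R} x *\<^sub>R g x) * \<psi> x) \<le> norm (B * (indicator {-R..R} x *\<^sub>R g x))"
      by (intro AE_I2) (simp add: indicator_def abs_mult)
  qed
  moreover have "(\<lambda>x. (indicator {-R..R} x *\<^sub>R g x) * \<psi> x) = (\<lambda>x. g x * \<psi> x)"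
    using z by (force simp: indicator_def fun_eq_iff)
  ultimately show ?thesis by simp
qed

text \<open>\<open>weak_deriv\<close> is an arbitrary choice; uniqueness up to null sets is what
  identifies it with any derivative found by hand.\<close>

lemma has_weak_deriv_unique:
  assumes "has_weak_deriv f g" "has_weak_deriv f h"
  shows "AE x in lborel. g x = h x"
proof -
  have "AE x in lborel. g x - h x = 0"
  proof (rule AE_zero_if_weakly_zero)
    show "locally_integrable (\<lambda>x. g x - h x)"
      using assms by (auto simp: has_weak_deriv_def locally_integrable_def)
    show "(LINT x|lborel. (g x - h x) * \<theta> x) = 0" if t: "test_function UNIV \<theta>" for \<theta>
    proof -
      obtain R where "\<And>x. \<bar>x\<bar> \<ge> R \<Longrightarrow> \<theta> x = 0" using test_function_realD(4)[OF t] by auto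
      then have "integrable lborel (\<lambda>x. g x * \<theta> x)" "integrable lborel (\<lambda>x. h x * \<theta> x)"
        using assms test_function_realD(2)[OF t]
        by (auto intro!: locally_integrable_times_continuous simp: has_weak_deriv_def)
      moreover have "(LINT x|lborel. g x * \<theta> x) = (LINT x|lborel. h x * \<theta> x)"
        using assms t by (auto simp: has_weak_deriv_def)
      ultimately show ?thesis by (simp add: left_diff_distrib)
    qed
  qed
  then show ?thesis by eventually_elim simp
qed

text \<open>f is only determined up to null sets and F is its continuously differentiable
  representative; the integration by parts is carried out for F.\<close>

lemma C1_has_weak_deriv:
  fixes f F F' :: "real \<Rightarrow> real"
  assumes f: "f \<in> borel_measurable borel" "AE x in lborel. f x = F x"
    and F: "\<And>x. DERIV F x :> F' x" and F': "continuous_on UNIV F'"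
  shows "has_weak_deriv f F'"
  unfolding has_weak_deriv_def
proof (intro conjI allI impI)
  have Fc: "continuous_on UNIV F" using F by (meson DERIV_isCont continuous_at_imp_continuous_on)
  then show "locally_integrable f" using locally_integrable_AE_continuous f by blast
  have [measurable]: "F \<in> borel_measurable borel" "F' \<in> borel_measurable borel"
    using Fc F' borel_measurable_continuous_onI by auto
  note [measurable] = f(1)
  show "locally_integrable F'" by (rule locally_integrable_AE_continuous[OF _ _ F']) auto
  fix \<psi> :: "real \<Rightarrow> real" assume t: "test_function UNIV \<psi>"
  obtain R where R: "R > 0" "\<And>x. \<bar>x\<bar> \<ge> R \<Longrightarrow> \<psi> x = 0 \<and> deriv \<psi> x = 0"
    using test_function_realD(4)[OF t] by auto
  note tc = test_function_realD(2,3)[OF t]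
  have [measurable]: "\<psi> \<in> borel_measurable borel" "deriv \<psi> \<in> borel_measurable borel"
    using tc borel_measurable_continuous_onI by auto
  have out: "\<psi> x = 0 \<and> deriv \<psi> x = 0" if "x \<notin> {-R..R}" for x using R(2)[of x] that by auto
  have i1: "integrable lborel (\<lambda>x. F x * deriv \<psi> x)"
    by (rule compact_support_integral[of "-R" R])
      (use out Fc tc in \<open>auto intro!: continuous_on_mult intro: continuous_on_subset\<close>)
  have i2: "integrable lborel (\<lambda>x. F' x * \<psi> x)"
    by (rule compact_support_integral[of "-R" R])
      (use out F' tc in \<open>auto intro!: continuous_on_mult intro: continuous_on_subset\<close>)
  have c: "continuous_on UNIV (\<lambda>x. F x * deriv \<psi> x + F' x * \<psi> x)"
    by (intro continuous_intros Fc F' tc)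
  have "(LINT x|lborel. F x * deriv \<psi> x + F' x * \<psi> x) = integral {-R..R} (\<lambda>x. F x * deriv \<psi> x + F' x * \<psi> x)"
    by (rule compact_support_integral(2)) (use out c in \<open>auto intro: continuous_on_subset\<close>)
  also have "\<dots> = F R * \<psi> R - F (-R) * \<psi> (-R)"
  proof (rule integral_unique, rule fundamental_theorem_of_calculus)
    show "((\<lambda>x. F x * \<psi> x) has_vector_derivative F x * deriv \<psi> x + F' x * \<psi> x) (at x within {-R..R})" for x
      using DERIV_mult[OF F[of x] test_function_realD(1)[OF t, of x]]
      by (auto simp: has_real_derivative_iff_has_vector_derivative[symmetric] ac_simps
          intro: has_field_derivative_at_within)
  qed (use R in auto)
  also have "\<dots> = 0" using R by simp
  finally have "(LINT x|lborel. F x * deriv \<psi> x) = - (LINT x|lborel. F' x * \<psi> x)"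
    using i1 i2 by simp
  moreover have "(LINT x|lborel. f x * deriv \<psi> x) = (LINT x|lborel. F x * deriv \<psi> x)"
    by (rule integral_cong_AE) (use f(2) in \<open>auto\<close>)
  ultimately show "(LINT x|lborel. f x * deriv \<psi> x) = - (LINT x|lborel. F' x * \<psi> x)" by simp
qed

text \<open>A continuously differentiable representative shows that some weak derivative exists;
  this is what makes the choice in \<open>weak_deriv\<close> satisfy its specification.\<close>

lemma weak_deriv_AE_eq:
  assumes "f \<in> borel_measurable borel" "AE x in lborel. f x = F x"
    "\<And>x. DERIV F x :> F' x" "continuous_on UNIV F'"
  shows "AE x in lborel. weak_deriv f x = F' x" "weak_deriv f \<in> borel_measurable borel"
proof -
  have "has_weak_deriv f F'" using C1_has_weak_deriv assms by blast
  then have w: "has_weak_deriv f (weak_deriv f)" unfolding weak_deriv_def by (rule someI[where P="has_weak_deriv f"])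
  then show "AE x in lborel. weak_deriv f x = F' x"
    using \<open>has_weak_deriv f F'\<close> by (rule has_weak_deriv_unique)
  \<comment> \<open>Local integrability only makes the truncations measurable; the function itself
    is their pointwise limit.\<close>
  have "integrable lborel (\<lambda>x. indicator {-real n..real n} x * weak_deriv f x)" for n
    using w by (simp add: has_weak_deriv_def locally_integrable_def set_integrable_def)
  then have [measurable]: "(\<lambda>x. indicator {-real n..real n} x * weak_deriv f x) \<in> borel_measurable borel" for n
    by (drule_tac x=n in meta_spec) (auto dest: borel_measurable_integrable)
  show "weak_deriv f \<in> borel_measurable borel"
  proof (rule borel_measurable_LIMSEQ_real)
    show "(\<lambda>n. indicator {-real n..real n} x * weak_deriv f x) \<longlonglongrightarrow> weak_deriv f x" for x
    proof (rule tendsto_eventually)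
      obtain n where "\<bar>x\<bar> \<le> real n" using real_arch_simple by blast
      then show "\<forall>\<^sub>F n in sequentially. indicator {-real n..real n} x * weak_deriv f x = weak_deriv f x"
        by (intro eventually_sequentiallyI[of n]) (auto simp: indicator_def)
    qed
  qed measurable
qed

lemma continuous_AE_eq_imp_eq:
  fixes f g :: "real \<Rightarrow> real"
  assumes f: "continuous_on UNIV f" and g: "continuous_on UNIV g" and ae: "AE x in lborel. f x = g x"
  shows "f = g"
proof (rule ccontr)
  assume "f \<noteq> g"
  then obtain x where x: "f x \<noteq> g x" by auto
  have o: "open {x. f x \<noteq> g x}" using f g by (intro open_Collect_neq)
  then obtain e where e: "e > 0" "ball x e \<subseteq> {x. f x \<noteq> g x}"
    using x unfolding open_contains_ball by blast
  have "emeasure lborel {x. f x \<noteq> g x} = 0"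
    using ae AE_iff_measurable[of "{x. f x \<noteq> g x}" lborel "\<lambda>x. f x = g x"] borel_open[OF o] by simp
  moreover have "{x - e<..<x + e} \<subseteq> {x. f x \<noteq> g x}" using e(2) by (simp add: ball_eq_greaterThanLessThan)
  then have "emeasure lborel {x - e<..<x + e} \<le> emeasure lborel {x. f x \<noteq> g x}"
    using borel_open[OF o] by (intro emeasure_mono) auto
  ultimately show False using e(1) by simp
qed

section \<open>Integrated form of the balance laws\<close>

text \<open>The product is carried by the product of the two compact sets. Products are the only
  test functions in the plane that are ever inserted into a balance law.\<close>

lemma test_function_product:
  fixes \<theta> \<eta> :: "real \<Rightarrow> real"
  assumes \<theta>: "test_function A \<theta>" and \<eta>: "test_function B \<eta>"
  shows "test_function (A \<times> B) (\<lambda>(t, x). \<theta> t * \<eta> x)"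
proof -
  obtain K where K: "compact K" "K \<subseteq> A" "\<And>x. x \<notin> K \<Longrightarrow> \<theta> x = 0" and k: "\<And>k. C_k k \<theta>"
    using \<theta> by (auto simp: test_function_def)
  obtain L where L: "compact L" "L \<subseteq> B" "\<And>x. x \<notin> L \<Longrightarrow> \<eta> x = 0" and l: "\<And>k. C_k k \<eta>"
    using \<eta> by (auto simp: test_function_def)
  show ?thesis
    unfolding test_function_def
  proof (intro conjI allI exI)
    show "C_k k (\<lambda>(t, x). \<theta> t * \<eta> x)" for k
      using C_k_mult[OF C_k_compose_affine[OF bounded_linear_fst k[of k], of 0]
          C_k_compose_affine[OF bounded_linear_snd l[of k], of 0]]
      by (simp add: case_prod_unfold)
    show "compact (K \<times> L)" using K L by (intro compact_Times)
    show "K \<times> L \<subseteq> A \<times> B" using K L by auto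
    show "z \<notin> K \<times> L \<longrightarrow> (case z of (t, x) \<Rightarrow> \<theta> t * \<eta> x) = 0" for z
      using K(3) L(3) by (cases z) auto
  qed
qed

lemma continuous_on_pair_compose:
  assumes "continuous_on (A \<times> B) (\<lambda>(t, x). f t x)" "continuous_on C g" "continuous_on C h"
    "\<And>z. z \<in> C \<Longrightarrow> g z \<in> A" "\<And>z. z \<in> C \<Longrightarrow> h z \<in> B"
  shows "continuous_on C (\<lambda>z. f (g z) (h z))"
  using continuous_on_compose2[OF assms(1) continuous_on_Pair[OF assms(2,3)]] assms(4,5) by auto

text \<open>The du Bois-Reymond lemma \<open>weak_derivative_FTC\<close> is applied to products of test functions, first
  in time and then in space.\<close>

lemma weak_balance_law_integrated:
  fixes Q F G q f g :: "real \<Rightarrow> real \<Rightarrow> real"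
  assumes law: "weak_balance_law T q f g"
    and cont: "continuous_on (time_interval T \<times> UNIV) (\<lambda>(t, x). Q t x)"
      "continuous_on (time_interval T \<times> UNIV) (\<lambda>(t, x). F t x)"
      "continuous_on (time_interval T \<times> UNIV) (\<lambda>(t, x). G t x)"
    and meas: "\<And>t. t \<in> time_interval T \<Longrightarrow> q t \<in> borel_measurable borel"
      "\<And>t. t \<in> time_interval T \<Longrightarrow> f t \<in> borel_measurable borel"
      "\<And>t. t \<in> time_interval T \<Longrightarrow> g t \<in> borel_measurable borel"
    and ae: "\<And>t. t \<in> time_interval T \<Longrightarrow> AE x in lborel. q t x = Q t x"
      "\<And>t. t \<in> time_interval T \<Longrightarrow> AE x in lborel. f t x = F t x"
      "\<And>t. t \<in> time_interval T \<Longrightarrow> AE x in lborel. g t x = G t x"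
    and t: "t \<in> time_interval T" and x: "x1 < x2"
  shows "integral {x1..x2} (\<lambda>x. Q t x - Q 0 x) =
    - integral {0..t} (\<lambda>\<tau>. F \<tau> x2 - F \<tau> x1 + integral {x1..x2} (G \<tau>))"
proof (cases "t = 0")
  case False
  then have t0: "0 < t" using t by (simp add: time_interval_def)
  have sub: "{0..t} \<subseteq> time_interval T"
    using t by (auto simp: time_interval_def) (metis ereal_less_eq(3) le_less_trans)
  have c2: "continuous_on ({0..t} \<times> X) (\<lambda>(t, x). Q t x)" "continuous_on ({0..t} \<times> X) (\<lambda>(t, x). F t x)"
    "continuous_on ({0..t} \<times> X) (\<lambda>(t, x). G t x)" for X
    using cont[THEN continuous_on_subset, of "{0..t} \<times> X"] sub by auto
  have cx: "continuous_on X (Q \<tau>)" "continuous_on X (F \<tau>)" "continuous_on X (G \<tau>)" if "\<tau> \<in> {0..t}" for \<tau> X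
    using that by (auto intro!: continuous_on_pair_compose[OF c2(1)[of X]] continuous_on_pair_compose[OF c2(2)[of X]]
        continuous_on_pair_compose[OF c2(3)[of X]] continuous_intros)
  have ct: "continuous_on {0..t} (\<lambda>\<tau>. Q \<tau> x)" "continuous_on {0..t} (\<lambda>\<tau>. F \<tau> x)" "continuous_on {0..t} (\<lambda>\<tau>. G \<tau> x)" for x
    by (auto intro!: continuous_on_pair_compose[OF c2(1)[of UNIV]] continuous_on_pair_compose[OF c2(2)[of UNIV]]
        continuous_on_pair_compose[OF c2(3)[of UNIV]] continuous_intros)
  \<comment> \<open>The spatial test function is kept fixed. Tested against products, the law says
    that \<gamma> is the weak time derivative of \<alpha> on (0, t); both are continuous up to the
    end points, so the increment of \<alpha> over [0, t] is the integral of \<gamma>, with the data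
    at time 0 reached by continuity.\<close>
  have step1: "integral {x1..x2} (\<lambda>x. Q t x * \<eta> x) - integral {x1..x2} (\<lambda>x. Q 0 x * \<eta> x)
      = integral {0..t} (\<lambda>\<tau>. integral {x1..x2} (\<lambda>x. F \<tau> x * deriv \<eta> x - G \<tau> x * \<eta> x))"
    if \<eta>: "test_function {x1<..<x2} \<eta>" for \<eta>
  proof -
    note \<eta>c = test_function_realD(2,3)[OF \<eta>]
    have \<eta>z: "\<eta> x = 0" "deriv \<eta> x = 0" if "x \<notin> {x1..x2}" for x
      using test_function_realD(5,6)[OF \<eta>, of x] that by auto
    define \<alpha> where "\<alpha> \<tau> = integral {x1..x2} (\<lambda>x. Q \<tau> x * \<eta> x)" for \<tau>
    define \<gamma> where "\<gamma> \<tau> = integral {x1..x2} (\<lambda>x. F \<tau> x * deriv \<eta> x - G \<tau> x * \<eta> x)" for \<tau>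
    have \<eta>c2: "continuous_on X (\<lambda>z. \<eta> (snd z))" "continuous_on X (\<lambda>z. deriv \<eta> (snd z))" for X :: "(real \<times> real) set"
      using \<eta>c by (auto intro!: continuous_on_compose2[where f=snd and s=X] continuous_intros)
    have \<alpha>c: "continuous_on {0..t} \<alpha>"
      unfolding \<alpha>_def using integral_continuous_on_param[of "{0..t}" x1 x2 "\<lambda>\<tau> x. Q \<tau> x * \<eta> x"]
        continuous_on_mult[OF c2(1)[of "{x1..x2}"] \<eta>c2(1)] by (simp add: case_prod_unfold)
    have \<gamma>c: "continuous_on {0..t} \<gamma>"
      unfolding \<gamma>_def using integral_continuous_on_param[of "{0..t}" x1 x2 "\<lambda>\<tau> x. F \<tau> x * deriv \<eta> x - G \<tau> x * \<eta> x"]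
        continuous_on_diff[OF continuous_on_mult[OF c2(2)[of "{x1..x2}"] \<eta>c2(2)]
          continuous_on_mult[OF c2(3)[of "{x1..x2}"] \<eta>c2(1)]] by (simp add: case_prod_unfold)
    have "\<alpha> t - \<alpha> 0 = integral {0..t} \<gamma>"
    proof (rule weak_derivative_FTC[OF t0 \<alpha>c \<gamma>c])
      fix \<theta> assume \<theta>: "test_function {0<..<t} \<theta>"
      note \<theta>c = test_function_realD(2,3)[OF \<theta>]
      have \<theta>z: "\<theta> x = 0" "deriv \<theta> x = 0" if "x \<notin> {0<..<t}" for x
        using test_function_realD(5,6)[OF \<theta>, of x] that by auto
      have "{0<..<t} \<times> {x1<..<x2} \<subseteq> {t. 0 < t \<and> ereal t < T} \<times> UNIV"
        using sub by (auto simp: time_interval_def subset_iff)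
      then have "test_function ({t. 0 < t \<and> ereal t < T} \<times> UNIV) (\<lambda>(t, x). \<theta> t * \<eta> x)"
        using test_function_product[OF \<theta> \<eta>] unfolding test_function_def by (meson subset_trans)
      from law[unfolded weak_balance_law_def, rule_format, OF this]
      have "0 = (LINT \<tau>|lborel. LINT x|lborel.
          q \<tau> x * deriv (\<lambda>\<tau>. \<theta> \<tau> * \<eta> x) \<tau> + f \<tau> x * deriv (\<lambda>y. \<theta> \<tau> * \<eta> y) x - g \<tau> x * (\<theta> \<tau> * \<eta> x))"
        by simp
      also have "\<dots> = (LINT \<tau>|lborel. \<alpha> \<tau> * deriv \<theta> \<tau> + \<gamma> \<tau> * \<theta> \<tau>)"
      proof (rule Bochner_Integration.integral_cong[OF refl])
        fix \<tau>
        have d: "deriv (\<lambda>\<tau>. \<theta> \<tau> * \<eta> x) \<tau> = deriv \<theta> \<tau> * \<eta> x" "deriv (\<lambda>y. \<theta> \<tau> * \<eta> y) x = \<theta> \<tau> * deriv \<eta> x" for x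
          using DERIV_cmult_right[OF test_function_realD(1)[OF \<theta>], of "\<eta> x" \<tau>]
            DERIV_cmult[OF test_function_realD(1)[OF \<eta>], of "\<theta> \<tau>" x] by (auto intro: DERIV_imp_deriv)
        show "(LINT x|lborel. q \<tau> x * deriv (\<lambda>\<tau>. \<theta> \<tau> * \<eta> x) \<tau> + f \<tau> x * deriv (\<lambda>y. \<theta> \<tau> * \<eta> y) x
            - g \<tau> x * (\<theta> \<tau> * \<eta> x)) = \<alpha> \<tau> * deriv \<theta> \<tau> + \<gamma> \<tau> * \<theta> \<tau>"
        proof (cases "\<tau> \<in> {0<..<t}")
          case True
          then have \<tau>: "\<tau> \<in> time_interval T" "\<tau> \<in> {0..t}" using sub by auto
          have [measurable]: "q \<tau> \<in> borel_measurable borel" "f \<tau> \<in> borel_measurable borel" "g \<tau> \<in> borel_measurable borel"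
            "\<eta> \<in> borel_measurable borel" "deriv \<eta> \<in> borel_measurable borel"
            using meas[OF \<tau>(1)] \<eta>c borel_measurable_continuous_onI by auto
          have [measurable]: "Q \<tau> \<in> borel_measurable borel" "F \<tau> \<in> borel_measurable borel" "G \<tau> \<in> borel_measurable borel"
            using cx[OF \<tau>(2), of UNIV] borel_measurable_continuous_onI by auto
          note cs = compact_support_integral[of x1 x2]
          have i: "integrable lborel (\<lambda>x. Q \<tau> x * \<eta> x)" "integrable lborel (\<lambda>x. F \<tau> x * deriv \<eta> x - G \<tau> x * \<eta> x)"
            using cx[OF \<tau>(2)] \<eta>z \<eta>c by (auto intro!: cs(1) continuous_intros intro: continuous_on_subset)
          have v: "(LINT x|lborel. Q \<tau> x * \<eta> x) = \<alpha> \<tau>"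
              "(LINT x|lborel. F \<tau> x * deriv \<eta> x - G \<tau> x * \<eta> x) = \<gamma> \<tau>"
            unfolding \<alpha>_def \<gamma>_def
            using cx[OF \<tau>(2)] \<eta>z \<eta>c by (auto intro!: cs(2) continuous_intros intro: continuous_on_subset)
          have "(LINT x|lborel. q \<tau> x * (deriv \<theta> \<tau> * \<eta> x) + f \<tau> x * (\<theta> \<tau> * deriv \<eta> x) - g \<tau> x * (\<theta> \<tau> * \<eta> x))
            = (LINT x|lborel. deriv \<theta> \<tau> * (Q \<tau> x * \<eta> x) + \<theta> \<tau> * (F \<tau> x * deriv \<eta> x - G \<tau> x * \<eta> x))"
          proof (rule integral_cong_AE)
            show "AE x in lborel. q \<tau> x * (deriv \<theta> \<tau> * \<eta> x) + f \<tau> x * (\<theta> \<tau> * deriv \<eta> x) - g \<tau> x * (\<theta> \<tau> * \<eta> x)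
              = deriv \<theta> \<tau> * (Q \<tau> x * \<eta> x) + \<theta> \<tau> * (F \<tau> x * deriv \<eta> x - G \<tau> x * \<eta> x)"
              using ae(1)[OF \<tau>(1)] ae(2)[OF \<tau>(1)] ae(3)[OF \<tau>(1)]
              by eventually_elim (simp add: algebra_simps)
          qed measurable
          also have "\<dots> = deriv \<theta> \<tau> * \<alpha> \<tau> + \<theta> \<tau> * \<gamma> \<tau>" using i by (simp add: v)
          finally show ?thesis unfolding d by (simp add: mult.commute)
        next
          \<comment> \<open>Outside (0, t) the functions q, f, g may lie beyond the time interval of
            the law; the factors \<open>\<theta> \<tau>\<close> and
            \<open>deriv \<theta> \<tau>\<close> remove them.\<close>
          case False
          then show ?thesis by (simp add: d \<theta>z)
        qed
      qed
      also have "\<dots> = (LINT \<tau>|lborel. \<alpha> \<tau> * deriv \<theta> \<tau>) + (LINT \<tau>|lborel. \<gamma> \<tau> * \<theta> \<tau>)"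
      proof (rule Bochner_Integration.integral_add)
        show "integrable lborel (\<lambda>\<tau>. \<alpha> \<tau> * deriv \<theta> \<tau>)" "integrable lborel (\<lambda>\<tau>. \<gamma> \<tau> * \<theta> \<tau>)"
          using \<alpha>c \<gamma>c \<theta>z \<theta>c
          by (auto intro!: compact_support_integral(1)[of 0 t] continuous_on_mult intro: continuous_on_subset)
      qed
      finally show "(LINT \<tau>|lborel. \<alpha> \<tau> * deriv \<theta> \<tau>) = - (LINT \<tau>|lborel. \<gamma> \<tau> * \<theta> \<tau>)" by simp
    qed
    then show ?thesis unfolding \<alpha>_def \<gamma>_def .
  qed
  define E where "E x = integral {0..t} (\<lambda>\<tau>. F \<tau> x)" for x
  define H where "H x = integral {0..t} (\<lambda>\<tau>. G \<tau> x)" for x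
  have swap: "continuous_on ({0..t} \<times> X) (\<lambda>(t, x). K t x) \<Longrightarrow> continuous_on (X \<times> {0..t}) (\<lambda>(x, t). K t x)"
    for K :: "real \<Rightarrow> real \<Rightarrow> real" and X
  proof -
    assume K: "continuous_on ({0..t} \<times> X) (\<lambda>(t, x). K t x)"
    have "continuous_on (X \<times> {0..t}) (\<lambda>z. K (snd z) (fst z))"
      by (rule continuous_on_pair_compose[OF K]) (auto intro!: continuous_intros)
    then show "continuous_on (X \<times> {0..t}) (\<lambda>(x, t). K t x)" by (simp add: case_prod_unfold)
  qed
  have Ec: "continuous_on {x1..x2} E" and Hc: "continuous_on {x1..x2} H"
    unfolding E_def H_def
    using integral_continuous_on_param[of "{x1..x2}" 0 t "\<lambda>x \<tau>. F \<tau> x"] integral_continuous_on_param[of "{x1..x2}" 0 t "\<lambda>x \<tau>. G \<tau> x"]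
      swap[OF c2(2)] swap[OF c2(3)] by auto
  have Qc: "continuous_on X (Q t)" "continuous_on X (Q 0)" for X using cx(1)[of t X] cx(1)[of 0 X] t0 by auto
  \<comment> \<open>The first identity, with the order of integration exchanged, says that E has the
    weak x-derivative -(Q t - Q 0 + H) on (x1, x2); the same lemma is now applied in space.\<close>
  have "E x2 - E x1 = integral {x1..x2} (\<lambda>x. - (Q t x - Q 0 x + H x))"
  proof (rule weak_derivative_FTC[OF x Ec])
    show Dc: "continuous_on {x1..x2} (\<lambda>x. - (Q t x - Q 0 x + H x))"
      by (intro continuous_intros Qc Hc)
    fix \<eta> assume \<eta>: "test_function {x1<..<x2} \<eta>"
    note \<eta>c = test_function_realD(2,3)[OF \<eta>]
    note \<eta>c' = \<eta>c[THEN continuous_on_subset, OF subset_UNIV, of "{x1..x2}"]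
    have \<eta>z: "\<eta> x = 0" "deriv \<eta> x = 0" if "x \<notin> {x1..x2}" for x
      using test_function_realD(5,6)[OF \<eta>, of x] that by auto
    have \<eta>c2: "continuous_on X (\<lambda>z. \<eta> (snd z))" "continuous_on X (\<lambda>z. deriv \<eta> (snd z))" for X :: "(real \<times> real) set"
      using \<eta>c by (auto intro!: continuous_on_compose2[where f=snd and s=X] continuous_intros)
    have "continuous_on ({0..t} \<times> {x1..x2}) (\<lambda>(\<tau>, x). F \<tau> x * deriv \<eta> x - G \<tau> x * \<eta> x)"
      using continuous_on_diff[OF continuous_on_mult[OF c2(2)[of "{x1..x2}"] \<eta>c2(2)]
          continuous_on_mult[OF c2(3)[of "{x1..x2}"] \<eta>c2(1)]] by (simp add: case_prod_unfold)
    then have "integral {0..t} (\<lambda>\<tau>. integral {x1..x2} (\<lambda>x. F \<tau> x * deriv \<eta> x - G \<tau> x * \<eta> x))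
      = integral {x1..x2} (\<lambda>x. integral {0..t} (\<lambda>\<tau>. F \<tau> x * deriv \<eta> x - G \<tau> x * \<eta> x))"
      using integral_swap_continuous[of 0 x1 t x2 "\<lambda>\<tau> x. F \<tau> x * deriv \<eta> x - G \<tau> x * \<eta> x"]
      by (simp add: cbox_Pair_eq)
    also have "\<dots> = integral {x1..x2} (\<lambda>x. E x * deriv \<eta> x - H x * \<eta> x)"
    proof (rule integral_cong)
      fix x
      have "(\<lambda>\<tau>. F \<tau> x * deriv \<eta> x) integrable_on {0..t}" "(\<lambda>\<tau>. G \<tau> x * \<eta> x) integrable_on {0..t}"
        using ct by (auto intro!: integrable_continuous_real continuous_on_mult_right)
      then show "integral {0..t} (\<lambda>\<tau>. F \<tau> x * deriv \<eta> x - G \<tau> x * \<eta> x) = E x * deriv \<eta> x - H x * \<eta> x"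
        by (simp add: Henstock_Kurzweil_Integration.integral_diff E_def H_def)
    qed
    finally have s: "integral {x1..x2} (\<lambda>x. Q t x * \<eta> x) - integral {x1..x2} (\<lambda>x. Q 0 x * \<eta> x)
        = integral {x1..x2} (\<lambda>x. E x * deriv \<eta> x - H x * \<eta> x)"
      using step1[OF \<eta>] by simp
    have i: "(\<lambda>x. Q t x * \<eta> x) integrable_on {x1..x2}" "(\<lambda>x. Q 0 x * \<eta> x) integrable_on {x1..x2}"
      "(\<lambda>x. E x * deriv \<eta> x) integrable_on {x1..x2}" "(\<lambda>x. H x * \<eta> x) integrable_on {x1..x2}"
      by (auto intro!: integrable_continuous_real continuous_intros Qc Ec Hc \<eta>c')
    have "integral {x1..x2} (\<lambda>x. - (Q t x - Q 0 x + H x) * \<eta> x)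
       = integral {x1..x2} (\<lambda>x. - (Q t x * \<eta> x - Q 0 x * \<eta> x + H x * \<eta> x))"
      by (simp add: algebra_simps)
    also have "\<dots> = - integral {x1..x2} (\<lambda>x. E x * deriv \<eta> x)"
      using i s by (simp add: Henstock_Kurzweil_Integration.integral_diff
          Henstock_Kurzweil_Integration.integral_add integrable_diff)
    finally have "integral {x1..x2} (\<lambda>x. E x * deriv \<eta> x) = - integral {x1..x2} (\<lambda>x. - (Q t x - Q 0 x + H x) * \<eta> x)"
      by simp
    moreover have "(LINT x|lborel. E x * deriv \<eta> x) = integral {x1..x2} (\<lambda>x. E x * deriv \<eta> x)"
      by (rule compact_support_integral) (auto simp: \<eta>z intro!: continuous_on_mult Ec \<eta>c')
    moreover have "(LINT x|lborel. - (Q t x - Q 0 x + H x) * \<eta> x) = integral {x1..x2} (\<lambda>x. - (Q t x - Q 0 x + H x) * \<eta> x)"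
      by (rule compact_support_integral) (use \<eta>z continuous_on_mult[OF Dc \<eta>c'(1)] in auto)
    ultimately show "(LINT x|lborel. E x * deriv \<eta> x) = - (LINT x|lborel. - (Q t x - Q 0 x + H x) * \<eta> x)"
      by simp
  qed
  also have "\<dots> = - (integral {x1..x2} (\<lambda>x. Q t x - Q 0 x) + integral {x1..x2} H)"
    unfolding Henstock_Kurzweil_Integration.integral_neg
    by (subst Henstock_Kurzweil_Integration.integral_add)
      (auto intro!: integrable_continuous_real continuous_on_diff Qc Hc)
  also have "integral {x1..x2} H = integral {0..t} (\<lambda>\<tau>. integral {x1..x2} (G \<tau>))"
    using integral_swap_continuous[of 0 x1 t x2 G] c2(3)[of "{x1..x2}"] by (simp add: cbox_Pair_eq H_def[abs_def])
  also have "E x2 - E x1 = integral {0..t} (\<lambda>\<tau>. F \<tau> x2 - F \<tau> x1)"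
    unfolding E_def by (rule Henstock_Kurzweil_Integration.integral_diff[symmetric]) (auto intro!: integrable_continuous_real ct)
  finally have "integral {x1..x2} (\<lambda>x. Q t x - Q 0 x) =
    - (integral {0..t} (\<lambda>\<tau>. F \<tau> x2 - F \<tau> x1) + integral {0..t} (\<lambda>\<tau>. integral {x1..x2} (G \<tau>)))" by simp
  also have "integral {0..t} (\<lambda>\<tau>. F \<tau> x2 - F \<tau> x1) + integral {0..t} (\<lambda>\<tau>. integral {x1..x2} (G \<tau>))
    = integral {0..t} (\<lambda>\<tau>. F \<tau> x2 - F \<tau> x1 + integral {x1..x2} (G \<tau>))"
  proof (rule Henstock_Kurzweil_Integration.integral_add[symmetric])
    show "(\<lambda>\<tau>. integral {x1..x2} (G \<tau>)) integrable_on {0..t}"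
      using integral_continuous_on_param[of "{0..t}" x1 x2 G] c2(3)[of "{x1..x2}"]
      by (auto intro!: integrable_continuous_real)
  qed (auto intro!: integrable_continuous_real continuous_intros ct)
  finally show ?thesis .
qed auto

section \<open>Transport along characteristics\<close>

text \<open>Picard iteration for the backward problem: the end value \<open>X t1 = x\<close> is
  prescribed because the estimate at (t1, x) traces the characteristic back to the data. The
  condition \<open>L * t1 \<le> 1 / 2\<close> makes the iteration a contraction with factor
  1/2.\<close>

lemma characteristic_exists:
  fixes a :: "real \<Rightarrow> real \<Rightarrow> real"
  assumes t1: "0 \<le> t1" and cont: "continuous_on ({0..t1} \<times> UNIV) (\<lambda>(t, x). a t x)"
    and bd: "\<And>t x. t \<in> {0..t1} \<Longrightarrow> \<bar>a t x\<bar> \<le> A"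
    and lip: "\<And>t x y. t \<in> {0..t1} \<Longrightarrow> \<bar>a t x - a t y\<bar> \<le> L * \<bar>x - y\<bar>"
    and small: "L * t1 \<le> 1 / 2"
  obtains X where "X t1 = x" "\<And>t. t \<in> {0..t1} \<Longrightarrow> (X has_real_derivative a t (X t)) (at t within {0..t1})"
    "\<And>t. t \<in> {0..t1} \<Longrightarrow> \<bar>X t - x\<bar> \<le> A * t1"
proof -
  \<comment> \<open>The fixed point is sought among bounded continuous functions on the whole line;
    clamping the time to [0, t1] gives the integral operator a meaning there.\<close>
  define c where "c s = max 0 (min s t1)" for s
  have c: "c s \<in> {0..t1}" for s using t1 by (auto simp: c_def)
  have cc: "continuous_on UNIV c" unfolding c_def by (intro continuous_intros)
  have A0: "0 \<le> A" using bd[of 0 0] t1 by force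
  have L0: "0 \<le> L" using lip[of 0 0 1] t1 by force
  define \<Phi>0 where "\<Phi>0 f s = x - integral {c s..t1} (\<lambda>\<tau>. a \<tau> (apply_bcontfun f \<tau>))" for f s
  have gc: "continuous_on {r..t1} (\<lambda>\<tau>. a \<tau> (apply_bcontfun f \<tau>))" if "0 \<le> r" for f r
    by (rule continuous_on_pair_compose[OF cont])
      (use that in \<open>auto intro!: continuous_intros\<close>)
  have ib: "\<bar>integral {c s..t1} g\<bar> \<le> B * t1"
    if "continuous_on {c s..t1} g" "\<And>\<tau>. \<tau> \<in> {c s..t1} \<Longrightarrow> \<bar>g \<tau>\<bar> \<le> B" "0 \<le> B" for s g B
  proof -
    have "norm (integral {c s..t1} g) \<le> B * (t1 - c s)"
      using that c[of s] by (intro integral_bound) auto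
    also have "\<dots> \<le> B * t1" using that(3) c[of s] by (intro mult_left_mono) auto
    finally show ?thesis by simp
  qed
  have mem: "\<Phi>0 f \<in> bcontfun" for f
  proof -
    have "continuous_on {0..t1} (\<lambda>s. integral {s..t1} (\<lambda>\<tau>. a \<tau> (apply_bcontfun f \<tau>)))"
      by (rule DERIV_continuous_on, rule integral_has_real_derivative'[OF gc[of 0 f]]) auto
    then have "continuous_on UNIV (\<lambda>s. integral {c s..t1} (\<lambda>\<tau>. a \<tau> (apply_bcontfun f \<tau>)))"
      by (rule continuous_on_compose2[OF _ cc]) (use c in auto)
    then have 1: "continuous_on UNIV (\<Phi>0 f)" unfolding \<Phi>0_def by (intro continuous_intros)
    have "\<bar>\<Phi>0 f s\<bar> \<le> \<bar>x\<bar> + A * t1" for s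
    proof -
      have "\<bar>integral {c s..t1} (\<lambda>\<tau>. a \<tau> (apply_bcontfun f \<tau>))\<bar> \<le> A * t1"
        using c[of s] A0 by (intro ib gc) (auto intro: bd)
      then show ?thesis unfolding \<Phi>0_def by linarith
    qed
    then have "bounded (range (\<Phi>0 f))" by (auto simp: bounded_iff)
    with 1 show ?thesis by (simp add: bcontfun_def)
  qed
  define \<Phi> where "\<Phi> f = Bcontfun (\<Phi>0 f)" for f
  have \<Phi>: "apply_bcontfun (\<Phi> f) = \<Phi>0 f" for f
    unfolding \<Phi>_def by (rule Bcontfun_inverse[OF mem])
  have "\<exists>!f. \<Phi> f = f"
  proof (rule banach_fix_type[of "1/2"])
    show "\<forall>f h. dist (\<Phi> f) (\<Phi> h) \<le> 1 / 2 * dist f h"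
    proof (intro allI dist_bound)
      fix f h :: "real \<Rightarrow>\<^sub>C real" and s
      have i: "(\<lambda>\<tau>. a \<tau> (apply_bcontfun k \<tau>)) integrable_on {c s..t1}" for k
        using c[of s] by (intro integrable_continuous_real gc) auto
      have "\<bar>integral {c s..t1} (\<lambda>\<tau>. a \<tau> (apply_bcontfun f \<tau>) - a \<tau> (apply_bcontfun h \<tau>))\<bar> \<le> (L * dist f h) * t1"
      proof (rule ib)
        show "continuous_on {c s..t1} (\<lambda>\<tau>. a \<tau> (apply_bcontfun f \<tau>) - a \<tau> (apply_bcontfun h \<tau>))"
          using c[of s] by (intro continuous_intros gc) auto
        show "\<bar>a \<tau> (apply_bcontfun f \<tau>) - a \<tau> (apply_bcontfun h \<tau>)\<bar> \<le> L * dist f h" if "\<tau> \<in> {c s..t1}" for \<tau>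
        proof -
          have "\<bar>a \<tau> (apply_bcontfun f \<tau>) - a \<tau> (apply_bcontfun h \<tau>)\<bar> \<le> L * \<bar>apply_bcontfun f \<tau> - apply_bcontfun h \<tau>\<bar>"
            using that c[of s] by (intro lip) auto
          also have "\<dots> \<le> L * dist f h"
            using dist_bounded[of f \<tau> h] L0 by (intro mult_left_mono) (auto simp: dist_real_def)
          finally show ?thesis .
        qed
      qed (use L0 in auto)
      also have "\<dots> \<le> 1 / 2 * dist f h"
        using mult_right_mono[OF small, of "dist f h"] by (simp add: ac_simps)
      finally show "dist (apply_bcontfun (\<Phi> f) s) (apply_bcontfun (\<Phi> h) s) \<le> 1 / 2 * dist f h"
        by (simp add: \<Phi> \<Phi>0_def dist_real_def Henstock_Kurzweil_Integration.integral_diff[OF i i] abs_minus_commute)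
    qed
  qed auto
  then obtain f where f: "\<Phi> f = f" by blast
  define X where "X = apply_bcontfun f"
  have X: "X s = x - integral {s..t1} (\<lambda>\<tau>. a \<tau> (X \<tau>))" if "s \<in> {0..t1}" for s
  proof -
    have "X s = \<Phi>0 f s" unfolding X_def by (metis \<Phi> f)
    then show ?thesis using that by (simp add: \<Phi>0_def X_def c_def max_def min_def)
  qed
  show ?thesis
  proof
    show "X t1 = x" using X[of t1] t1 by simp
    show "(X has_real_derivative a t (X t)) (at t within {0..t1})" if t: "t \<in> {0..t1}" for t
    proof -
      have "((\<lambda>s. x - integral {s..t1} (\<lambda>\<tau>. a \<tau> (X \<tau>))) has_real_derivative 0 - (- a t (X t))) (at t within {0..t1})"
        unfolding X_def by (intro DERIV_diff DERIV_const integral_has_real_derivative'[OF gc[of 0 f] t]) simp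
      then have "((\<lambda>s. x - integral {s..t1} (\<lambda>\<tau>. a \<tau> (X \<tau>))) has_real_derivative a t (X t)) (at t within {0..t1})"
        by simp
      then show ?thesis
        by (rule has_field_derivative_transform_within[of _ _ _ _ 1]) (use t X in auto)
    qed
    show "\<bar>X t - x\<bar> \<le> A * t1" if t: "t \<in> {0..t1}" for t
    proof -
      have "c t = t" using t by (auto simp: c_def)
      then have "\<bar>integral {t..t1} (\<lambda>\<tau>. a \<tau> (X \<tau>))\<bar> \<le> A * t1"
        using ib[of t "\<lambda>\<tau>. a \<tau> (X \<tau>)" A] gc[of t f] bd A0 t by (auto simp: X_def)
      then show ?thesis using X[OF t] by linarith
    qed
  qed
qed

text \<open>All three quotients occur when the mean value over [X - r, X + r] is differentiated: the
  symmetric one for averages, the one-sided ones for the velocity.\<close>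

lemma symmetric_difference_quotient_tendsto:
  fixes P :: "real \<Rightarrow> real"
  assumes "(P has_real_derivative p) (at x)" "r \<longlonglongrightarrow> 0" "\<And>n. r n > 0"
  shows "(\<lambda>n. (P (x + r n) - P (x - r n)) / (2 * r n)) \<longlonglongrightarrow> p"
    "(\<lambda>n. (P (x + r n) - P x) / r n) \<longlonglongrightarrow> p" "(\<lambda>n. (P x - P (x - r n)) / r n) \<longlonglongrightarrow> p"
proof -
  have D: "((\<lambda>h. (P (x + h) - P x) / h) \<longlongrightarrow> p) (at 0)"
    using assms(1) by (simp add: DERIV_def)
  have r: "filterlim r (at 0) sequentially"
    using assms(2,3) by (auto simp: filterlim_at less_imp_neq[symmetric] intro!: always_eventually)
  have r': "filterlim (\<lambda>n. - r n) (at 0) sequentially"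
    using tendsto_minus[OF assms(2)] assms(3) by (auto simp: filterlim_at intro!: always_eventually) (metis less_irrefl)
  show 1: "(\<lambda>n. (P (x + r n) - P x) / r n) \<longlonglongrightarrow> p" using filterlim_compose[OF D r] .
  have "(\<lambda>n. (P (x + - r n) - P x) / (- r n)) \<longlonglongrightarrow> p" using filterlim_compose[OF D r'] .
  moreover have "(P (x + - r n) - P x) / (- r n) = (P x - P (x - r n)) / r n" for n
    using assms(3)[of n] by (simp add: field_simps)
  ultimately show 2: "(\<lambda>n. (P x - P (x - r n)) / r n) \<longlonglongrightarrow> p" by simp
  have "(\<lambda>n. ((P (x + r n) - P x) / r n + (P x - P (x - r n)) / r n) / 2) \<longlonglongrightarrow> (p + p) / 2"
    by (intro tendsto_intros 1 2) simp
  moreover have "((P (x + r n) - P x) / r n + (P x - P (x - r n)) / r n) / 2 = (P (x + r n) - P (x - r n)) / (2 * r n)" for n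
    using assms(3)[of n] by (simp add: field_simps)
  ultimately show "(\<lambda>n. (P (x + r n) - P (x - r n)) / (2 * r n)) \<longlonglongrightarrow> p" by (simp only:) simp
qed

lemma integral_average_tendsto:
  fixes h :: "real \<Rightarrow> real"
  assumes h: "continuous_on UNIV h" and r: "r \<longlonglongrightarrow> 0" "\<And>n. r n > 0"
  shows "(\<lambda>n. integral {x - r n..x + r n} h / (2 * r n)) \<longlonglongrightarrow> h x"
proof -
  obtain P where P: "\<And>x. DERIV P x :> h x"
    using einterval_antiderivative[of "-\<infinity>" \<infinity> h] h
    by (auto simp: has_real_derivative_iff_has_vector_derivative continuous_on_eq_continuous_at)
  have "integral {x - r n..x + r n} h = P (x + r n) - P (x - r n)" for n
    by (rule integral_unique, rule fundamental_theorem_of_calculus)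
      (use P r(2)[of n] in \<open>auto simp: has_real_derivative_iff_has_vector_derivative[symmetric] intro: has_field_derivative_at_within\<close>)
  then show ?thesis using symmetric_difference_quotient_tendsto(1)[OF P r] by simp
qed

text \<open>Although \<open>q\<close> is only continuous, its primitive \<open>Q\<close> in space is continuously differentiable, so
  that the chain rule applies to the mean value \<open>V\<close> of \<open>q\<close> over \<open>[X - r, X + r]\<close>.\<close>

lemma balance_law_along_characteristic:
  fixes a ax q g :: "real \<Rightarrow> real \<Rightarrow> real" and X :: "real \<Rightarrow> real"
  assumes t1: "0 < t1"
    and cont: "continuous_on ({0..t1} \<times> UNIV) (\<lambda>(t, x). a t x)"
      "continuous_on ({0..t1} \<times> UNIV) (\<lambda>(t, x). q t x)"
      "continuous_on ({0..t1} \<times> UNIV) (\<lambda>(t, x). g t x)"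
    and a': "\<And>t x. t \<in> {0..t1} \<Longrightarrow> DERIV (a t) x :> ax t x"
    and lip: "\<And>t x y. t \<in> {0..t1} \<Longrightarrow> \<bar>a t x - a t y\<bar> \<le> L * \<bar>x - y\<bar>"
    and bd: "\<And>t x. t \<in> {0..t1} \<Longrightarrow> \<bar>q t x\<bar> \<le> Bq" "\<And>t x. t \<in> {0..t1} \<Longrightarrow> \<bar>g t x\<bar> \<le> Bg"
    and law: "\<And>t x1 x2. t \<in> {0..t1} \<Longrightarrow> x1 < x2 \<Longrightarrow> integral {x1..x2} (\<lambda>x. q t x - q 0 x) =
      - integral {0..t} (\<lambda>\<tau>. a \<tau> x2 * q \<tau> x2 - a \<tau> x1 * q \<tau> x1 + integral {x1..x2} (g \<tau>))"
    and X: "\<And>t. t \<in> {0..t1} \<Longrightarrow> (X has_real_derivative a t (X t)) (at t within {0..t1})"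
    and t: "t \<in> {0..t1}"
  shows "q t (X t) - q 0 (X 0) = - integral {0..t} (\<lambda>\<tau>. ax \<tau> (X \<tau>) * q \<tau> (X \<tau>) + g \<tau> (X \<tau>))"
proof -
  have L0: "0 \<le> L" using lip[of 0 0 1] t1 by force
  have Bq0: "0 \<le> Bq" using bd(1)[of 0 0] t1 by force
  have Xc: "continuous_on {0..t1} X" by (rule DERIV_continuous_on[OF X])
  obtain R where R: "\<And>t. t \<in> {0..t1} \<Longrightarrow> \<bar>X t\<bar> \<le> R"
    using compact_imp_bounded[OF compact_continuous_image[OF Xc compact_Icc]]
    by (metis bounded_iff image_eqI real_norm_def)
  \<comment> \<open>The window contains every [X - r, X + r] with r \<le> 1 and leaves a positive
    distance to the base point c of the primitive.\<close>
  define c d where "c = - R - 2" and "d = R + 2"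
  have cx: "continuous_on S (a \<tau>)" "continuous_on S (q \<tau>)" "continuous_on S (g \<tau>)" if "\<tau> \<in> {0..t1}" for \<tau> S
    using that by (auto intro!: continuous_on_pair_compose[OF cont(1)] continuous_on_pair_compose[OF cont(2)]
        continuous_on_pair_compose[OF cont(3)] continuous_intros)
  have ct: "continuous_on {0..t1} (\<lambda>\<tau>. a \<tau> x)" "continuous_on {0..t1} (\<lambda>\<tau>. q \<tau> x)" for x
    by (auto intro!: continuous_on_pair_compose[OF cont(1)] continuous_on_pair_compose[OF cont(2)] continuous_intros)
  have qi: "q \<tau> integrable_on {u..v}" "g \<tau> integrable_on {u..v}" if "\<tau> \<in> {0..t1}" for \<tau> u v
    using cx[OF that] by (auto intro: integrable_continuous_real)
  define Q where "Q \<tau> y = integral {c..y} (q \<tau>)" for \<tau> y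
  \<comment> \<open>By the integrated law on [c, y], -h is the time derivative of Q at fixed
    y.\<close>
  define h where "h y \<tau> = a \<tau> y * q \<tau> y - a \<tau> c * q \<tau> c + integral {c..y} (g \<tau>)" for y \<tau>
  have hc: "continuous_on {0..t1} (h y)" for y
  proof -
    have "continuous_on ({0..t1} \<times> cbox c y) (\<lambda>(t, x). g t x)"
      using cont(3) by (rule continuous_on_subset) auto
    then have "continuous_on {0..t1} (\<lambda>\<tau>. integral {c..y} (g \<tau>))"
      using integral_continuous_on_param[of "{0..t1}" c y g] by simp
    then show ?thesis unfolding h_def by (intro continuous_intros ct)
  qed
  have Qt: "((\<lambda>s. Q s y) has_real_derivative - h y \<tau>) (at \<tau> within {0..t1})"
    if \<tau>: "\<tau> \<in> {0..t1}" and y: "c < y" for \<tau> y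
  proof -
    have "((\<lambda>s. Q 0 y - integral {0..s} (h y)) has_real_derivative 0 - h y \<tau>) (at \<tau> within {0..t1})"
      by (intro DERIV_diff DERIV_const integral_has_real_derivative[OF hc \<tau>])
    moreover have "Q 0 y - integral {0..s} (h y) = Q s y" if "s \<in> {0..t1}" for s
      using law[OF that y] t1 qi(1)[OF that] qi(1)[of 0 c y] unfolding h_def Q_def
      by (simp add: Henstock_Kurzweil_Integration.integral_diff)
    ultimately show ?thesis
      using has_field_derivative_transform_within[of "\<lambda>s. Q 0 y - integral {0..s} (h y)" "0 - h y \<tau>" \<tau> "{0..t1}" 1 "\<lambda>s. Q s y"] \<tau>
      by simp
  qed
  have W: "((\<lambda>s. Q s (X s + r)) has_real_derivative - h (X \<tau> + r) \<tau> + q \<tau> (X \<tau> + r) * a \<tau> (X \<tau>)) (at \<tau> within {0..t1})"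
    if \<tau>: "\<tau> \<in> {0..t1}" and r: "\<bar>r\<bar> \<le> 1" for \<tau> r
  proof -
    have y: "X s + r \<in> {c..d}" "c < X s + r" if "s \<in> {0..t1}" for s
      using R[OF that] r by (auto simp: c_def d_def)
    have fx: "((\<lambda>s. Q s (X \<tau> + r)) has_derivative (*) (- h (X \<tau> + r) \<tau>)) (at \<tau> within {0..t1})"
      using Qt[OF \<tau> y(2)[OF \<tau>]] by (simp add: has_field_derivative_def)
    have fy: "(Q s has_derivative blinfun_apply (blinfun_mult_right (q s z))) (at z within {c..d})"
      if "s \<in> {0..t1}" "z \<in> {c..d}" for s z
      using integral_has_real_derivative[OF cx(2)[OF that(1)] that(2)]
      by (simp add: has_field_derivative_def Q_def[abs_def])
    have "continuous_on ({0..t1} \<times> {c..d}) (\<lambda>(s, z). q s z)"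
      using cont(2) by (rule continuous_on_subset) auto
    then have "continuous_on ({0..t1} \<times> {c..d}) (\<lambda>(s, z). blinfun_mult_right (q s z))"
      by (auto simp: case_prod_unfold intro!: bounded_linear.continuous_on[OF bounded_linear_blinfun_mult_right])
    then have fyc: "((\<lambda>(s, z). blinfun_mult_right (q s z)) \<longlongrightarrow> blinfun_mult_right (q \<tau> (X \<tau> + r)))
        (at (\<tau>, X \<tau> + r) within {0..t1} \<times> {c..d})"
      using \<tau> y(1)[OF \<tau>] by (auto simp: continuous_on_def)
    \<comment> \<open>Q is differentiable in both variables jointly because both partial derivatives
      exist and the one in y, which is q, is continuous.\<close>
    have "((\<lambda>(s, y). Q s y) has_derivative (\<lambda>(ts, ty). (*) (- h (X \<tau> + r) \<tau>) ts
        + blinfun_apply (blinfun_mult_right (q \<tau> (X \<tau> + r))) ty)) (at (\<tau>, X \<tau> + r) within {0..t1} \<times> {c..d})"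
      by (rule has_derivative_partialsI[where f=Q and fx="(*) (- h (X \<tau> + r) \<tau>)"
          and fy="\<lambda>s z. blinfun_mult_right (q s z)", OF fx fy])
        (use fyc y(1)[OF \<tau>] in \<open>simp_all add: case_prod_unfold continuous_within\<close>)
    then have D: "((\<lambda>(s, y). Q s y) has_derivative (\<lambda>(ts, ty). - h (X \<tau> + r) \<tau> * ts + q \<tau> (X \<tau> + r) * ty))
        (at (\<tau>, X \<tau> + r) within {0..t1} \<times> {c..d})" by simp
    have "((\<lambda>s. (s, X s + r)) has_derivative (\<lambda>k. (k, a \<tau> (X \<tau>) * k))) (at \<tau> within {0..t1})"
      using X[OF \<tau>] unfolding has_field_derivative_def
      by (intro has_derivative_Pair has_derivative_ident) (auto intro!: derivative_eq_intros)
    from has_derivative_in_compose[OF this, where g="\<lambda>(s, y). Q s y"]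
    have cmp: "\<And>g'. ((\<lambda>(s, y). Q s y) has_derivative g') (at (\<tau>, X \<tau> + r) within (\<lambda>s. (s, X s + r)) ` {0..t1}) \<Longrightarrow>
        ((\<lambda>s. Q s (X s + r)) has_derivative (\<lambda>k. g' (k, a \<tau> (X \<tau>) * k))) (at \<tau> within {0..t1})"
      by simp
    have "(\<lambda>s. (s, X s + r)) ` {0..t1} \<subseteq> {0..t1} \<times> {c..d}" using y(1) by blast
    then have "((\<lambda>s. Q s (X s + r)) has_derivative
        (\<lambda>k. - h (X \<tau> + r) \<tau> * k + q \<tau> (X \<tau> + r) * (a \<tau> (X \<tau>) * k))) (at \<tau> within {0..t1})"
      using cmp[OF has_derivative_subset[OF D]] by simp
    then show ?thesis
      unfolding has_field_derivative_def by (rule has_derivative_eq_rhs) (auto simp: algebra_simps)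
  qed
  define r where "r n = 1 / real (Suc n)" for n
  have r: "r n > 0" "r n \<le> 1" for n by (auto simp: r_def)
  have r0: "r \<longlonglongrightarrow> 0" unfolding r_def by (rule LIMSEQ_Suc[OF lim_1_over_n])
  define V where "V n s = (Q s (X s + r n) - Q s (X s - r n)) / (2 * r n)" for n s
  define w where "w n s = (- h (X s + r n) s + q s (X s + r n) * a s (X s)
      - (- h (X s - r n) s + q s (X s - r n) * a s (X s))) / (2 * r n)" for n s
  have Vw: "(V n has_real_derivative w n s) (at s within {0..t1})" if "s \<in> {0..t1}" for n s
    unfolding V_def w_def using W[OF that, of "r n"] W[OF that, of "- r n"] r[of n]
    by (auto intro!: DERIV_cdivide DERIV_diff)
  have w_int: "(w n has_integral V n t - V n 0) {0..t}" for n
    by (rule fundamental_theorem_of_calculus)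
      (use t Vw in \<open>auto simp: has_real_derivative_iff_has_vector_derivative[symmetric]
        intro: DERIV_subset[of _ _ _ "{0..t1}"]\<close>)
  have split: "integral {c..X s + r n} k - integral {c..X s - r n} k = integral {X s - r n..X s + r n} k"
    if "s \<in> {0..t1}" "\<And>u v. k integrable_on {u..v}" for s n and k :: "real \<Rightarrow> real"
  proof -
    have "c \<le> X s - r n" "X s - r n \<le> X s + r n" using R[OF that(1)] r[of n] by (auto simp: c_def)
    then show ?thesis using Henstock_Kurzweil_Integration.integral_combine[of c "X s - r n" "X s + r n" k] that(2)
      by (simp add: algebra_simps)
  qed
  \<comment> \<open>The velocity \<open>a s (X s)\<close> of the moving window is subtracted from
    the flux velocity at each end. What remains are difference quotients of the Lipschitz function
    a, each multiplied by a value of q; no difference quotient of q appears, so continuity of q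
    suffices for the limit.\<close>
  have w_eq: "w n s = - (((a s (X s + r n) - a s (X s)) / r n * q s (X s + r n)
      + (a s (X s) - a s (X s - r n)) / r n * q s (X s - r n)) / 2
      + integral {X s - r n..X s + r n} (g s) / (2 * r n))" if s: "s \<in> {0..t1}" for n s
  proof -
    have "w n s = - ((a s (X s + r n) - a s (X s)) * q s (X s + r n)
      + (a s (X s) - a s (X s - r n)) * q s (X s - r n)
      + (integral {c..X s + r n} (g s) - integral {c..X s - r n} (g s))) / (2 * r n)"
      by (simp add: w_def h_def algebra_simps)
    moreover have "- (p * u + p' * u' + i) / (2 * k) = - ((p / k * u + p' / k * u') / 2 + i / (2 * k))"
      for p p' u u' i k :: real
      by (simp add: add_divide_distrib diff_divide_distrib mult.commute)
    ultimately show ?thesis unfolding split[OF s qi(2)[OF s]] by (simp only:)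
  qed
  have w_bound: "\<bar>w n s\<bar> \<le> L * Bq + Bg" if s: "s \<in> {0..t1}" for n s
  proof -
    have 1: "\<bar>(a s (X s + r n) - a s (X s)) / r n * q s (X s + r n)\<bar> \<le> L * Bq"
      using lip[OF s, of "X s + r n" "X s"] r(1)[of n] L0 unfolding abs_mult
      by (intro mult_mono bd(1) s) (auto simp: field_simps)
    have 2: "\<bar>(a s (X s) - a s (X s - r n)) / r n * q s (X s - r n)\<bar> \<le> L * Bq"
      using lip[OF s, of "X s" "X s - r n"] r(1)[of n] L0 unfolding abs_mult
      by (intro mult_mono bd(1) s) (auto simp: field_simps)
    have "norm (integral {X s - r n..X s + r n} (g s)) \<le> Bg * (X s + r n - (X s - r n))"
      using bd(2)[OF s] r(1)[of n] by (intro integral_bound cx s) auto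
    then have "\<bar>integral {X s - r n..X s + r n} (g s) / (2 * r n)\<bar> \<le> Bg"
      using r(1)[of n] by (simp add: field_simps)
    moreover have "\<bar>- ((p + p') / 2 + i)\<bar> \<le> B + G" if "\<bar>p\<bar> \<le> B" "\<bar>p'\<bar> \<le> B" "\<bar>i\<bar> \<le> G" for p p' i B G :: real
      using that by (simp add: abs_le_iff field_simps)
    ultimately show ?thesis unfolding w_eq[OF s] using 1 2 by blast
  qed
  have qlim: "(\<lambda>n. q s (X s + r n)) \<longlonglongrightarrow> q s (X s)" "(\<lambda>n. q s (X s - r n)) \<longlonglongrightarrow> q s (X s)"
    if s: "s \<in> {0..t1}" for s
  proof -
    have c: "isCont (q s) (X s)" using cx(2)[OF s, of UNIV] by (simp add: continuous_on_eq_continuous_at)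
    have "(\<lambda>n. X s + r n) \<longlonglongrightarrow> X s + 0" "(\<lambda>n. X s - r n) \<longlonglongrightarrow> X s - 0" by (intro tendsto_intros r0)+
    then show "(\<lambda>n. q s (X s + r n)) \<longlonglongrightarrow> q s (X s)" "(\<lambda>n. q s (X s - r n)) \<longlonglongrightarrow> q s (X s)"
      using isCont_tendsto_compose[OF c] by auto
  qed
  have w_lim: "(\<lambda>n. w n s) \<longlonglongrightarrow> - (ax s (X s) * q s (X s) + g s (X s))" if s: "s \<in> {0..t1}" for s
  proof -
    have "(\<lambda>n. w n s) \<longlonglongrightarrow> - ((ax s (X s) * q s (X s) + ax s (X s) * q s (X s)) / 2 + g s (X s))"
      unfolding w_eq[OF s]
      by (intro tendsto_intros qlim s symmetric_difference_quotient_tendsto[OF a'[OF s] r0 r(1)]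
        integral_average_tendsto[OF cx(3)[OF s] r0 r(1)]) simp
    then show ?thesis by simp
  qed
  have V_lim: "(\<lambda>n. V n s) \<longlonglongrightarrow> q s (X s)" if s: "s \<in> {0..t1}" for s
    using integral_average_tendsto[OF cx(2)[OF s] r0 r(1)]
    unfolding V_def Q_def split[OF s qi(1)[OF s]] .
  have "(\<lambda>n. integral {0..t} (w n)) \<longlonglongrightarrow> integral {0..t} (\<lambda>s. - (ax s (X s) * q s (X s) + g s (X s)))"
    by (rule dominated_convergence(2)[where h="\<lambda>s. L * Bq + Bg"])
      (use w_int w_lim w_bound t in \<open>auto simp: has_integral_integrable\<close>)
  moreover have "(\<lambda>n. integral {0..t} (w n)) \<longlonglongrightarrow> q t (X t) - q 0 (X 0)"
    using tendsto_diff[OF V_lim[OF t] V_lim[of 0]] t1 integral_unique[OF w_int] by simp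
  ultimately show ?thesis
    unfolding Henstock_Kurzweil_Integration.integral_neg by (rule LIMSEQ_unique[rotated])
qed

text \<open>Let M be the maximum of |q| along the characteristic ending at (t, x). The equation
  gives M \<le> |q 0 (X 0)| + (M + 2 D / \<phi> x) / 2, and the M on the right is absorbed. The
  factor 2 in the weight, applied at the starting point, turns 2 |q 0 (X 0)| into at most 4 C /
  \<phi> x. D stands for the weighted bound of another unknown that drives q through the
  source.\<close>

lemma balance_law_weighted_bound:
  fixes a ax q g :: "real \<Rightarrow> real \<Rightarrow> real" and \<phi> :: "real \<Rightarrow> real"
  assumes cont: "continuous_on ({0..t0} \<times> UNIV) (\<lambda>(t, x). a t x)"
      "continuous_on ({0..t0} \<times> UNIV) (\<lambda>(t, x). ax t x)"
      "continuous_on ({0..t0} \<times> UNIV) (\<lambda>(t, x). q t x)"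
      "continuous_on ({0..t0} \<times> UNIV) (\<lambda>(t, x). g t x)"
    and a': "\<And>t x. t \<in> {0..t0} \<Longrightarrow> DERIV (a t) x :> ax t x"
    and bd: "\<And>t x. t \<in> {0..t0} \<Longrightarrow> \<bar>a t x\<bar> \<le> A" "\<And>t x. t \<in> {0..t0} \<Longrightarrow> \<bar>ax t x\<bar> \<le> L"
      "\<And>t x. t \<in> {0..t0} \<Longrightarrow> \<bar>q t x\<bar> \<le> Bq" "\<And>t x. t \<in> {0..t0} \<Longrightarrow> \<bar>g t x\<bar> \<le> Bg"
    and law: "\<And>t x1 x2. t \<in> {0..t0} \<Longrightarrow> x1 < x2 \<Longrightarrow> integral {x1..x2} (\<lambda>x. q t x - q 0 x) =
      - integral {0..t} (\<lambda>\<tau>. a \<tau> x2 * q \<tau> x2 - a \<tau> x1 * q \<tau> x1 + integral {x1..x2} (g \<tau>))"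
    and \<phi>: "\<And>x. 0 < \<phi> x" "\<And>x y. \<bar>x - y\<bar> \<le> A * t0 \<Longrightarrow> \<phi> x \<le> 2 * \<phi> y"
    and source: "\<And>t x. t \<in> {0..t0} \<Longrightarrow> \<bar>ax t x * q t x + g t x\<bar> \<le> K * (\<bar>q t x\<bar> + D / \<phi> x)"
    and init: "\<And>x. \<bar>q 0 x\<bar> * \<phi> x \<le> C"
    and small: "L * t0 \<le> 1 / 2" "K * t0 \<le> 1 / 2" and K: "0 \<le> K" and D: "0 \<le> D"
    and t: "t \<in> {0..t0}"
  shows "\<bar>q t x\<bar> * \<phi> x \<le> 4 * C + 2 * D"
proof (cases "t = 0")
  case True
  have "0 \<le> C" using init[of 0] \<phi>(1)[of 0] by (meson abs_ge_zero less_imp_le mult_nonneg_nonneg order_trans)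
  then show ?thesis using init[of x] D True by simp
next
  case False
  then have t0: "0 < t" "t \<le> t0" using t by auto
  have L0: "0 \<le> L" and A0: "0 \<le> A" using bd(1)[of t 0] bd(2)[of t 0] t by (meson abs_ge_zero order_trans)+
  have lip: "\<bar>a s x - a s y\<bar> \<le> L * \<bar>x - y\<bar>" if s: "s \<in> {0..t0}" for s x y
  proof -
    have "norm (a s x - a s y) \<le> L * norm (x - y)"
      by (rule field_differentiable_bound[of UNIV "a s" "ax s"]) (use a' bd(2) s in auto)
    then show ?thesis by simp
  qed
  have sub: "{0..t} \<subseteq> {0..t0}" using t0 by auto
  have c: "continuous_on ({0..t} \<times> UNIV) (\<lambda>(t, x). a t x)"
      "continuous_on ({0..t} \<times> UNIV) (\<lambda>(t, x). ax t x)"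
      "continuous_on ({0..t} \<times> UNIV) (\<lambda>(t, x). q t x)"
      "continuous_on ({0..t} \<times> UNIV) (\<lambda>(t, x). g t x)"
    using cont[THEN continuous_on_subset, OF Sigma_mono[OF sub order_refl]] by auto
  have "L * t \<le> L * t0" "A * t \<le> A * t0" using t0 L0 A0 by (auto intro: mult_left_mono)
  then have Lt: "L * t \<le> 1 / 2" and At: "A * t \<le> A * t0" using small by linarith+
  obtain X where X: "X t = x" "\<And>s. s \<in> {0..t} \<Longrightarrow> (X has_real_derivative a s (X s)) (at s within {0..t})"
    "\<And>s. s \<in> {0..t} \<Longrightarrow> \<bar>X s - x\<bar> \<le> A * t"
    by (rule characteristic_exists[of t a A L x]) (use t0 c bd lip Lt sub in auto)
  have Xc: "continuous_on {0..t} X" by (rule DERIV_continuous_on[OF X(2)])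
  have along: "q s (X s) - q 0 (X 0) = - integral {0..s} (\<lambda>\<tau>. ax \<tau> (X \<tau>) * q \<tau> (X \<tau>) + g \<tau> (X \<tau>))"
    if s: "s \<in> {0..t}" for s
    by (rule balance_law_along_characteristic[of t a q g ax L Bq Bg X s])
      (use t0 c a' lip bd law X s in auto)
  have \<phi>x: "\<phi> x \<le> 2 * \<phi> (X s)" if "s \<in> {0..t}" for s
    by (rule \<phi>(2)) (use X(3)[OF that] At in \<open>auto simp: abs_minus_commute\<close>)
  have "continuous_on {0..t} (\<lambda>s. \<bar>q s (X s)\<bar>)"
    by (auto intro!: continuous_intros continuous_on_pair_compose[OF c(3)] Xc)
  from continuous_attains_sup[OF compact_Icc _ this]
  \<comment> \<open>The maximum is attained, hence finite before any weighted bound on q is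
    available; this is what permits absorbing it.\<close>
  obtain s0 where s0: "s0 \<in> {0..t}" "\<And>s. s \<in> {0..t} \<Longrightarrow> \<bar>q s (X s)\<bar> \<le> \<bar>q s0 (X s0)\<bar>"
    using t0 by auto
  define M where "M = \<bar>q s0 (X s0)\<bar>"
  have B: "\<bar>ax \<tau> (X \<tau>) * q \<tau> (X \<tau>) + g \<tau> (X \<tau>)\<bar> \<le> K * (M + 2 * D / \<phi> x)" if \<tau>: "\<tau> \<in> {0..t}" for \<tau>
  proof -
    \<comment> \<open>The weight is frozen at the end point x, at the price of the factor 2 granted
      by the small displacement.\<close>
    have "D / \<phi> (X \<tau>) \<le> 2 * D / \<phi> x"
      using \<phi>x[OF \<tau>] \<phi>(1)[of x] \<phi>(1)[of "X \<tau>"] D mult_left_mono[of "\<phi> x" "2 * \<phi> (X \<tau>)" D] by (simp add: field_simps)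
    then have "\<bar>q \<tau> (X \<tau>)\<bar> + D / \<phi> (X \<tau>) \<le> M + 2 * D / \<phi> x" using s0(2)[OF \<tau>] by (simp add: M_def)
    then show ?thesis using source[of \<tau> "X \<tau>"] \<tau> sub K by (meson mult_left_mono order_trans subset_iff)
  qed
  have E0: "0 \<le> M + 2 * D / \<phi> x" using D \<phi>(1)[of x] by (auto simp: M_def intro!: add_nonneg_nonneg divide_nonneg_pos)
  have "norm (integral {0..s0} (\<lambda>\<tau>. ax \<tau> (X \<tau>) * q \<tau> (X \<tau>) + g \<tau> (X \<tau>))) \<le> K * (M + 2 * D / \<phi> x) * (s0 - 0)"
  proof (rule integral_bound)
    show "continuous_on {0..s0} (\<lambda>\<tau>. ax \<tau> (X \<tau>) * q \<tau> (X \<tau>) + g \<tau> (X \<tau>))"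
      using s0(1) by (auto intro!: continuous_intros continuous_on_pair_compose[OF c(2)] continuous_on_pair_compose[OF c(3)]
          continuous_on_pair_compose[OF c(4)] intro: continuous_on_subset[OF Xc])
  qed (use s0(1) B in auto)
  also have "\<dots> = (K * s0) * (M + 2 * D / \<phi> x)" by simp
  also have "\<dots> \<le> 1 / 2 * (M + 2 * D / \<phi> x)"
    using E0 mult_left_mono[of s0 t0 K] s0(1) t0 K small by (intro mult_right_mono) auto
  finally have "M \<le> \<bar>q 0 (X 0)\<bar> + 1 / 2 * (M + 2 * D / \<phi> x)"
    using along[OF s0(1)] unfolding M_def real_norm_def by linarith
  then have "M \<le> 2 * \<bar>q 0 (X 0)\<bar> + 2 * D / \<phi> x" by (simp add: field_simps)
  moreover have "\<bar>q t x\<bar> \<le> M" using s0(2)[of t] t0 X(1) by (simp add: M_def)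
  ultimately have "\<bar>q t x\<bar> \<le> 2 * \<bar>q 0 (X 0)\<bar> + 2 * D / \<phi> x" by linarith
  then have "\<bar>q t x\<bar> * \<phi> x \<le> (2 * \<bar>q 0 (X 0)\<bar> + 2 * D / \<phi> x) * \<phi> x"
    using \<phi>(1)[of x] by (intro mult_right_mono) auto
  also have "\<dots> = 2 * (\<bar>q 0 (X 0)\<bar> * \<phi> x) + 2 * D" using \<phi>(1)[of x] by (simp add: field_simps)
  also have "\<bar>q 0 (X 0)\<bar> * \<phi> x \<le> \<bar>q 0 (X 0)\<bar> * (2 * \<phi> (X 0))"
    using \<phi>x[of 0] t0 by (intro mult_left_mono) auto
  also have "\<dots> \<le> 2 * C" using init[of "X 0"] by simp
  finally show ?thesis by simp
qed

section \<open>Fourier inversion and Sobolev embedding\<close>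

text \<open>Dominates an L2 function on a bounded interval, or against a bounded integrable weight,
  by an integrable one.\<close>

lemma abs_le_1_plus_square: "\<bar>y\<bar> \<le> 1 + y\<^sup>2" for y :: real
  using zero_le_power2[of "\<bar>y\<bar> - 1"] by (simp add: power2_diff)

section \<open>The Plancherel transform: linearity and uniqueness\<close>

lemma square_integrable_measurable [measurable_dest]:
  "square_integrable f \<Longrightarrow> f \<in> borel_measurable borel"
  by (simp add: square_integrable_def)

lemma square_integrable_set_integrable:
  fixes f :: "real \<Rightarrow> real"
  assumes "square_integrable f"
  shows "set_integrable lborel {a..b} f"
  unfolding set_integrable_def
proof (rule Bochner_Integration.integrable_bound)
  have [measurable]: "f \<in> borel_measurable borel" using assms by (rule square_integrable_measurable)
  show "integrable lborel (\<lambda>x. indicator {a..b} x *\<^sub>R (1::real) + (norm (f x))\<^sup>2)"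
    using assms integrable_real_indicator[of "{a..b}" lborel]
    by (intro Bochner_Integration.integrable_add) (auto simp: square_integrable_def emeasure_lborel_Icc_eq)
  show "(\<lambda>x. indicator {a..b} x *\<^sub>R f x) \<in> borel_measurable lborel" by measurable
  show "AE x in lborel. norm (indicator {a..b} x *\<^sub>R f x)
      \<le> norm (indicator {a..b} x *\<^sub>R (1::real) + (norm (f x))\<^sup>2)"
    using abs_le_1_plus_square by (intro AE_I2) (auto simp: indicator_def)
qed

lemma truncated_fourier_measurable [measurable]:
  assumes [measurable]: "f \<in> borel_measurable borel"
  shows "truncated_fourier R f \<in> borel_measurable borel"
  unfolding truncated_fourier_def[abs_def] set_lebesgue_integral_def by measurable

lemma truncated_fourier_integrable:
  assumes "square_integrable f"
  shows "complex_set_integrable lborel {-R..R} (\<lambda>x. exp (- \<i> * complex_of_real (x * \<xi>)) * complex_of_real (f x))"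
  unfolding set_integrable_def
proof (rule Bochner_Integration.integrable_bound)
  have [measurable]: "f \<in> borel_measurable borel" using assms by (rule square_integrable_measurable)
  show "integrable lborel (\<lambda>x. indicator {-R..R} x *\<^sub>R f x)"
    using square_integrable_set_integrable[OF assms] by (simp add: set_integrable_def)
  show "(\<lambda>x. indicator {-R..R} x *\<^sub>R (exp (- \<i> * complex_of_real (x * \<xi>)) * complex_of_real (f x))) \<in> borel_measurable lborel"
    by measurable
  show "AE x in lborel. norm (indicator {-R..R} x *\<^sub>R (exp (- \<i> * complex_of_real (x * \<xi>)) * complex_of_real (f x)))
      \<le> norm (indicator {-R..R} x *\<^sub>R f x)"
    by (intro AE_I2) (simp add: norm_mult)
qed

lemma truncated_fourier_diff:
  assumes "square_integrable f" "square_integrable h"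
  shows "truncated_fourier R (\<lambda>x. f x - h x) \<xi> = truncated_fourier R f \<xi> - truncated_fourier R h \<xi>"
proof -
  have "(LINT x:{-R..R}|lborel. exp (- \<i> * complex_of_real (x * \<xi>)) * complex_of_real (f x - h x))
    = (LINT x:{-R..R}|lborel. exp (- \<i> * complex_of_real (x * \<xi>)) * complex_of_real (f x)
       - exp (- \<i> * complex_of_real (x * \<xi>)) * complex_of_real (h x))"
    by (simp add: right_diff_distrib)
  also have "\<dots> = (LINT x:{-R..R}|lborel. exp (- \<i> * complex_of_real (x * \<xi>)) * complex_of_real (f x))
       - (LINT x:{-R..R}|lborel. exp (- \<i> * complex_of_real (x * \<xi>)) * complex_of_real (h x))"
    by (rule set_integral_diff) (use assms truncated_fourier_integrable in auto)
  finally show ?thesis by (simp add: truncated_fourier_def right_diff_distrib)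
qed

lemma norm_diff_square_le:
  fixes a b :: "'a::real_normed_vector"
  shows "(norm (a - b))\<^sup>2 \<le> 2 * (norm a)\<^sup>2 + 2 * (norm b)\<^sup>2"
proof -
  have "(norm (a - b))\<^sup>2 \<le> (norm a + norm b)\<^sup>2"
    by (rule power_mono[OF norm_triangle_ineq4]) simp
  also have "\<dots> \<le> 2 * (norm a)\<^sup>2 + 2 * (norm b)\<^sup>2"
    using zero_le_power2[of "norm a - norm b"] by (simp add: power2_eq_square algebra_simps)
  finally show ?thesis .
qed

lemma square_integrable_diff:
  assumes "square_integrable f" "square_integrable h"
  shows "square_integrable (\<lambda>x. f x - h x)"
  unfolding square_integrable_def
proof
  have [measurable]: "f \<in> borel_measurable borel" "h \<in> borel_measurable borel"
    using assms by (simp_all add: square_integrable_def)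
  show "(\<lambda>x. f x - h x) \<in> borel_measurable lborel" by measurable
  show "integrable lborel (\<lambda>x. (norm (f x - h x))\<^sup>2)"
  proof (rule Bochner_Integration.integrable_bound)
    show "integrable lborel (\<lambda>x. 2 * (norm (f x))\<^sup>2 + 2 * (norm (h x))\<^sup>2)"
      using assms by (simp add: square_integrable_def)
    show "(\<lambda>x. (norm (f x - h x))\<^sup>2) \<in> borel_measurable lborel" by measurable
  qed (use norm_diff_square_le[of "f _" "h _"] in auto)
qed

text \<open>With nonnegative integrals no integrability of the truncated transforms has to be shown,
  and the inequality combines directly with the limits in \<open>has_fourier_L2\<close>.\<close>

lemma nn_integral_diff_square_le:
  fixes A B :: "real \<Rightarrow> complex"
  assumes [measurable]: "A \<in> borel_measurable borel" "B \<in> borel_measurable borel"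
  shows "(\<integral>\<^sup>+\<xi>. ennreal ((cmod (A \<xi> - B \<xi>))\<^sup>2) \<partial>lborel)
    \<le> 2 * (\<integral>\<^sup>+\<xi>. ennreal ((cmod (A \<xi>))\<^sup>2) \<partial>lborel) + 2 * (\<integral>\<^sup>+\<xi>. ennreal ((cmod (B \<xi>))\<^sup>2) \<partial>lborel)"
proof -
  have "(\<integral>\<^sup>+\<xi>. ennreal ((cmod (A \<xi> - B \<xi>))\<^sup>2) \<partial>lborel)
    \<le> (\<integral>\<^sup>+\<xi>. 2 * ennreal ((cmod (A \<xi>))\<^sup>2) + 2 * ennreal ((cmod (B \<xi>))\<^sup>2) \<partial>lborel)"
  proof (rule nn_integral_mono)
    fix \<xi>
    have "ennreal ((cmod (A \<xi> - B \<xi>))\<^sup>2) \<le> ennreal (2 * (cmod (A \<xi>))\<^sup>2 + 2 * (cmod (B \<xi>))\<^sup>2)"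
      by (rule ennreal_leI[OF norm_diff_square_le])
    also have "\<dots> = 2 * ennreal ((cmod (A \<xi>))\<^sup>2) + 2 * ennreal ((cmod (B \<xi>))\<^sup>2)"
      by (simp add: ennreal_plus ennreal_mult)
    finally show "ennreal ((cmod (A \<xi> - B \<xi>))\<^sup>2) \<le> 2 * ennreal ((cmod (A \<xi>))\<^sup>2) + 2 * ennreal ((cmod (B \<xi>))\<^sup>2)" .
  qed
  also have "\<dots> = 2 * (\<integral>\<^sup>+\<xi>. ennreal ((cmod (A \<xi>))\<^sup>2) \<partial>lborel) + 2 * (\<integral>\<^sup>+\<xi>. ennreal ((cmod (B \<xi>))\<^sup>2) \<partial>lborel)"
    by (subst nn_integral_add) (auto simp: nn_integral_cmult)
  finally show ?thesis .
qed

lemma has_fourier_L2_diff: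
  assumes "has_fourier_L2 f g" "has_fourier_L2 f' g'"
  shows "has_fourier_L2 (\<lambda>x. f x - f' x) (\<lambda>\<xi>. g \<xi> - g' \<xi>)"
  unfolding has_fourier_L2_def
proof (intro conjI)
  have f: "square_integrable f" "square_integrable f'" "square_integrable g" "square_integrable g'"
    using assms by (simp_all add: has_fourier_L2_def)
  have [measurable]: "f \<in> borel_measurable borel" "f' \<in> borel_measurable borel"
      "g \<in> borel_measurable borel" "g' \<in> borel_measurable borel"
    using f by (simp_all add: square_integrable_def)
  show "square_integrable (\<lambda>x. f x - f' x)" "square_integrable (\<lambda>\<xi>. g \<xi> - g' \<xi>)"
    using f by (auto intro: square_integrable_diff)
  have lim: "((\<lambda>R. 2 * (\<integral>\<^sup>+\<xi>. ennreal ((cmod (truncated_fourier R f \<xi> - g \<xi>))\<^sup>2) \<partial>lborel)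
     + 2 * (\<integral>\<^sup>+\<xi>. ennreal ((cmod (truncated_fourier R f' \<xi> - g' \<xi>))\<^sup>2) \<partial>lborel)) \<longlongrightarrow> 2 * 0 + 2 * 0) at_top"
    using assms by (intro tendsto_add ennreal_tendsto_cmult) (auto simp: has_fourier_L2_def)
  have le: "(\<integral>\<^sup>+\<xi>. ennreal ((cmod (truncated_fourier R (\<lambda>x. f x - f' x) \<xi> - (g \<xi> - g' \<xi>)))\<^sup>2) \<partial>lborel)
    \<le> 2 * (\<integral>\<^sup>+\<xi>. ennreal ((cmod (truncated_fourier R f \<xi> - g \<xi>))\<^sup>2) \<partial>lborel)
     + 2 * (\<integral>\<^sup>+\<xi>. ennreal ((cmod (truncated_fourier R f' \<xi> - g' \<xi>))\<^sup>2) \<partial>lborel)" for R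
    using nn_integral_diff_square_le[of "\<lambda>\<xi>. truncated_fourier R f \<xi> - g \<xi>" "\<lambda>\<xi>. truncated_fourier R f' \<xi> - g' \<xi>"]
    by (simp add: truncated_fourier_diff f algebra_simps)
  show "((\<lambda>R. \<integral>\<^sup>+\<xi>. ennreal ((cmod (truncated_fourier R (\<lambda>x. f x - f' x) \<xi> - (g \<xi> - g' \<xi>)))\<^sup>2) \<partial>lborel) \<longlongrightarrow> 0) at_top"
    by (rule tendsto_sandwich[OF _ _ tendsto_const])
      (use lim le in \<open>auto intro!: always_eventually\<close>)
qed

text \<open>Both transforms are L2 limits of the same truncated integrals, so their distance is at
  most a quantity that tends to 0.\<close>

lemma has_fourier_L2_unique:
  assumes "has_fourier_L2 f g" "has_fourier_L2 f g'"
  shows "AE \<xi> in lborel. g \<xi> = g' \<xi>"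
proof -
  have [measurable]: "f \<in> borel_measurable borel" "g \<in> borel_measurable borel" "g' \<in> borel_measurable borel"
    using assms by (auto simp: has_fourier_L2_def square_integrable_def)
  have lim: "((\<lambda>R. 2 * (\<integral>\<^sup>+\<xi>. ennreal ((cmod (truncated_fourier R f \<xi> - g \<xi>))\<^sup>2) \<partial>lborel)
     + 2 * (\<integral>\<^sup>+\<xi>. ennreal ((cmod (truncated_fourier R f \<xi> - g' \<xi>))\<^sup>2) \<partial>lborel)) \<longlongrightarrow> 2 * 0 + 2 * 0) at_top"
    using assms by (intro tendsto_add ennreal_tendsto_cmult) (auto simp: has_fourier_L2_def)
  have le: "(\<integral>\<^sup>+\<xi>. ennreal ((cmod (g' \<xi> - g \<xi>))\<^sup>2) \<partial>lborel)
    \<le> 2 * (\<integral>\<^sup>+\<xi>. ennreal ((cmod (truncated_fourier R f \<xi> - g \<xi>))\<^sup>2) \<partial>lborel)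
     + 2 * (\<integral>\<^sup>+\<xi>. ennreal ((cmod (truncated_fourier R f \<xi> - g' \<xi>))\<^sup>2) \<partial>lborel)" for R
    using nn_integral_diff_square_le[of "\<lambda>\<xi>. truncated_fourier R f \<xi> - g \<xi>" "\<lambda>\<xi>. truncated_fourier R f \<xi> - g' \<xi>"]
    by simp
  have "(\<integral>\<^sup>+\<xi>. ennreal ((cmod (g' \<xi> - g \<xi>))\<^sup>2) \<partial>lborel) \<le> 2 * 0 + 2 * 0"
    by (rule tendsto_lowerbound[OF lim]) (use le in \<open>auto intro!: always_eventually\<close>)
  then have "(\<integral>\<^sup>+\<xi>. ennreal ((cmod (g' \<xi> - g \<xi>))\<^sup>2) \<partial>lborel) = 0" by simp
  then have "AE \<xi> in lborel. ennreal ((cmod (g' \<xi> - g \<xi>))\<^sup>2) = 0"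
    by (subst (asm) nn_integral_0_iff_AE) auto
  then show ?thesis by eventually_elim (auto simp: ennreal_eq_0_iff)
qed

text \<open>\<open>in_sobolev\<close> speaks of some transform and \<open>sobolev_norm\<close> of
  the chosen one; uniqueness up to null sets transfers the weighted integrability to the
  latter.\<close>

lemma in_sobolev_fourier_L2:
  assumes "in_sobolev r f"
  shows "has_fourier_L2 f (fourier_L2 f)"
    "integrable lborel (\<lambda>\<xi>. (1 + \<xi>\<^sup>2) powr r * (cmod (fourier_L2 f \<xi>))\<^sup>2)"
proof -
  obtain g where g: "has_fourier_L2 f g" "integrable lborel (\<lambda>\<xi>. (1 + \<xi>\<^sup>2) powr r * (cmod (g \<xi>))\<^sup>2)"
    using assms by (auto simp: in_sobolev_def)
  show F: "has_fourier_L2 f (fourier_L2 f)"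
    unfolding fourier_L2_def by (rule someI[where P="has_fourier_L2 f", OF g(1)])
  have [measurable]: "g \<in> borel_measurable borel" "fourier_L2 f \<in> borel_measurable borel"
    using F g by (auto simp: has_fourier_L2_def square_integrable_def)
  show "integrable lborel (\<lambda>\<xi>. (1 + \<xi>\<^sup>2) powr r * (cmod (fourier_L2 f \<xi>))\<^sup>2)"
  proof (rule integrable_cong_AE_imp[OF g(2)])
    show "AE \<xi> in lborel. (1 + \<xi>\<^sup>2) powr r * (cmod (g \<xi>))\<^sup>2 = (1 + \<xi>\<^sup>2) powr r * (cmod (fourier_L2 f \<xi>))\<^sup>2"
      using has_fourier_L2_unique[OF F g(1)] by eventually_elim simp
  qed measurable
qed

lemma in_sobolev_measurable: "in_sobolev r f \<Longrightarrow> f \<in> borel_measurable borel"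
  by (auto simp: in_sobolev_def has_fourier_L2_def square_integrable_def)

text \<open>Continuity in time is expressed by the norm of \<open>f \<tau> - f t\<close>, and the
  embedding will be applied to this difference.\<close>

lemma in_sobolev_diff:
  assumes "in_sobolev r f" "in_sobolev r h"
  shows "in_sobolev r (\<lambda>x. f x - h x)"
proof -
  obtain g where g: "has_fourier_L2 f g" "integrable lborel (\<lambda>\<xi>. (1 + \<xi>\<^sup>2) powr r * (cmod (g \<xi>))\<^sup>2)"
    using assms by (auto simp: in_sobolev_def)
  obtain k where k: "has_fourier_L2 h k" "integrable lborel (\<lambda>\<xi>. (1 + \<xi>\<^sup>2) powr r * (cmod (k \<xi>))\<^sup>2)"
    using assms by (auto simp: in_sobolev_def)
  have [measurable]: "g \<in> borel_measurable borel" "k \<in> borel_measurable borel"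
    using k g by (auto simp: has_fourier_L2_def square_integrable_def)
  have "integrable lborel (\<lambda>\<xi>. (1 + \<xi>\<^sup>2) powr r * (cmod (g \<xi> - k \<xi>))\<^sup>2)"
  proof (rule Bochner_Integration.integrable_bound)
    show "integrable lborel (\<lambda>\<xi>. 2 * ((1 + \<xi>\<^sup>2) powr r * (cmod (g \<xi>))\<^sup>2) + 2 * ((1 + \<xi>\<^sup>2) powr r * (cmod (k \<xi>))\<^sup>2))"
      using g k by simp
    show "(\<lambda>\<xi>. (1 + \<xi>\<^sup>2) powr r * (cmod (g \<xi> - k \<xi>))\<^sup>2) \<in> borel_measurable lborel" by measurable
    show "AE \<xi> in lborel. norm ((1 + \<xi>\<^sup>2) powr r * (cmod (g \<xi> - k \<xi>))\<^sup>2)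
        \<le> norm (2 * ((1 + \<xi>\<^sup>2) powr r * (cmod (g \<xi>))\<^sup>2) + 2 * ((1 + \<xi>\<^sup>2) powr r * (cmod (k \<xi>))\<^sup>2))"
    proof (rule AE_I2)
      fix \<xi>
      have "(1 + \<xi>\<^sup>2) powr r * (cmod (g \<xi> - k \<xi>))\<^sup>2 \<le> (1 + \<xi>\<^sup>2) powr r * (2 * (cmod (g \<xi>))\<^sup>2 + 2 * (cmod (k \<xi>))\<^sup>2)"
        by (rule mult_left_mono[OF norm_diff_square_le]) simp
      then show "norm ((1 + \<xi>\<^sup>2) powr r * (cmod (g \<xi> - k \<xi>))\<^sup>2)
        \<le> norm (2 * ((1 + \<xi>\<^sup>2) powr r * (cmod (g \<xi>))\<^sup>2) + 2 * ((1 + \<xi>\<^sup>2) powr r * (cmod (k \<xi>))\<^sup>2))"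
        by (simp add: algebra_simps)
    qed
  qed
  then show ?thesis using has_fourier_L2_diff[OF g(1) k(1)] by (auto simp: in_sobolev_def)
qed

section \<open>Gaussian regularisation and Fourier inversion\<close>

lemma std_normal_density_le_1: "std_normal_density z \<le> 1"
proof -
  have "1 / sqrt (2 * pi) \<le> 1" using pi_ge_two by (simp add: field_simps real_le_rsqrt)
  then show ?thesis unfolding std_normal_density_def
    by (intro mult_le_one) auto
qed

text \<open>This is the characteristic function of the standard normal distribution, rescaled by
  \<epsilon>.\<close>

lemma gaussian_fourier:
  assumes "0 < \<epsilon>"
  shows "integrable lborel (\<lambda>\<xi>. exp (- (\<epsilon> * \<xi>)\<^sup>2 / 2))"
    and "(LINT \<xi>|lborel. iexp (s * \<xi>) * complex_of_real (exp (- (\<epsilon> * \<xi>)\<^sup>2 / 2)))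
      = complex_of_real (sqrt (2 * pi) / \<epsilon> * exp (- (s / \<epsilon>)\<^sup>2 / 2))"
proof -
  have "integrable lborel (\<lambda>\<xi>. std_normal_density (0 + \<epsilon> * \<xi>))"
    using assms by (subst lborel_integrable_real_affine_iff) auto
  then have "integrable lborel (\<lambda>\<xi>. sqrt (2 * pi) * std_normal_density (0 + \<epsilon> * \<xi>))" by simp
  then show "integrable lborel (\<lambda>\<xi>. exp (- (\<epsilon> * \<xi>)\<^sup>2 / 2))" by (simp add: std_normal_density_def)
  have "complex_of_real (exp (- (s / \<epsilon>)\<^sup>2 / 2)) = (CLINT x|std_normal_distribution. iexp (s / \<epsilon> * x))"
    using fun_cong[OF char_std_normal_distribution, of "s / \<epsilon>"] by (simp add: char_def)
  also have "\<dots> = (CLINT x|lborel. std_normal_density x *\<^sub>R iexp (s / \<epsilon> * x))"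
    by (subst integral_density) auto
  also have "\<dots> = \<epsilon> *\<^sub>R (CLINT \<xi>|lborel. std_normal_density (0 + \<epsilon> * \<xi>) *\<^sub>R iexp (s / \<epsilon> * (0 + \<epsilon> * \<xi>)))"
    using assms by (subst lborel_integral_real_affine[of \<epsilon> _ 0]) auto
  also have "(\<lambda>\<xi>. std_normal_density (0 + \<epsilon> * \<xi>) *\<^sub>R iexp (s / \<epsilon> * (0 + \<epsilon> * \<xi>)))
    = (\<lambda>\<xi>. complex_of_real (1 / sqrt (2 * pi)) * (iexp (s * \<xi>) * complex_of_real (exp (- (\<epsilon> * \<xi>)\<^sup>2 / 2))))"
    using assms by (auto simp: std_normal_density_def fun_eq_iff scaleR_conv_of_real)
  also have "(CLINT \<xi>|lborel. complex_of_real (1 / sqrt (2 * pi)) * (iexp (s * \<xi>) * complex_of_real (exp (- (\<epsilon> * \<xi>)\<^sup>2 / 2))))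
    = complex_of_real (1 / sqrt (2 * pi)) * (CLINT \<xi>|lborel. iexp (s * \<xi>) * complex_of_real (exp (- (\<epsilon> * \<xi>)\<^sup>2 / 2)))"
    by simp
  finally show "(LINT \<xi>|lborel. iexp (s * \<xi>) * complex_of_real (exp (- (\<epsilon> * \<xi>)\<^sup>2 / 2)))
      = complex_of_real (sqrt (2 * pi) / \<epsilon> * exp (- (s / \<epsilon>)\<^sup>2 / 2))"
    using assms by (simp add: scaleR_conv_of_real field_simps)
qed

text \<open>Fubini moves the damped inverse transform onto the Gaussian, whose transform is
  explicit; after y = x + \<epsilon> z the result is an average of the truncated function around x
  at scale \<epsilon>. The damping provides absolute convergence in \<xi>, where the truncated
  transform is only known to be bounded.\<close>

lemma truncated_fourier_gaussian:
  assumes f: "square_integrable f" and \<epsilon>: "0 < \<epsilon>"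
  shows "complex_of_real (1 / sqrt (2 * pi)) *
      (LINT \<xi>|lborel. truncated_fourier R f \<xi> * (iexp (x * \<xi>) * complex_of_real (exp (- (\<epsilon> * \<xi>)\<^sup>2 / 2))))
    = complex_of_real (LINT z|lborel. indicator {-R..R} (x + \<epsilon> * z) * f (x + \<epsilon> * z) * std_normal_density z)"
proof -
  have [measurable]: "f \<in> borel_measurable borel" using f by (rule square_integrable_measurable)
  define c where "c = complex_of_real (1 / sqrt (2 * pi))"
  define e where "e \<xi> = exp (- (\<epsilon> * \<xi>)\<^sup>2 / 2)" for \<xi>
  define F where "F y = indicator {-R..R} y * f y" for y
  have e_int: "integrable lborel e" using gaussian_fourier(1)[OF \<epsilon>] by (simp add: e_def[abs_def])
  have F_int: "integrable lborel F"
    using square_integrable_set_integrable[OF f] by (simp add: set_integrable_def F_def[abs_def])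
  have [measurable]: "e \<in> borel_measurable borel" "F \<in> borel_measurable borel"
    unfolding e_def[abs_def] F_def[abs_def] by measurable
  define K where "K \<xi> y = iexp ((x - y) * \<xi>) * complex_of_real (e \<xi> * F y)" for \<xi> y
  have K_meas [measurable]: "case_prod K \<in> borel_measurable (lborel \<Otimes>\<^sub>M lborel)"
    unfolding K_def[abs_def] by measurable
  have K_norm: "norm (K \<xi> y) = e \<xi> * \<bar>F y\<bar>" for \<xi> y
    by (simp add: K_def norm_mult abs_mult e_def)
  have K_int: "integrable (lborel \<Otimes>\<^sub>M lborel) (case_prod K)"
  proof (rule lborel_pair.Fubini_integrable[OF K_meas])
    show "integrable lborel (\<lambda>\<xi>. LINT y|lborel. norm (case (\<xi>, y) of (\<xi>, y) \<Rightarrow> K \<xi> y))"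
      using e_int F_int by (simp add: K_norm)
    have "integrable lborel (K \<xi>)" for \<xi>
    proof (rule Bochner_Integration.integrable_bound)
      show "integrable lborel (\<lambda>y. e \<xi> * F y)" using F_int by simp
      show "K \<xi> \<in> borel_measurable lborel" unfolding K_def[abs_def] by measurable
    qed (simp add: K_norm abs_mult e_def)
    then show "AE \<xi> in lborel. integrable lborel (\<lambda>y. case (\<xi>, y) of (\<xi>, y) \<Rightarrow> K \<xi> y)" by simp
  qed
  have tf: "truncated_fourier R f \<xi> * (iexp (x * \<xi>) * complex_of_real (e \<xi>)) = c * (LINT y|lborel. K \<xi> y)" for \<xi>
  proof -
    have "truncated_fourier R f \<xi> * (iexp (x * \<xi>) * complex_of_real (e \<xi>))
      = c * ((LINT y|lborel. exp (- \<i> * complex_of_real (y * \<xi>)) * complex_of_real (F y)) * (iexp (x * \<xi>) * complex_of_real (e \<xi>)))"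
      unfolding truncated_fourier_def set_lebesgue_integral_def c_def F_def
      by (simp add: scaleR_conv_of_real ac_simps)
    also have "(LINT y|lborel. exp (- \<i> * complex_of_real (y * \<xi>)) * complex_of_real (F y)) * (iexp (x * \<xi>) * complex_of_real (e \<xi>))
      = (LINT y|lborel. exp (- \<i> * complex_of_real (y * \<xi>)) * complex_of_real (F y) * (iexp (x * \<xi>) * complex_of_real (e \<xi>)))"
      by simp
    also have "\<dots> = (LINT y|lborel. K \<xi> y)"
      by (rule Bochner_Integration.integral_cong) (auto simp: K_def exp_add[symmetric] algebra_simps exp_diff exp_minus field_simps)
    finally show ?thesis .
  qed
  have inner: "(LINT \<xi>|lborel. K \<xi> y) = complex_of_real (F y * (sqrt (2 * pi) / \<epsilon> * exp (- ((x - y) / \<epsilon>)\<^sup>2 / 2)))" for y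
  proof -
    have "(LINT \<xi>|lborel. K \<xi> y) = (LINT \<xi>|lborel. complex_of_real (F y) * (iexp ((x - y) * \<xi>) * complex_of_real (exp (- (\<epsilon> * \<xi>)\<^sup>2 / 2))))"
      by (rule Bochner_Integration.integral_cong) (auto simp: K_def e_def)
    also have "\<dots> = complex_of_real (F y) * (LINT \<xi>|lborel. iexp ((x - y) * \<xi>) * complex_of_real (exp (- (\<epsilon> * \<xi>)\<^sup>2 / 2)))"
      by simp
    finally show ?thesis unfolding gaussian_fourier(2)[OF \<epsilon>] by (simp only: of_real_mult)
  qed
  have "(LINT \<xi>|lborel. truncated_fourier R f \<xi> * (iexp (x * \<xi>) * complex_of_real (e \<xi>)))
     = c * (LINT \<xi>|lborel. (LINT y|lborel. K \<xi> y))" unfolding tf by simp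
  also have "(LINT \<xi>|lborel. (LINT y|lborel. K \<xi> y)) = (LINT y|lborel. (LINT \<xi>|lborel. K \<xi> y))"
    by (rule lborel_pair.Fubini_integral[OF K_int, symmetric])
  also have "\<dots> = complex_of_real (LINT y|lborel. F y * (sqrt (2 * pi) / \<epsilon> * exp (- ((x - y) / \<epsilon>)\<^sup>2 / 2)))"
    unfolding inner by (rule integral_complex_of_real)
  also have "(LINT y|lborel. F y * (sqrt (2 * pi) / \<epsilon> * exp (- ((x - y) / \<epsilon>)\<^sup>2 / 2)))
    = \<epsilon> * (LINT z|lborel. F (x + \<epsilon> * z) * (sqrt (2 * pi) / \<epsilon> * exp (- ((x - (x + \<epsilon> * z)) / \<epsilon>)\<^sup>2 / 2)))"
    using \<epsilon> by (subst lborel_integral_real_affine[of \<epsilon> _ x]) auto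
  also have "\<dots> = (LINT z|lborel. \<epsilon> * (F (x + \<epsilon> * z) * (sqrt (2 * pi) / \<epsilon> * exp (- ((x - (x + \<epsilon> * z)) / \<epsilon>)\<^sup>2 / 2))))"
    by simp
  also have "\<dots> = (LINT z|lborel. 2 * pi * (F (x + \<epsilon> * z) * std_normal_density z))"
  proof (rule Bochner_Integration.integral_cong[OF refl])
    fix z
    \<comment> \<open>This form of the constant exposes \<open>1 / sqrt (2 * pi)\<close>, the
      prefactor of \<open>std_normal_density\<close>.\<close>
    have p: "sqrt (2 * pi) = 2 * pi / sqrt (2 * pi)" using real_div_sqrt[of "2 * pi"] by simp
    show "\<epsilon> * (F (x + \<epsilon> * z) * (sqrt (2 * pi) / \<epsilon> * exp (- ((x - (x + \<epsilon> * z)) / \<epsilon>)\<^sup>2 / 2)))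
       = 2 * pi * (F (x + \<epsilon> * z) * std_normal_density z)"
      unfolding std_normal_density_def by (subst p) (use \<epsilon> in simp)
  qed
  also have "\<dots> = 2 * pi * (LINT z|lborel. F (x + \<epsilon> * z) * std_normal_density z)" by simp
  finally have T: "(LINT \<xi>|lborel. truncated_fourier R f \<xi> * (iexp (x * \<xi>) * complex_of_real (e \<xi>)))
     = c * complex_of_real (2 * pi * (LINT z|lborel. F (x + \<epsilon> * z) * std_normal_density z))" .
  \<comment> \<open>The normalising factors of the transform and of its inverse cancel the 2 pi
    produced by the Gaussian.\<close>
  have cc: "c * c * complex_of_real (2 * pi) = 1" by (simp add: c_def flip: of_real_mult)
  have "c * (LINT \<xi>|lborel. truncated_fourier R f \<xi> * (iexp (x * \<xi>) * complex_of_real (e \<xi>)))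
     = (c * c * complex_of_real (2 * pi)) * complex_of_real (LINT z|lborel. F (x + \<epsilon> * z) * std_normal_density z)"
    by (subst T) (simp only: of_real_mult mult.assoc)
  then show ?thesis unfolding cc by (simp add: c_def e_def F_def)
qed

text \<open>The truncation is removed: on the function side by dominated convergence, on the
  transform side because L2 convergence may be tested against the square integrable damping
  factor.\<close>

lemma fourier_gaussian:
  assumes fg: "has_fourier_L2 f g" and \<epsilon>: "0 < \<epsilon>"
  shows "complex_of_real (1 / sqrt (2 * pi)) *
      (LINT \<xi>|lborel. g \<xi> * (iexp (x * \<xi>) * complex_of_real (exp (- (\<epsilon> * \<xi>)\<^sup>2 / 2))))
    = complex_of_real (LINT z|lborel. f (x + \<epsilon> * z) * std_normal_density z)"
    and "integrable lborel (\<lambda>z. f (x + \<epsilon> * z) * std_normal_density z)"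
proof -
  have f: "square_integrable f" and g: "square_integrable g" using fg by (auto simp: has_fourier_L2_def)
  have [measurable]: "f \<in> borel_measurable borel" "g \<in> borel_measurable borel"
    using f g by (auto simp: square_integrable_def)
  define c where "c = complex_of_real (1 / sqrt (2 * pi))"
  define e where "e \<xi> = exp (- (\<epsilon> * \<xi>)\<^sup>2 / 2)" for \<xi>
  define w where "w \<xi> = iexp (x * \<xi>) * complex_of_real (e \<xi>)" for \<xi>
  have [measurable]: "w \<in> borel_measurable borel" "e \<in> borel_measurable borel" unfolding w_def[abs_def] e_def[abs_def] by measurable
  have e_int: "integrable lborel e" using gaussian_fourier(1)[OF \<epsilon>] by (simp add: e_def[abs_def])
  have e01: "0 \<le> e \<xi>" "e \<xi> \<le> 1" for \<xi> by (auto simp: e_def)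
  have w_norm: "cmod (w \<xi>) = e \<xi>" for \<xi> using e01 by (simp add: w_def norm_mult)
  have f2: "integrable lborel (\<lambda>z. (f (x + \<epsilon> * z))\<^sup>2)"
    using f \<epsilon> lborel_integrable_real_affine_iff[of \<epsilon> "\<lambda>y. (f y)\<^sup>2" x] by (simp add: square_integrable_def)
  have dom: "\<bar>f (x + \<epsilon> * z)\<bar> * std_normal_density z \<le> std_normal_density z + (f (x + \<epsilon> * z))\<^sup>2" for z
  proof -
    have 1: "\<bar>f (x + \<epsilon> * z)\<bar> * std_normal_density z \<le> (1 + (f (x + \<epsilon> * z))\<^sup>2) * std_normal_density z"
      by (rule mult_right_mono[OF abs_le_1_plus_square]) simp
    have 2: "(f (x + \<epsilon> * z))\<^sup>2 * std_normal_density z \<le> (f (x + \<epsilon> * z))\<^sup>2 * 1"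
      by (rule mult_left_mono[OF std_normal_density_le_1]) simp
    show ?thesis using 1 2 by (simp add: distrib_right)
  qed
  have dom_int: "integrable lborel (\<lambda>z. std_normal_density z + (f (x + \<epsilon> * z))\<^sup>2)"
    using f2 by (intro Bochner_Integration.integrable_add) auto
  show "integrable lborel (\<lambda>z. f (x + \<epsilon> * z) * std_normal_density z)"
    by (rule Bochner_Integration.integrable_bound[OF dom_int]) (use dom in \<open>auto simp: abs_mult\<close>)
  have R: "(\<lambda>n. LINT z|lborel. indicator {-real n..real n} (x + \<epsilon> * z) * f (x + \<epsilon> * z) * std_normal_density z)
     \<longlonglongrightarrow> (LINT z|lborel. f (x + \<epsilon> * z) * std_normal_density z)"
  proof (rule integral_dominated_convergence[OF _ _ dom_int])
    show "AE z in lborel. (\<lambda>n. indicator {-real n..real n} (x + \<epsilon> * z) * f (x + \<epsilon> * z) * std_normal_density z)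
       \<longlonglongrightarrow> f (x + \<epsilon> * z) * std_normal_density z"
    proof (rule AE_I2, rule tendsto_eventually)
      fix z
      obtain n where "\<bar>x + \<epsilon> * z\<bar> \<le> real n" using real_arch_simple by blast
      then show "\<forall>\<^sub>F n in sequentially. indicator {-real n..real n} (x + \<epsilon> * z) * f (x + \<epsilon> * z) * std_normal_density z
          = f (x + \<epsilon> * z) * std_normal_density z"
        by (intro eventually_sequentiallyI[of n]) (auto simp: indicator_def)
    qed
    show "AE z in lborel. norm (indicator {-real n..real n} (x + \<epsilon> * z) * f (x + \<epsilon> * z) * std_normal_density z)
      \<le> std_normal_density z + (f (x + \<epsilon> * z))\<^sup>2" for n
      using dom by (intro AE_I2) (auto simp: abs_mult indicator_def)
  qed measurable
  have gw_int: "integrable lborel (\<lambda>\<xi>. g \<xi> * w \<xi>)"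
  proof (rule Bochner_Integration.integrable_bound)
    show "integrable lborel (\<lambda>\<xi>. e \<xi> + (cmod (g \<xi>))\<^sup>2)"
      using e_int g by (auto simp: square_integrable_def)
    have "cmod (g \<xi>) * e \<xi> \<le> e \<xi> + (cmod (g \<xi>))\<^sup>2" for \<xi>
    proof -
      have 1: "cmod (g \<xi>) * e \<xi> \<le> (1 + (cmod (g \<xi>))\<^sup>2) * e \<xi>"
        using abs_le_1_plus_square[of "cmod (g \<xi>)"] e01 by (intro mult_right_mono) auto
      have 2: "(cmod (g \<xi>))\<^sup>2 * e \<xi> \<le> (cmod (g \<xi>))\<^sup>2 * 1" using e01 by (intro mult_left_mono) auto
      show ?thesis using 1 2 by (simp add: distrib_right)
    qed
    then show "AE \<xi> in lborel. norm (g \<xi> * w \<xi>) \<le> norm (e \<xi> + (cmod (g \<xi>))\<^sup>2)"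
      using e01 by (intro AE_I2) (auto simp: norm_mult w_norm intro: order_trans[OF _ abs_ge_self])
  qed measurable
  have tf_bound: "cmod (truncated_fourier R f \<xi>) \<le> (LINT y:{-R..R}|lborel. \<bar>f y\<bar>)" for R \<xi>
  proof -
    have "cmod (LINT y:{-R..R}|lborel. exp (- \<i> * complex_of_real (y * \<xi>)) * complex_of_real (f y))
       \<le> (LINT y:{-R..R}|lborel. cmod (exp (- \<i> * complex_of_real (y * \<xi>)) * complex_of_real (f y)))"
      unfolding set_lebesgue_integral_def
      by (rule order_trans[OF integral_norm_bound]) simp
    also have "\<dots> = (LINT y:{-R..R}|lborel. \<bar>f y\<bar>)" by (simp add: norm_mult)
    finally have 1: "cmod (LINT y:{-R..R}|lborel. exp (- \<i> * complex_of_real (y * \<xi>)) * complex_of_real (f y)) \<le> (LINT y:{-R..R}|lborel. \<bar>f y\<bar>)" .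
    have "1 / sqrt (2 * pi) \<le> 1" using pi_ge_two by (simp add: field_simps real_le_rsqrt)
    then have "1 / sqrt (2 * pi) * cmod (LINT y:{-R..R}|lborel. exp (- \<i> * complex_of_real (y * \<xi>)) * complex_of_real (f y))
      \<le> 1 * (LINT y:{-R..R}|lborel. \<bar>f y\<bar>)" using 1 by (intro mult_mono) auto
    then show ?thesis unfolding truncated_fourier_def norm_mult by (simp add: norm_divide)
  qed
  have tw_int: "integrable lborel (\<lambda>\<xi>. truncated_fourier R f \<xi> * w \<xi>)" for R
  proof (rule Bochner_Integration.integrable_bound)
    show "integrable lborel (\<lambda>\<xi>. (LINT y:{-R..R}|lborel. \<bar>f y\<bar>) * e \<xi>)" using e_int by simp
    show "AE \<xi> in lborel. norm (truncated_fourier R f \<xi> * w \<xi>) \<le> norm ((LINT y:{-R..R}|lborel. \<bar>f y\<bar>) * e \<xi>)"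
      using tf_bound[of R] e01
      by (intro AE_I2) (auto simp: norm_mult w_norm abs_mult intro!: mult_right_mono intro: order_trans[OF _ abs_ge_self])
  qed measurable
  define D where "D n = (\<integral>\<^sup>+\<xi>. ennreal ((cmod (truncated_fourier (real n) f \<xi> - g \<xi>))\<^sup>2) \<partial>lborel)" for n :: nat
  have D: "D \<longlonglongrightarrow> 0"
    using fg filterlim_compose[OF _ filterlim_real_sequentially] unfolding D_def has_fourier_L2_def by blast
  define W where "W = (\<integral>\<^sup>+\<xi>. ennreal ((e \<xi>)\<^sup>2) \<partial>lborel)"
  have "W \<le> (\<integral>\<^sup>+\<xi>. ennreal (e \<xi>) \<partial>lborel)"
    unfolding W_def using e01 by (intro nn_integral_mono ennreal_leI) (auto simp: power2_eq_square mult_left_le)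
  also have "\<dots> < \<infinity>" using e_int e01 by (simp add: integrable_iff_bounded)
  finally have W: "W < \<infinity>" .
  \<comment> \<open>Cauchy-Schwarz: D n is the squared L2 distance of the transforms and W the
    squared L2 norm of the damping factor.\<close>
  have bnd: "ennreal ((cmod ((LINT \<xi>|lborel. truncated_fourier (real n) f \<xi> * w \<xi>) - (LINT \<xi>|lborel. g \<xi> * w \<xi>)))\<^sup>2) \<le> D n * W" for n
  proof -
    let ?d = "\<lambda>\<xi>. truncated_fourier (real n) f \<xi> - g \<xi>"
    have "ennreal (cmod (LINT \<xi>|lborel. ?d \<xi> * w \<xi>)) \<le> (\<integral>\<^sup>+\<xi>. ennreal (cmod (?d \<xi> * w \<xi>)) \<partial>lborel)"
      using tw_int[of n] gw_int by (intro integral_norm_bound_ennreal) (simp add: left_diff_distrib)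
    also have "\<dots> = (\<integral>\<^sup>+\<xi>. ennreal (cmod (?d \<xi>)) * ennreal (e \<xi>) \<partial>lborel)"
      by (simp add: norm_mult w_norm ennreal_mult' e01)
    finally have "(ennreal (cmod (LINT \<xi>|lborel. ?d \<xi> * w \<xi>)))\<^sup>2 \<le> (\<integral>\<^sup>+\<xi>. ennreal (cmod (?d \<xi>)) * ennreal (e \<xi>) \<partial>lborel)\<^sup>2"
      by (rule power_mono) simp
    also have "\<dots> \<le> (\<integral>\<^sup>+\<xi>. (ennreal (cmod (?d \<xi>)))\<^sup>2 \<partial>lborel) * (\<integral>\<^sup>+\<xi>. (ennreal (e \<xi>))\<^sup>2 \<partial>lborel)"
      by (rule Cauchy_Schwarz_nn_integral) measurable
    also have "\<dots> = D n * W" by (simp add: D_def W_def ennreal_power e01)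
    finally show ?thesis using tw_int[of n] gw_int by (simp add: left_diff_distrib ennreal_power)
  qed
  have DW: "(\<lambda>n. D n * W) \<longlonglongrightarrow> ennreal 0"
    using ennreal_tendsto_cmult[OF W[unfolded infinity_ennreal_def] D] by (simp add: mult.commute)
  have "(\<lambda>n. ennreal ((cmod ((LINT \<xi>|lborel. truncated_fourier (real n) f \<xi> * w \<xi>) - (LINT \<xi>|lborel. g \<xi> * w \<xi>)))\<^sup>2)) \<longlonglongrightarrow> ennreal 0"
    by (rule tendsto_sandwich[OF _ _ tendsto_const DW]) (use bnd in auto)
  then have "(\<lambda>n. (cmod ((LINT \<xi>|lborel. truncated_fourier (real n) f \<xi> * w \<xi>) - (LINT \<xi>|lborel. g \<xi> * w \<xi>)))\<^sup>2) \<longlonglongrightarrow> 0"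
    by (subst (asm) tendsto_ennreal_iff) auto
  then have "(\<lambda>n. sqrt ((cmod ((LINT \<xi>|lborel. truncated_fourier (real n) f \<xi> * w \<xi>) - (LINT \<xi>|lborel. g \<xi> * w \<xi>)))\<^sup>2)) \<longlonglongrightarrow> sqrt 0"
    by (rule tendsto_real_sqrt)
  then have "(\<lambda>n. LINT \<xi>|lborel. truncated_fourier (real n) f \<xi> * w \<xi>) \<longlonglongrightarrow> (LINT \<xi>|lborel. g \<xi> * w \<xi>)"
    by (simp add: tendsto_norm_zero_iff LIM_zero_iff)
  then have "(\<lambda>n. c * (LINT \<xi>|lborel. truncated_fourier (real n) f \<xi> * w \<xi>)) \<longlonglongrightarrow> c * (LINT \<xi>|lborel. g \<xi> * w \<xi>)"
    by (intro tendsto_intros)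
  moreover have "(\<lambda>n. c * (LINT \<xi>|lborel. truncated_fourier (real n) f \<xi> * w \<xi>))
      \<longlonglongrightarrow> complex_of_real (LINT z|lborel. f (x + \<epsilon> * z) * std_normal_density z)"
    unfolding c_def w_def e_def truncated_fourier_gaussian[OF f \<epsilon>] by (rule tendsto_of_real[OF R])
  ultimately show "complex_of_real (1 / sqrt (2 * pi)) *
      (LINT \<xi>|lborel. g \<xi> * (iexp (x * \<xi>) * complex_of_real (exp (- (\<epsilon> * \<xi>)\<^sup>2 / 2))))
    = complex_of_real (LINT z|lborel. f (x + \<epsilon> * z) * std_normal_density z)"
    using LIMSEQ_unique unfolding c_def w_def e_def by blast
qed

text \<open>Gaussian smoothing of \<open>f\<close> corresponds to damping \<open>g\<close> by a Gaussian; the damping is removed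
  after integration over an interval, where \<open>f\<close> need not be continuous.\<close>

lemma fourier_inversion:
  assumes fg: "has_fourier_L2 f g" and gi: "integrable lborel g"
  shows "AE x in lborel. f x = Re (complex_of_real (1 / sqrt (2 * pi)) * (LINT \<xi>|lborel. g \<xi> * iexp (x * \<xi>)))"
proof -
  have f: "square_integrable f" using fg by (simp add: has_fourier_L2_def)
  have [measurable]: "f \<in> borel_measurable borel" using f by (simp add: square_integrable_def)
  have [measurable]: "g \<in> borel_measurable borel" using borel_measurable_integrable[OF gi] by simp
  define c where "c = complex_of_real (1 / sqrt (2 * pi))"
  define h where "h x = Re (c * (LINT \<xi>|lborel. g \<xi> * iexp (x * \<xi>)))" for x
  define \<epsilon> where "\<epsilon> n = 1 / real (Suc n)" for n
  have \<epsilon>: "0 < \<epsilon> n" "\<epsilon> n \<le> 1" for n by (auto simp: \<epsilon>_def)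
  have \<epsilon>0: "\<epsilon> \<longlonglongrightarrow> 0" unfolding \<epsilon>_def by (rule LIMSEQ_Suc[OF lim_1_over_n])
  define w where "w n x \<xi> = iexp (x * \<xi>) * complex_of_real (exp (- (\<epsilon> n * \<xi>)\<^sup>2 / 2))" for n x \<xi>
  have w1: "cmod (w n x \<xi>) \<le> 1" for n x \<xi> by (simp add: w_def norm_mult)
  \<comment> \<open>H is Gaussian damping in frequency and, by the preceding lemma, Gaussian
    averaging of f in space; the first form yields the pointwise limit h, the second the limit of
    the integrals over an interval.\<close>
  define H where "H n x = Re (c * (LINT \<xi>|lborel. g \<xi> * w n x \<xi>))" for n x
  have H_eq: "H n x = (LINT z|lborel. f (x + \<epsilon> n * z) * std_normal_density z)" for n x
    unfolding H_def w_def c_def fourier_gaussian(1)[OF fg \<epsilon>(1)] by simp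
  have [measurable]: "H n \<in> borel_measurable borel" for n
    unfolding H_def[abs_def] w_def by measurable
  have [measurable]: "h \<in> borel_measurable borel"
    unfolding h_def[abs_def] by measurable
  define B where "B = cmod c * (LINT \<xi>|lborel. cmod (g \<xi>))"
  have "\<bar>Re (c * (LINT \<xi>|lborel. g \<xi> * v \<xi>))\<bar> \<le> B"
    if [measurable]: "v \<in> borel_measurable borel" and v: "\<And>\<xi>. cmod (v \<xi>) \<le> 1" for v
  proof -
    have "cmod (LINT \<xi>|lborel. g \<xi> * v \<xi>) \<le> (LINT \<xi>|lborel. cmod (g \<xi>))"
    proof (rule order_trans[OF integral_norm_bound integral_mono])
      show i: "integrable lborel (\<lambda>\<xi>. cmod (g \<xi>))" using gi by simp
      show "integrable lborel (\<lambda>\<xi>. cmod (g \<xi> * v \<xi>))"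
        by (rule Bochner_Integration.integrable_bound[OF i]) (use v in \<open>auto simp: norm_mult mult_left_le\<close>)
    qed (use v in \<open>auto simp: norm_mult mult_left_le\<close>)
    then have "cmod (c * (LINT \<xi>|lborel. g \<xi> * v \<xi>)) \<le> B" by (simp add: norm_mult B_def mult_left_mono)
    then show ?thesis using abs_Re_le_cmod order_trans by blast
  qed note RB = this
  have HB: "\<bar>H n x\<bar> \<le> B" for n x unfolding H_def by (rule RB) (use w1 in \<open>auto simp: w_def\<close>)
  have hB: "\<bar>h x\<bar> \<le> B" for x unfolding h_def by (rule RB) auto
  have Hlim: "(\<lambda>n. H n x) \<longlonglongrightarrow> h x" for x
  proof -
    have "(\<lambda>n. LINT \<xi>|lborel. g \<xi> * w n x \<xi>) \<longlonglongrightarrow> (LINT \<xi>|lborel. g \<xi> * iexp (x * \<xi>))"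
    proof (rule integral_dominated_convergence[where w="\<lambda>\<xi>. cmod (g \<xi>)"])
      show "(\<lambda>\<xi>. g \<xi> * w n x \<xi>) \<in> borel_measurable lborel" for n unfolding w_def by measurable
      show "AE \<xi> in lborel. norm (g \<xi> * w n x \<xi>) \<le> cmod (g \<xi>)" for n
        using w1 by (auto simp: norm_mult mult_left_le)
      have "(\<lambda>n. w n x \<xi>) \<longlonglongrightarrow> iexp (x * \<xi>) * complex_of_real (exp (- (0 * \<xi>)\<^sup>2 / 2))" for \<xi>
        unfolding w_def by (intro tendsto_intros \<epsilon>0) simp
      then have "(\<lambda>n. w n x \<xi>) \<longlonglongrightarrow> iexp (x * \<xi>)" for \<xi> by simp
      then show "AE \<xi> in lborel. (\<lambda>n. g \<xi> * w n x \<xi>) \<longlonglongrightarrow> g \<xi> * iexp (x * \<xi>)"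
        by (intro AE_I2 tendsto_mult tendsto_const)
    qed (use gi in auto)
    then show ?thesis unfolding H_def h_def by (intro tendsto_intros)
  qed
  have ind: "integrable lborel (\<lambda>x. indicator {a..b} x * B')" for a b B' :: real
    using integrable_real_indicator[of "{a..b}" lborel] by (simp add: emeasure_lborel_Icc_eq)
  have hi: "set_integrable lborel {a..b} h" for a b
    unfolding set_integrable_def
    by (rule Bochner_Integration.integrable_bound[OF ind[of a b B]])
      (use hB in \<open>auto simp: indicator_def intro: order_trans[OF _ abs_ge_self]\<close>)
  have fi: "set_integrable lborel {a..b} f" for a b by (rule square_integrable_set_integrable[OF f])
  have eq: "(LINT x:{a..b}|lborel. f x) = (LINT x:{a..b}|lborel. h x)" if ab: "a < b" for a b
  proof -
    have 1: "(\<lambda>n. LINT x:{a..b}|lborel. H n x) \<longlonglongrightarrow> (LINT x:{a..b}|lborel. h x)"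
      unfolding set_lebesgue_integral_def
    proof (rule integral_dominated_convergence[OF _ _ ind[of a b B]])
      show "AE x in lborel. norm (indicator {a..b} x *\<^sub>R H n x) \<le> indicator {a..b} x * B" for n
        using HB by (auto simp: indicator_def)
      show "AE x in lborel. (\<lambda>n. indicator {a..b} x *\<^sub>R H n x) \<longlonglongrightarrow> indicator {a..b} x *\<^sub>R h x"
        by (intro AE_I2 tendsto_scaleR tendsto_const Hlim)
    qed measurable
    \<comment> \<open>The integral of a translate of f over the interval; averaging it against the
      Gaussian gives the integral of H.\<close>
    define L where "L \<delta> = (LINT x|lborel. indicator {a..b} x * f (x + \<delta>))" for \<delta>
    \<comment> \<open>One bound for all translates, since the squared norm of f is translation
      invariant.\<close>
    define N where "N = (b - a) + (LINT x|lborel. (f x)\<^sup>2)"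
    have shift2: "integrable lborel (\<lambda>x. (f (x + \<delta>))\<^sup>2)" "(LINT x|lborel. (f (x + \<delta>))\<^sup>2) = (LINT x|lborel. (f x)\<^sup>2)" for \<delta>
      using f lborel_integrable_real_affine_iff[of 1 "\<lambda>y. (f y)\<^sup>2" \<delta>] lborel_integral_real_affine[of 1 "\<lambda>y. (f y)\<^sup>2" \<delta>]
      by (simp_all add: square_integrable_def add.commute)
    have dom: "integrable lborel (\<lambda>x. indicator {a..b} x + (f (x + \<delta>))\<^sup>2)"
      "(LINT x|lborel. indicator {a..b} x + (f (x + \<delta>))\<^sup>2) = N" for \<delta>
      using ind[of a b 1] shift2[of \<delta>] ab by (simp_all add: N_def)
    have le: "\<bar>indicator {a..b} x * f (x + \<delta>)\<bar> \<le> indicator {a..b} x + (f (x + \<delta>))\<^sup>2" for x \<delta>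
      using abs_le_1_plus_square[of "f (x + \<delta>)"] by (simp add: indicator_def)
    have sh_int: "integrable lborel (\<lambda>x. indicator {a..b} x * f (x + \<delta>))" for \<delta>
      by (rule Bochner_Integration.integrable_bound[OF dom(1)[of \<delta>]])
        (use le in \<open>auto intro: order_trans[OF _ abs_ge_self]\<close>)
    have abs_bound: "(LINT x|lborel. \<bar>indicator {a..b} x * f (x + \<delta>)\<bar>) \<le> N" for \<delta>
      unfolding dom(2)[of \<delta>, symmetric] by (rule integral_mono) (use sh_int dom le in auto)
    have LB: "\<bar>L \<delta>\<bar> \<le> N" for \<delta>
      unfolding L_def using integral_norm_bound[of lborel "\<lambda>x. indicator {a..b} x * f (x + \<delta>)"] abs_bound[of \<delta>]
      by (metis (no_types, lifting) order_trans real_norm_def Bochner_Integration.integral_cong)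
    have [measurable]: "L \<in> borel_measurable borel" unfolding L_def[abs_def] by measurable
    have Llim: "(\<lambda>n. L (\<epsilon> n * z)) \<longlonglongrightarrow> L 0" for z
    proof -
      \<comment> \<open>Translating the interval instead of f keeps f fixed, so that the limit is a
        matter of dominated convergence; only the two end points have to be excluded.\<close>
      have L': "L \<delta> = (LINT y|lborel. indicator {a + \<delta>..b + \<delta>} y * f y)" for \<delta>
      proof -
        have "(LINT y|lborel. indicator {a + \<delta>..b + \<delta>} y * f y) = (LINT x|lborel. indicator {a + \<delta>..b + \<delta>} (\<delta> + x) * f (\<delta> + x))"
          by (subst lborel_integral_real_affine[of 1 _ \<delta>]) auto
        also have "\<dots> = L \<delta>"
          unfolding L_def by (rule Bochner_Integration.integral_cong) (auto simp: indicator_def add.commute)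
        finally show ?thesis ..
      qed
      have "(\<lambda>n. LINT y|lborel. indicator {a + \<epsilon> n * z..b + \<epsilon> n * z} y * f y) \<longlonglongrightarrow> (LINT y|lborel. indicator {a + 0..b + 0} y * f y)"
      proof (rule integral_dominated_convergence[where w="\<lambda>y. \<bar>indicator {a - \<bar>z\<bar>..b + \<bar>z\<bar>} y * f y\<bar>"])
        show "integrable lborel (\<lambda>y. \<bar>indicator {a - \<bar>z\<bar>..b + \<bar>z\<bar>} y * f y\<bar>)"
          using fi[of "a - \<bar>z\<bar>" "b + \<bar>z\<bar>"] by (simp add: set_integrable_def)
        have za: "\<bar>\<epsilon> n * z\<bar> \<le> \<bar>z\<bar>" for n
          using mult_right_mono[OF \<epsilon>(2)[of n] abs_ge_zero[of z]] \<epsilon>(1)[of n] by (simp add: abs_mult)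
        have zb: "- \<bar>z\<bar> \<le> \<epsilon> n * z \<and> \<epsilon> n * z \<le> \<bar>z\<bar>" for n using za[of n] by linarith
        have s: "y \<in> {a + \<epsilon> n * z..b + \<epsilon> n * z} \<Longrightarrow> y \<in> {a - \<bar>z\<bar>..b + \<bar>z\<bar>}" for n y
          using zb[of n] unfolding atLeastAtMost_iff by linarith
        show "AE y in lborel. norm (indicator {a + \<epsilon> n * z..b + \<epsilon> n * z} y * f y) \<le> \<bar>indicator {a - \<bar>z\<bar>..b + \<bar>z\<bar>} y * f y\<bar>" for n
          using s[of _ n] by (intro AE_I2) (simp add: indicator_def)
        show "AE y in lborel. (\<lambda>n. indicator {a + \<epsilon> n * z..b + \<epsilon> n * z} y * f y) \<longlonglongrightarrow> indicator {a + 0..b + 0} y * f y"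
          using AE_lborel_singleton[of a] AE_lborel_singleton[of b]
        proof eventually_elim
          case (elim y)
          have "(\<lambda>n. a + \<epsilon> n * z) \<longlonglongrightarrow> a + 0 * z" "(\<lambda>n. b + \<epsilon> n * z) \<longlonglongrightarrow> b + 0 * z" by (intro tendsto_intros \<epsilon>0)+
          then have la: "(\<lambda>n. a + \<epsilon> n * z) \<longlonglongrightarrow> a" and lb: "(\<lambda>n. b + \<epsilon> n * z) \<longlonglongrightarrow> b" by auto
          have "\<forall>\<^sub>F n in sequentially. (a + \<epsilon> n * z \<le> y \<longleftrightarrow> a \<le> y)"
            using order_tendstoD(1)[OF la, of y] order_tendstoD(2)[OF la, of y] elim
            by (cases "a < y") (auto elim!: eventually_mono)
          moreover have "\<forall>\<^sub>F n in sequentially. (y \<le> b + \<epsilon> n * z \<longleftrightarrow> y \<le> b)"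
            using order_tendstoD(1)[OF lb, of y] order_tendstoD(2)[OF lb, of y] elim
            by (cases "b < y") (auto elim!: eventually_mono)
          ultimately have "\<forall>\<^sub>F n in sequentially. indicator {a + \<epsilon> n * z..b + \<epsilon> n * z} y * f y = indicator {a + 0..b + 0} y * f y"
            by eventually_elim (simp add: indicator_def)
          then show ?case by (rule tendsto_eventually)
        qed
      qed measurable
      then show ?thesis unfolding L' by simp
    qed
    have swap: "(LINT x:{a..b}|lborel. H n x) = (LINT z|lborel. L (\<epsilon> n * z) * std_normal_density z)" for n
    proof -
      define K where "K z x = (indicator {a..b} x * f (x + \<epsilon> n * z)) * std_normal_density z" for z x
      have K_meas [measurable]: "case_prod K \<in> borel_measurable (lborel \<Otimes>\<^sub>M lborel)" unfolding K_def[abs_def] by measurable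
      have "integrable (lborel \<Otimes>\<^sub>M lborel) (case_prod K)"
      proof (rule lborel_pair.Fubini_integrable[OF K_meas])
        show "AE z in lborel. integrable lborel (\<lambda>x. case (z, x) of (z, x) \<Rightarrow> K z x)"
          using sh_int by (simp add: K_def)
        show "integrable lborel (\<lambda>z. LINT x|lborel. norm (case (z, x) of (z, x) \<Rightarrow> K z x))"
        proof (rule Bochner_Integration.integrable_bound[where f="\<lambda>z. N * std_normal_density z"])
          show "AE z in lborel. norm (LINT x|lborel. norm (case (z, x) of (z, x) \<Rightarrow> K z x)) \<le> norm (N * std_normal_density z)"
          proof (rule AE_I2)
            fix z
            have "(LINT x|lborel. norm (case (z, x) of (z, x) \<Rightarrow> K z x))
              = (LINT x|lborel. \<bar>indicator {a..b} x * f (x + \<epsilon> n * z)\<bar>) * std_normal_density z"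
              by (simp add: K_def abs_mult)
            also have "\<dots> \<le> N * std_normal_density z" by (rule mult_right_mono[OF abs_bound]) simp
            finally show "norm (LINT x|lborel. norm (case (z, x) of (z, x) \<Rightarrow> K z x)) \<le> norm (N * std_normal_density z)"
              by (simp add: Bochner_Integration.integral_nonneg)
          qed
        qed auto
      qed
      then have "(LINT x|lborel. LINT z|lborel. K z x) = (LINT z|lborel. LINT x|lborel. K z x)"
        by (rule lborel_pair.Fubini_integral)
      moreover have "(LINT z|lborel. K z x) = indicator {a..b} x *\<^sub>R H n x" for x
        by (simp add: H_eq K_def mult.assoc)
      moreover have "(LINT x|lborel. K z x) = L (\<epsilon> n * z) * std_normal_density z" for z
        unfolding K_def L_def by (rule integral_mult_left_zero)
      ultimately show ?thesis by (simp add: set_lebesgue_integral_def)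
    qed
    have "(\<lambda>n. LINT z|lborel. L (\<epsilon> n * z) * std_normal_density z) \<longlonglongrightarrow> (LINT z|lborel. L 0 * std_normal_density z)"
    proof (rule integral_dominated_convergence[where w="\<lambda>z. N * std_normal_density z"])
      show "AE z in lborel. (\<lambda>n. L (\<epsilon> n * z) * std_normal_density z) \<longlonglongrightarrow> L 0 * std_normal_density z"
        by (intro AE_I2 tendsto_mult Llim tendsto_const)
      show "AE z in lborel. norm (L (\<epsilon> n * z) * std_normal_density z) \<le> N * std_normal_density z" for n
        using LB by (auto simp: abs_mult intro!: mult_right_mono)
    qed auto
    moreover have "(LINT z|lborel. L 0 * std_normal_density z) = L 0" by simp
    ultimately have 2: "(\<lambda>n. LINT x:{a..b}|lborel. H n x) \<longlonglongrightarrow> L 0" unfolding swap by simp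
    show ?thesis using LIMSEQ_unique[OF 2 1] by (simp add: L_def set_lebesgue_integral_def)
  qed
  have "AE x in lborel. f x - h x = 0"
  proof (rule AE_zero_if_interval_integrals_zero)
    show "set_integrable lborel {a..b} (\<lambda>x. f x - h x)" for a b
      by (rule set_integral_diff(1)[OF fi hi])
    show "(LINT x:{a..b}|lborel. f x - h x) = 0" if "a < b" for a b
      using set_integral_diff(2)[OF fi hi] eq[OF that] by simp
  qed
  then show ?thesis unfolding h_def c_def by eventually_elim simp
qed

section \<open>Differentiating the inverse transform; Sobolev embedding\<close>

text \<open>Used with p = r - k, the weight left over after k derivatives in the embedding, and with
  p = 1 to dominate the exponential kernel.\<close>

lemma integrable_one_plus_square_powr:
  fixes p :: real
  assumes "1 / 2 < p"
  shows "integrable lborel (\<lambda>\<xi>::real. (1 + \<xi>\<^sup>2) powr (- p))"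
proof -
  have le: "(1 + \<xi>\<^sup>2) powr (- p) \<le> \<xi> powr (- 2 * p)" if "\<xi> \<ge> 1" for \<xi> :: real
  proof -
    have "(1 + \<xi>\<^sup>2) powr (- p) \<le> (\<xi>\<^sup>2) powr (- p)"
      using that assms by (intro powr_mono2') auto
    also have "\<dots> = \<xi> powr (- 2 * p)"
      using that by (simp add: powr_powr flip: powr_numeral)
    finally show ?thesis .
  qed
  have "(\<lambda>x::real. x powr (- 2 * p)) integrable_on {1..}"
    using has_integral_powr_to_inf[of "- 2 * p" 1] assms by (auto simp: has_integral_integrable_integral)
  then have "(\<lambda>x::real. x powr (- 2 * p)) absolutely_integrable_on {1..}"
    by (rule nonnegative_absolutely_integrable_1) auto
  then have "integrable lebesgue (\<lambda>x::real. indicator {1..} x *\<^sub>R x powr (- 2 * p))"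
    by (simp add: set_integrable_def)
  then have i1: "integrable lborel (\<lambda>x::real. indicator {1..} x *\<^sub>R x powr (- 2 * p))"
    by (subst (asm) integrable_completion) auto
  define k where "k x = indicator {1..} x *\<^sub>R x powr (- 2 * p)" for x :: real
  have k: "integrable lborel k" using i1 by (simp add: k_def[abs_def])
  then have k': "integrable lborel (\<lambda>x. k (- x))"
    using lborel_integrable_real_affine_iff[of "-1" k 0] by simp
  have ind: "integrable lborel (indicat_real {-1..1::real})"
    by (rule integrable_real_indicator) (auto simp: emeasure_lborel_Icc_eq)
  show ?thesis
  proof (rule Bochner_Integration.integrable_bound)
    show "integrable lborel (\<lambda>x. k x + k (- x) + indicat_real {-1..1} x)"
      by (intro Bochner_Integration.integrable_add k k' ind)
    show "AE x in lborel. norm ((1 + x\<^sup>2) powr (- p)) \<le> norm (k x + k (- x) + indicat_real {-1..1} x)"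
    proof (rule AE_I2)
      fix x :: real
      have k0: "0 \<le> k y" for y by (auto simp: k_def indicator_def)
      have i0: "0 \<le> indicat_real {-1..1::real} x" by simp
      consider "x \<ge> 1" | "- x \<ge> 1" | "x \<in> {-1..1}" by force
      then have "(1 + x\<^sup>2) powr (- p) \<le> k x + k (- x) + indicat_real {-1..1} x"
      proof cases
        case 1
        then have "k x = x powr (- 2 * p)" by (simp add: k_def)
        then show ?thesis using le[OF 1] k0[of "-x"] i0 by linarith
      next
        case 2
        then have "k (- x) = (- x) powr (- 2 * p)" by (simp add: k_def)
        then show ?thesis using le[OF 2] k0[of x] i0 by (simp only: power2_minus)
      next
        case 3
        have "(1 + x\<^sup>2) powr (- p) \<le> 1 powr (- p)" using assms by (intro powr_mono2') auto
        then show ?thesis using 3 k0[of x] k0[of "-x"] by simp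
      qed
      then show "norm ((1 + x\<^sup>2) powr (- p)) \<le> norm (k x + k (- x) + indicat_real {-1..1} x)"
        using k0[of x] k0[of "-x"] by simp
    qed
  qed measurable
qed

text \<open>In quotient form the derivative of a parameter integral can be tested along sequences,
  where dominated convergence applies.\<close>

lemma has_vector_derivative_iff_quotient:
  fixes f :: "real \<Rightarrow> 'a::real_normed_vector"
  shows "(f has_vector_derivative D) (at x) \<longleftrightarrow> ((\<lambda>y. (f y - f x) /\<^sub>R (y - x)) \<longlongrightarrow> D) (at x)"
proof -
  have "(f has_vector_derivative D) (at x) \<longleftrightarrow>
      ((\<lambda>y. norm ((f y - f x) - (y - x) *\<^sub>R D) / norm (y - x)) \<longlongrightarrow> 0) (at x)"
    unfolding has_vector_derivative_def has_derivative_iff_norm by (simp add: bounded_linear_scaleR_left)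
  also have "\<dots> \<longleftrightarrow> ((\<lambda>y. norm ((f y - f x) /\<^sub>R (y - x) - D)) \<longlongrightarrow> 0) (at x)"
  proof (rule tendsto_cong)
    have "norm ((f y - f x) - (y - x) *\<^sub>R D) / norm (y - x) = norm ((f y - f x) /\<^sub>R (y - x) - D)" if "y \<noteq> x" for y
    proof -
      have "(f y - f x) /\<^sub>R (y - x) - D = ((f y - f x) - (y - x) *\<^sub>R D) /\<^sub>R (y - x)"
        using that by (simp add: scaleR_diff_right)
      then show ?thesis by (simp add: divide_inverse mult.commute)
    qed
    then show "\<forall>\<^sub>F y in at x. norm ((f y - f x) - (y - x) *\<^sub>R D) / norm (y - x) = norm ((f y - f x) /\<^sub>R (y - x) - D)"
      by (simp add: eventually_at_filter)
  qed
  finally show ?thesis by (simp add: tendsto_norm_zero_iff LIM_zero_iff)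
qed

text \<open>The difference quotients of the oscillating factor are bounded by |\<xi>|, so |\<xi> G|
  is an integrable majorant.\<close>

lemma Fourier_integral_has_derivative:
  fixes G :: "real \<Rightarrow> complex"
  assumes G: "integrable lborel G" and G1: "integrable lborel (\<lambda>\<xi>. complex_of_real \<xi> * G \<xi>)"
  shows "((\<lambda>x. LINT \<xi>|lborel. G \<xi> * iexp (x * \<xi>)) has_vector_derivative
      (LINT \<xi>|lborel. \<i> * (complex_of_real \<xi> * G \<xi>) * iexp (x * \<xi>))) (at x)"
proof -
  have [measurable]: "G \<in> borel_measurable borel" using borel_measurable_integrable[OF G] by simp
  have Gi: "integrable lborel (\<lambda>\<xi>. G \<xi> * iexp (x * \<xi>))" for x
    by (rule Bochner_Integration.integrable_bound[OF G]) (auto simp: norm_mult)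
  have "((\<lambda>y. ((LINT \<xi>|lborel. G \<xi> * iexp (y * \<xi>)) - (LINT \<xi>|lborel. G \<xi> * iexp (x * \<xi>))) /\<^sub>R (y - x)) \<longlongrightarrow>
      (LINT \<xi>|lborel. \<i> * (complex_of_real \<xi> * G \<xi>) * iexp (x * \<xi>))) (at x)"
    unfolding tendsto_at_iff_sequentially
  proof (intro allI impI)
    fix X :: "nat \<Rightarrow> real" assume X: "\<forall>i. X i \<in> UNIV - {x}" "X \<longlonglongrightarrow> x"
    have Xx: "X n - x \<noteq> 0" for n using X(1) by simp
    define D where "D n \<xi> = (G \<xi> * iexp (X n * \<xi>) - G \<xi> * iexp (x * \<xi>)) /\<^sub>R (X n - x)" for n \<xi>
    have "(\<lambda>n. LINT \<xi>|lborel. D n \<xi>) \<longlonglongrightarrow> (LINT \<xi>|lborel. \<i> * (complex_of_real \<xi> * G \<xi>) * iexp (x * \<xi>))"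
    proof (rule integral_dominated_convergence)
      show "integrable lborel (\<lambda>\<xi>. norm (complex_of_real \<xi> * G \<xi>))" using G1 by (rule integrable_norm)
      show "D n \<in> borel_measurable lborel" for n unfolding D_def[abs_def] by measurable
      show "AE \<xi> in lborel. (\<lambda>n. D n \<xi>) \<longlonglongrightarrow> \<i> * (complex_of_real \<xi> * G \<xi>) * iexp (x * \<xi>)"
      proof (rule AE_I2)
        fix \<xi>
        have "((\<lambda>y. G \<xi> * iexp (y * \<xi>)) has_vector_derivative \<i> * (complex_of_real \<xi> * G \<xi>) * iexp (x * \<xi>)) (at x)"
        proof -
          have "((\<lambda>z. G \<xi> * exp (\<i> * (z * complex_of_real \<xi>))) has_field_derivative
              \<i> * (complex_of_real \<xi> * G \<xi>) * exp (\<i> * (complex_of_real x * complex_of_real \<xi>))) (at (complex_of_real x))"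
            by (auto intro!: derivative_eq_intros)
          from has_vector_derivative_real_field[OF this] show ?thesis by simp
        qed
        then show "(\<lambda>n. D n \<xi>) \<longlonglongrightarrow> \<i> * (complex_of_real \<xi> * G \<xi>) * iexp (x * \<xi>)"
          unfolding has_vector_derivative_iff_quotient tendsto_at_iff_sequentially D_def
          using X by (auto simp: o_def)
      qed
      show "AE \<xi> in lborel. norm (D n \<xi>) \<le> norm (complex_of_real \<xi> * G \<xi>)" for n
      proof (rule AE_I2)
        fix \<xi>
        have "G \<xi> * iexp (X n * \<xi>) - G \<xi> * iexp (x * \<xi>) = G \<xi> * iexp (x * \<xi>) * (iexp ((X n - x) * \<xi>) - 1)"
          by (simp add: algebra_simps flip: exp_add)
        then have "norm (D n \<xi>) = cmod (G \<xi>) * cmod (iexp ((X n - x) * \<xi>) - 1) / \<bar>X n - x\<bar>"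
          by (simp add: D_def norm_mult divide_inverse mult.commute)
        also have "\<dots> \<le> cmod (G \<xi>) * \<bar>(X n - x) * \<xi>\<bar> / \<bar>X n - x\<bar>"
          using iexp_approx1[of "(X n - x) * \<xi>" 0] by (intro divide_right_mono mult_left_mono) auto
        also have "\<dots> = norm (complex_of_real \<xi> * G \<xi>)"
          using Xx[of n] by (simp add: abs_mult norm_mult)
        finally show "norm (D n \<xi>) \<le> norm (complex_of_real \<xi> * G \<xi>)" .
      qed
    qed measurable
    moreover have "(LINT \<xi>|lborel. D n \<xi>) = ((LINT \<xi>|lborel. G \<xi> * iexp (X n * \<xi>)) - (LINT \<xi>|lborel. G \<xi> * iexp (x * \<xi>))) /\<^sub>R (X n - x)" for n
      unfolding D_def using Gi by simp
    ultimately show "((\<lambda>y. ((LINT \<xi>|lborel. G \<xi> * iexp (y * \<xi>)) - (LINT \<xi>|lborel. G \<xi> * iexp (x * \<xi>))) /\<^sub>R (y - x)) \<circ> X)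
       \<longlonglongrightarrow> (LINT \<xi>|lborel. \<i> * (complex_of_real \<xi> * G \<xi>) * iexp (x * \<xi>))"
      by (simp add: o_def)
  qed
  then show ?thesis unfolding has_vector_derivative_iff_quotient .
qed

text \<open>Young's inequality with a free parameter \<open>\<mu>\<close> replaces the Cauchy-Schwarz inequality; the
  parameter is chosen to be the norm.\<close>

lemma sobolev_embedding:
  fixes r :: real and k :: nat
  assumes r: "r > real k + 1 / 2"
  obtains K where "0 \<le> K" "\<And>f. in_sobolev r f \<Longrightarrow> \<exists>h. (AE x in lborel. f x = h 0 x) \<and>
    (\<forall>j<k. \<forall>x. DERIV (h j) x :> h (Suc j) x) \<and> (\<forall>j\<le>k. continuous_on UNIV (h j)) \<and>
    (\<forall>j\<le>k. \<forall>x. \<bar>h j x\<bar> \<le> K * sobolev_norm r f)"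
proof -
  define A where "A = (LINT \<xi>|lborel. (1 + \<xi>\<^sup>2) powr (- (r - real k)))"
  have Ai: "integrable lborel (\<lambda>\<xi>. (1 + \<xi>\<^sup>2) powr (- (r - real k)))"
    by (rule integrable_one_plus_square_powr) (use r in simp)
  have A0: "0 \<le> A" unfolding A_def by (rule Bochner_Integration.integral_nonneg) simp
  define c where "c = complex_of_real (1 / sqrt (2 * pi))"
  have c1: "cmod c \<le> 1" unfolding c_def using pi_ge_two by (simp add: norm_divide field_simps real_le_rsqrt)
  have "\<exists>h. (AE x in lborel. f x = h 0 x) \<and>
    (\<forall>j<k. \<forall>x. DERIV (h j) x :> h (Suc j) x) \<and> (\<forall>j\<le>k. continuous_on UNIV (h j)) \<and>
    (\<forall>j\<le>k. \<forall>x. \<bar>h j x\<bar> \<le> (A + 1) * sobolev_norm r f)" if f: "in_sobolev r f" for f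
  proof -
    define g where "g = fourier_L2 f"
    have fg: "has_fourier_L2 f g" and gi: "integrable lborel (\<lambda>\<xi>. (1 + \<xi>\<^sup>2) powr r * (cmod (g \<xi>))\<^sup>2)"
      using in_sobolev_fourier_L2[OF f] by (auto simp: g_def)
    have [measurable]: "g \<in> borel_measurable borel" using fg by (auto simp: has_fourier_L2_def square_integrable_def)
    define N where "N = sobolev_norm r f"
    define I where "I = (LINT \<xi>|lborel. (1 + \<xi>\<^sup>2) powr r * (cmod (g \<xi>))\<^sup>2)"
    have I0: "0 \<le> I" unfolding I_def by (rule Bochner_Integration.integral_nonneg) simp
    have N: "0 \<le> N" "N\<^sup>2 = I" using I0 by (auto simp: N_def sobolev_norm_def I_def g_def)
    \<comment> \<open>With q = 1 + \<xi>^2 and |\<xi>|^j \<le> q^(k/2), the exponent k/2 is split as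
      -(r - k)/2 + r/2: the first power is square integrable because r - k > 1/2, the second is so
      after multiplication by g because f lies in the Sobolev space.\<close>
    have young: "\<bar>\<xi>\<bar> ^ j * cmod (g \<xi>) \<le> \<mu> * (1 + \<xi>\<^sup>2) powr (- (r - real k)) + ((1 + \<xi>\<^sup>2) powr r * (cmod (g \<xi>))\<^sup>2) / \<mu>"
      if j: "j \<le> k" and l: "0 < \<mu>" for j \<xi> \<mu>
    proof -
      define q where "q = 1 + \<xi>\<^sup>2"
      have q1: "1 \<le> q" "0 < q" by (auto simp: q_def add_pos_nonneg)
      have "\<bar>\<xi>\<bar> ^ j \<le> (sqrt q) ^ j" by (rule power_mono) (auto simp: q_def real_le_rsqrt)
      also have "\<dots> \<le> (sqrt q) ^ k" using q1 j by (intro power_increasing) auto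
      also have "\<dots> = q powr (real k / 2)" using q1 by (simp add: powr_half_sqrt[symmetric] powr_power)
      finally have "\<bar>\<xi>\<bar> ^ j * cmod (g \<xi>) \<le> q powr (real k / 2) * cmod (g \<xi>)" by (rule mult_right_mono) simp
      also have "\<dots> = q powr (- (r - real k) / 2) * (q powr (r / 2) * cmod (g \<xi>))"
        by (simp add: mult.assoc[symmetric] powr_add[symmetric] add_divide_distrib[symmetric])
      also have "\<dots> \<le> \<mu> * (q powr (- (r - real k) / 2))\<^sup>2 + (q powr (r / 2) * cmod (g \<xi>))\<^sup>2 / \<mu>"
      proof -
        have "a * b \<le> \<mu> * a\<^sup>2 + b\<^sup>2 / \<mu>" if "0 \<le> a" "0 \<le> b" for a b :: real
        proof -
          have "0 \<le> (\<mu> * a - b)\<^sup>2 / \<mu>" using l by simp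
          also have "\<dots> = \<mu> * a\<^sup>2 + b\<^sup>2 / \<mu> - 2 * (a * b)" using l by (simp add: power2_eq_square field_simps)
          finally show ?thesis using mult_nonneg_nonneg[OF that] by linarith
        qed
        then show ?thesis by simp
      qed
      also have "(q powr (- (r - real k) / 2))\<^sup>2 = q powr (- (r - real k))"
        using q1 by (simp add: power2_eq_square powr_add[symmetric])
      also have "(q powr (r / 2) * cmod (g \<xi>))\<^sup>2 = q powr r * (cmod (g \<xi>))\<^sup>2"
        using q1 by (simp add: power2_eq_square powr_add[symmetric])
      finally show ?thesis by (simp add: q_def)
    qed
    define G where "G j \<xi> = (\<i> * complex_of_real \<xi>) ^ j * g \<xi>" for j \<xi>
    have [measurable]: "G j \<in> borel_measurable borel" for j unfolding G_def[abs_def] by measurable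
    have G_norm: "cmod (G j \<xi>) = \<bar>\<xi>\<bar> ^ j * cmod (g \<xi>)" for j \<xi> by (simp add: G_def norm_mult norm_power)
    have rhs_int: "integrable lborel (\<lambda>\<xi>. \<mu> * (1 + \<xi>\<^sup>2) powr (- (r - real k)) + ((1 + \<xi>\<^sup>2) powr r * (cmod (g \<xi>))\<^sup>2) / \<mu>)" for \<mu>
      using Ai gi by simp
    have G_int: "integrable lborel (G j)" if "j \<le> k" for j
      by (rule Bochner_Integration.integrable_bound[OF rhs_int[of 1]])
        (use young[OF that, of 1] in \<open>auto simp: G_norm intro: order_trans[OF _ abs_ge_self]\<close>)
    have bound: "(LINT \<xi>|lborel. cmod (G j \<xi>)) \<le> (A + 1) * N" if j: "j \<le> k" for j
    proof -
      have l: "(LINT \<xi>|lborel. cmod (G j \<xi>)) \<le> \<mu> * A + N\<^sup>2 / \<mu>" if "0 < \<mu>" for \<mu>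
      proof -
        have "(LINT \<xi>|lborel. cmod (G j \<xi>)) \<le> (LINT \<xi>|lborel. \<mu> * (1 + \<xi>\<^sup>2) powr (- (r - real k)) + ((1 + \<xi>\<^sup>2) powr r * (cmod (g \<xi>))\<^sup>2) / \<mu>)"
          using young[OF j that] by (intro integral_mono integrable_norm G_int j rhs_int) (simp only: G_norm)
        also have "\<dots> = \<mu> * A + I / \<mu>" using Ai gi by (simp add: A_def I_def)
        finally show ?thesis by (simp add: N)
      qed
      show ?thesis
      proof (cases "N = 0")
        case False
        then have "N > 0" using N by simp
        \<comment> \<open>For \<mu> = N the bound \<mu> A + N^2 / \<mu> becomes (A + 1) N; this is
          the origin of the embedding constant.\<close>
        with l[of N] show ?thesis by (simp add: power2_eq_square algebra_simps)
      next
        case True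
        \<comment> \<open>For N = 0 the parameter cannot be the norm and is sent to 0
          instead.\<close>
        have "(LINT \<xi>|lborel. cmod (G j \<xi>)) \<le> 0 + e" if "0 < e" for e
        proof -
          have "e / (A + 1) * A \<le> e" using A0 that by (simp add: field_simps)
          then show ?thesis using l[of "e / (A + 1)"] that A0 True by simp
        qed
        then have "(LINT \<xi>|lborel. cmod (G j \<xi>)) \<le> 0" by (rule field_le_epsilon)
        then show ?thesis using True by simp
      qed
    qed
    \<comment> \<open>Each factor \<i> \<xi> in \<open>G j\<close> is one x-derivative of the
      inverse transform, so \<open>h j\<close> is the j-th derivative of \<open>h 0\<close> for j
      \<le> k.\<close>
    define h where "h j x = Re (c * (LINT \<xi>|lborel. G j \<xi> * iexp (x * \<xi>)))" for j x
    have D: "DERIV (h j) x :> h (Suc j) x" if "j < k" for j x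
    proof -
      have G1: "integrable lborel (\<lambda>\<xi>. complex_of_real \<xi> * G j \<xi>)"
        by (rule Bochner_Integration.integrable_bound[OF G_int[of "Suc j"]])
          (use that in \<open>auto simp: G_norm norm_mult\<close>)
      have "((\<lambda>x. c * (LINT \<xi>|lborel. G j \<xi> * iexp (x * \<xi>))) has_vector_derivative
        c * (LINT \<xi>|lborel. \<i> * (complex_of_real \<xi> * G j \<xi>) * iexp (x * \<xi>))) (at x)"
        using that by (intro has_vector_derivative_mult_right Fourier_integral_has_derivative G_int G1) auto
      from bounded_linear.has_vector_derivative[OF bounded_linear_Re this]
      show ?thesis
        by (simp add: h_def[abs_def] has_real_derivative_iff_has_vector_derivative G_def mult.assoc)
    qed
    have gwi: "integrable lborel (\<lambda>\<xi>. G j \<xi> * iexp (x * \<xi>))" if "j \<le> k" for j x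
      by (rule Bochner_Integration.integrable_bound[OF G_int[OF that]]) (auto simp: norm_mult)
    have hb: "\<bar>h j x\<bar> \<le> (A + 1) * N" if "j \<le> k" for j x
    proof -
      have "cmod (LINT \<xi>|lborel. G j \<xi> * iexp (x * \<xi>)) \<le> (LINT \<xi>|lborel. cmod (G j \<xi>))"
        using integral_norm_bound[of lborel "\<lambda>\<xi>. G j \<xi> * iexp (x * \<xi>)"] by (simp add: norm_mult)
      also have "\<dots> \<le> (A + 1) * N" by (rule bound[OF that])
      finally have "cmod c * cmod (LINT \<xi>|lborel. G j \<xi> * iexp (x * \<xi>)) \<le> 1 * ((A + 1) * N)"
        using c1 by (intro mult_mono) auto
      then have "cmod (c * (LINT \<xi>|lborel. G j \<xi> * iexp (x * \<xi>))) \<le> (A + 1) * N" by (simp add: norm_mult)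
      then show ?thesis unfolding h_def using abs_Re_le_cmod order_trans by blast
    qed
    have hc: "continuous_on UNIV (h j)" if "j \<le> k" for j
    proof -
      have "isCont (h j) x" for x
        unfolding isCont_def tendsto_at_iff_sequentially
      proof (intro allI impI)
        fix X :: "nat \<Rightarrow> real" assume "\<forall>i. X i \<in> UNIV - {x}" and X: "X \<longlonglongrightarrow> x"
        have "(\<lambda>n. LINT \<xi>|lborel. G j \<xi> * iexp (X n * \<xi>)) \<longlonglongrightarrow> (LINT \<xi>|lborel. G j \<xi> * iexp (x * \<xi>))"
        proof (rule integral_dominated_convergence)
          show "integrable lborel (\<lambda>\<xi>. cmod (G j \<xi>))" using G_int[OF that] by simp
          show "AE \<xi> in lborel. (\<lambda>n. G j \<xi> * iexp (X n * \<xi>)) \<longlonglongrightarrow> G j \<xi> * iexp (x * \<xi>)"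
            by (intro AE_I2 tendsto_intros X)
        qed (auto simp: norm_mult)
        then show "(h j \<circ> X) \<longlonglongrightarrow> h j x" unfolding h_def o_def by (intro tendsto_intros)
      qed
      then show ?thesis by (simp add: continuous_on_eq_continuous_at)
    qed
    have "integrable lborel g" using G_int[of 0] by (simp add: G_def[abs_def])
    from fourier_inversion[OF fg this] have "AE x in lborel. f x = h 0 x"
      by (simp add: h_def G_def c_def)
    then show ?thesis using D hc hb by (auto simp: N_def intro!: exI[of _ h])
  qed
  then show ?thesis using that[of "A + 1"] A0 by auto
qed

section \<open>Representatives of the solution\<close>

lemma has_field_derivative_chain_unique:
  fixes F G :: "nat \<Rightarrow> real \<Rightarrow> real"
  assumes "F 0 = G 0" "\<And>j x. j < k \<Longrightarrow> DERIV (F j) x :> F (Suc j) x" "\<And>j x. j < k \<Longrightarrow> DERIV (G j) x :> G (Suc j) x"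
  shows "j \<le> k \<Longrightarrow> F j = G j"
proof (induction j)
  case 0 show ?case by fact
next
  case (Suc j)
  then have "F j = G j" by simp
  then show ?case using assms(2,3)[of j] Suc.prems DERIV_unique by (metis Suc_le_eq ext)
qed

text \<open>The embedding is applied twice: to \<open>f t\<close>, for the representatives, and to
  \<open>f \<tau> - f t\<close>, for their distance. The representative of the difference is the
  difference of the representatives, since both are continuous and agree almost everywhere; hence
  every derivative up to order k varies continuously in t, uniformly in x.\<close>

lemma continuous_in_sobolev_representative:
  assumes r: "r > real k + 1 / 2" and f: "continuous_in_sobolev T r f" and T: "0 < T"
  obtains H :: "nat \<Rightarrow> real \<Rightarrow> real \<Rightarrow> real" and \<delta> B where
    "\<And>t. t \<in> time_interval T \<Longrightarrow> f t \<in> borel_measurable borel"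
    "\<And>t. t \<in> time_interval T \<Longrightarrow> AE x in lborel. f t x = H 0 t x"
    "\<And>t j x. t \<in> time_interval T \<Longrightarrow> j < k \<Longrightarrow> DERIV (H j t) x :> H (Suc j) t x"
    "\<And>j. j \<le> k \<Longrightarrow> continuous_on (time_interval T \<times> UNIV) (\<lambda>(t, x). H j t x)"
    "0 < \<delta>" "ereal \<delta> < T"
    "\<And>t j x. t \<in> {0..\<delta>} \<Longrightarrow> j \<le> k \<Longrightarrow> \<bar>H j t x\<bar> \<le> B"
proof -
  obtain K where K: "0 \<le> K" "\<And>f. in_sobolev r f \<Longrightarrow> \<exists>h. (AE x in lborel. f x = h 0 x) \<and>
    (\<forall>j<k. \<forall>x. DERIV (h j) x :> h (Suc j) x) \<and> (\<forall>j\<le>k. continuous_on UNIV (h j)) \<and>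
    (\<forall>j\<le>k. \<forall>x. \<bar>h j x\<bar> \<le> K * sobolev_norm r f)"
    using sobolev_embedding[OF r] by blast
  have fs: "in_sobolev r (f t)" if "t \<in> time_interval T" for t
    using f that by (auto simp: continuous_in_sobolev_def)
  have "\<forall>t\<in>time_interval T. \<exists>h. (AE x in lborel. f t x = h 0 x) \<and>
    (\<forall>j<k. \<forall>x. DERIV (h j) x :> h (Suc j) x) \<and> (\<forall>j\<le>k. continuous_on UNIV (h j)) \<and>
    (\<forall>j\<le>k. \<forall>x. \<bar>h j x\<bar> \<le> K * sobolev_norm r (f t))"
    using K(2)[OF fs] by blast
  from bchoice[OF this] obtain h where hh: "\<forall>t\<in>time_interval T. (AE x in lborel. f t x = h t 0 x) \<and>
    (\<forall>j<k. \<forall>x. DERIV (h t j) x :> h t (Suc j) x) \<and> (\<forall>j\<le>k. continuous_on UNIV (h t j)) \<and>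
    (\<forall>j\<le>k. \<forall>x. \<bar>h t j x\<bar> \<le> K * sobolev_norm r (f t))" by (rule exE)
  have h: "AE x in lborel. f t x = h t 0 x" "j < k \<Longrightarrow> DERIV (h t j) x :> h t (Suc j) x"
      "j \<le> k \<Longrightarrow> continuous_on UNIV (h t j)" "j \<le> k \<Longrightarrow> \<bar>h t j x\<bar> \<le> K * sobolev_norm r (f t)"
    if "t \<in> time_interval T" for t j x
    using bspec[OF hh that] by simp_all
  have diff: "\<bar>h \<tau> j x - h t j x\<bar> \<le> K * sobolev_norm r (\<lambda>x. f \<tau> x - f t x)"
    if \<tau>: "\<tau> \<in> time_interval T" and t: "t \<in> time_interval T" and j: "j \<le> k" for \<tau> t j x
  proof -
    from K(2)[OF in_sobolev_diff[OF fs[OF \<tau>] fs[OF t]]]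
    obtain w where ww: "(AE x in lborel. f \<tau> x - f t x = w 0 x) \<and>
      (\<forall>j<k. \<forall>x. DERIV (w j) x :> w (Suc j) x) \<and> (\<forall>j\<le>k. continuous_on UNIV (w j)) \<and>
      (\<forall>j\<le>k. \<forall>x. \<bar>w j x\<bar> \<le> K * sobolev_norm r (\<lambda>x. f \<tau> x - f t x))" by (rule exE)
    have w: "AE x in lborel. f \<tau> x - f t x = w 0 x"
      "j < k \<Longrightarrow> DERIV (w j) x :> w (Suc j) x" "j \<le> k \<Longrightarrow> continuous_on UNIV (w j)"
      "j \<le> k \<Longrightarrow> \<bar>w j x\<bar> \<le> K * sobolev_norm r (\<lambda>x. f \<tau> x - f t x)" for j x
      using ww by simp_all
    have "AE x in lborel. w 0 x = h \<tau> 0 x - h t 0 x"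
      using w(1) h(1)[OF \<tau>] h(1)[OF t] by eventually_elim simp
    then have "w 0 = (\<lambda>x. h \<tau> 0 x - h t 0 x)"
      by (intro continuous_AE_eq_imp_eq w(3) continuous_on_diff h(3)) (simp_all add: \<tau> t)
    then have "w j = (\<lambda>x. h \<tau> j x - h t j x)"
      by (intro has_field_derivative_chain_unique[of w "\<lambda>j x. h \<tau> j x - h t j x" k j] w(2) DERIV_diff h(2) \<tau> t j)
    then show ?thesis using w(4)[OF j, of x] by simp
  qed
  have near: "\<exists>d>0. \<forall>\<tau>\<in>time_interval T. \<bar>\<tau> - t\<bar> < d \<longrightarrow> (\<forall>j\<le>k. \<forall>x. \<bar>h \<tau> j x - h t j x\<bar> \<le> e)"
    if t: "t \<in> time_interval T" and e: "0 < e" for t e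
  proof -
    have "((\<lambda>\<tau>. K * sobolev_norm r (\<lambda>x. f \<tau> x - f t x)) \<longlongrightarrow> K * 0) (at t within time_interval T)"
      using f t by (intro tendsto_mult_left) (auto simp: continuous_in_sobolev_def)
    then have "\<forall>\<^sub>F \<tau> in at t within time_interval T. K * sobolev_norm r (\<lambda>x. f \<tau> x - f t x) < e"
      using e by (intro order_tendstoD(2)) auto
    then obtain d where d: "d > 0" "\<And>\<tau>. \<tau> \<in> time_interval T \<Longrightarrow> \<tau> \<noteq> t \<Longrightarrow> dist \<tau> t < d \<Longrightarrow>
        K * sobolev_norm r (\<lambda>x. f \<tau> x - f t x) < e"
      by (auto simp: eventually_at)
    have "\<bar>h \<tau> j x - h t j x\<bar> \<le> e" if "\<tau> \<in> time_interval T" "\<bar>\<tau> - t\<bar> < d" "j \<le> k" for \<tau> j x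
    proof (cases "\<tau> = t")
      case False
      then show ?thesis using d(2)[of \<tau>] diff[OF that(1) t that(3), of x] that by (simp add: dist_real_def)
    qed (use e in simp)
    then show ?thesis using d(1) by blast
  qed
  have z: "0 \<in> time_interval T" using T by (simp add: time_interval_def zero_ereal_def)
  \<comment> \<open>Tolerance 1 at time 0: on a short interval all derivatives stay within 1 of the
    initial ones, which gives a bound uniform in t and x.\<close>
  obtain d where d: "d > 0" "\<And>\<tau> j x. \<tau> \<in> time_interval T \<Longrightarrow> \<bar>\<tau>\<bar> < d \<Longrightarrow> j \<le> k \<Longrightarrow> \<bar>h \<tau> j x - h 0 j x\<bar> \<le> 1"
    using near[OF z, of 1] by auto
  have "0 < min T (ereal d)" using T d(1) by (simp add: zero_ereal_def)
  then obtain \<delta> where \<delta>: "ereal 0 < ereal \<delta>" "ereal \<delta> < min T (ereal d)"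
    by (metis ereal_dense2 zero_ereal_def)
  show ?thesis
  proof
    show "f t \<in> borel_measurable borel" if "t \<in> time_interval T" for t
      using in_sobolev_measurable[OF fs[OF that]] .
    show "AE x in lborel. f t x = (\<lambda>j t x. h t j x) 0 t x" if "t \<in> time_interval T" for t
      using h(1)[OF that] .
    show "DERIV ((\<lambda>j t x. h t j x) j t) x :> (\<lambda>j t x. h t j x) (Suc j) t x"
      if "t \<in> time_interval T" "j < k" for t j x using h(2)[OF that] .
    show "0 < \<delta>" "ereal \<delta> < T" using \<delta> by auto
    show "\<bar>(\<lambda>j t x. h t j x) j t x\<bar> \<le> K * sobolev_norm r (f 0) + 1" if "t \<in> {0..\<delta>}" "j \<le> k" for t j x
    proof -
      have "ereal t \<le> ereal \<delta>" using that by simp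
      then have "ereal t < T" using \<delta>(2) by (meson le_less_trans min_less_iff_conj)
      then have "t \<in> time_interval T" "\<bar>t\<bar> < d" using that \<delta> by (auto simp: time_interval_def)
      then have "\<bar>h t j x - h 0 j x\<bar> \<le> 1" using d(2) that(2) by blast
      then show ?thesis using h(4)[OF z that(2), of x] by simp
    qed
    show "continuous_on (time_interval T \<times> UNIV) (\<lambda>(t, x). (\<lambda>j t x. h t j x) j t x)" if j: "j \<le> k" for j
      unfolding continuous_on_iff
    proof (intro ballI allI impI)
      fix p :: "real \<times> real" and e :: real
      assume p: "p \<in> time_interval T \<times> UNIV" and e: "0 < e"
      obtain t x where tx: "p = (t, x)" "t \<in> time_interval T" using p by auto
      \<comment> \<open>d1 does not depend on the space variable, so the move in time can be made at
        the new point y and the move in space at the fixed time t.\<close>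
      obtain d1 where d1: "d1 > 0" "\<And>\<tau> x. \<tau> \<in> time_interval T \<Longrightarrow> \<bar>\<tau> - t\<bar> < d1 \<Longrightarrow> \<bar>h \<tau> j x - h t j x\<bar> \<le> e / 2"
        using near[OF tx(2), of "e / 2"] e j by auto
      obtain d2 where d2: "d2 > 0" "\<And>y. dist y x < d2 \<Longrightarrow> dist (h t j y) (h t j x) < e / 2"
        using h(3)[OF tx(2) j] e unfolding continuous_on_iff by (metis UNIV_I half_gt_zero)
      show "\<exists>d>0. \<forall>p'\<in>time_interval T \<times> UNIV. dist p' p < d \<longrightarrow>
          dist (case p' of (t, x) \<Rightarrow> h t j x) (case p of (t, x) \<Rightarrow> h t j x) < e"
      proof (intro exI[of _ "min d1 d2"] conjI ballI impI)
        fix p' assume p': "p' \<in> time_interval T \<times> UNIV" "dist p' p < min d1 d2"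
        obtain \<tau> y where ty: "p' = (\<tau>, y)" "\<tau> \<in> time_interval T" using p' by auto
        have 1: "\<bar>\<tau> - t\<bar> < d1" using dist_fst_le[of p' p] p'(2) by (simp add: ty tx dist_real_def)
        have 2: "dist y x < d2" using dist_snd_le[of p' p] p'(2) by (simp add: ty tx)
        have "\<bar>h \<tau> j y - h t j y\<bar> \<le> e / 2" using d1(2)[OF ty(2) 1] .
        moreover have "\<bar>h t j y - h t j x\<bar> < e / 2" using d2(2)[OF 2] by (simp add: dist_real_def)
        ultimately have "\<bar>h \<tau> j y - h t j x\<bar> < e" by linarith
        then show "dist (case p' of (t, x) \<Rightarrow> h t j x) (case p of (t, x) \<Rightarrow> h t j x) < e"
          by (simp add: ty tx dist_real_def)
      qed (use d1 d2 in auto)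
    qed
  qed
qed

section \<open>The exponential kernel and the inversion of 1 - d^2/dx^2\<close>

text \<open>For \<beta> > 0 the truncated weights are at least 1, so this makes the integrals in
  \<open>is_weight_constant\<close> converge. The bound comes from the exponential series up to
  order two, which dominates (1 + z^2) / 2.\<close>

lemma integrable_exp_neg_abs_diff: "integrable lborel (\<lambda>y::real. exp (- \<bar>x - y\<bar>))"
proof -
  have i: "integrable lborel (\<lambda>z::real. 2 * (1 + z\<^sup>2) powr (- 1))"
    by (intro integrable_mult_right integrable_one_plus_square_powr) simp
  have 0: "integrable lborel (\<lambda>z::real. exp (- \<bar>z\<bar>))"
  proof (rule Bochner_Integration.integrable_bound[OF i])
    show "AE z in lborel. norm (exp (- \<bar>z::real\<bar>)) \<le> norm (2 * (1 + z\<^sup>2) powr (- 1))"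
    proof (rule AE_I2)
      fix z :: real
      have "(1 + z\<^sup>2) / 2 \<le> 1 + \<bar>z\<bar> + \<bar>z\<bar>\<^sup>2 / 2" by simp
      also have "\<dots> \<le> exp \<bar>z\<bar>" by (rule exp_lower_Taylor_quadratic) simp
      finally have "exp (- \<bar>z\<bar>) \<le> 2 / (1 + z\<^sup>2)"
        by (simp add: exp_minus field_simps add_pos_nonneg)
      then show "norm (exp (- \<bar>z\<bar>)) \<le> norm (2 * (1 + z\<^sup>2) powr (- 1))"
        by (simp add: powr_minus divide_inverse add_nonneg_nonneg)
    qed
  qed measurable
  have "integrable lborel (\<lambda>y. exp (- \<bar>- x + 1 * y\<bar>))"
    using lborel_integrable_real_affine_iff[of 1 "\<lambda>z. exp (- \<bar>z\<bar>)" "-x"] 0 by simp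
  moreover have "\<bar>- x + 1 * y\<bar> = \<bar>x - y\<bar>" for y by simp
  ultimately show ?thesis by (simp only:)
qed

text \<open>The y-derivatives of -exp(x - y) (f + f1) and of exp(y - x) (f - f1) are the respective
  exponentials times f - f2. Integrating to the right and to the left of x bounds f + f1 and f - f1
  by the same integral, and f and f1 are their half sum and half difference.\<close>

lemma helmholtz_bound:
  fixes f f1 f2 w :: "real \<Rightarrow> real"
  assumes f: "\<And>x. DERIV f x :> f1 x" "\<And>x. DERIV f1 x :> f2 x" "continuous_on UNIV f2"
    and bd: "\<And>x. \<bar>f x\<bar> \<le> B" "\<And>x. \<bar>f1 x\<bar> \<le> B"
    and w: "\<And>y. \<bar>f y - f2 y\<bar> \<le> w y" and wi: "integrable lborel (\<lambda>y. exp (- \<bar>x - y\<bar>) * w y)"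
  shows "\<bar>f x\<bar> \<le> (LINT y|lborel. exp (- \<bar>x - y\<bar>) * w y)" "\<bar>f1 x\<bar> \<le> (LINT y|lborel. exp (- \<bar>x - y\<bar>) * w y)"
proof -
  define I where "I = (LINT y|lborel. exp (- \<bar>x - y\<bar>) * w y)"
  have fc: "continuous_on S f" "continuous_on S f2" for S
    using f(1) f(3) by (meson DERIV_isCont continuous_at_imp_continuous_on, meson continuous_on_subset subset_UNIV)
  have w0: "0 \<le> w y" for y using w[of y] by linarith
  have part: "\<bar>integral {a..b} g\<bar> \<le> I"
    if g: "continuous_on {a..b} g" "\<And>y. y \<in> {a..b} \<Longrightarrow> \<bar>g y\<bar> \<le> exp (- \<bar>x - y\<bar>) * w y" for a b g
  proof -
    have i: "set_integrable lborel {a..b} g" by (rule borel_integrable_atLeastAtMost'[OF g(1)])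
    have "\<bar>LINT y|lborel. indicator {a..b} y *\<^sub>R g y\<bar> \<le> (LINT y|lborel. \<bar>indicator {a..b} y *\<^sub>R g y\<bar>)"
      using integral_norm_bound[of lborel "\<lambda>y. indicator {a..b} y *\<^sub>R g y"] by simp
    also have "\<dots> \<le> I"
      unfolding I_def
      by (rule integral_mono) (use i g(2) w0 wi in \<open>auto simp: set_integrable_def indicator_def\<close>)
    finally show ?thesis
      using set_borel_integral_eq_integral(2)[OF i] by (simp add: set_lebesgue_integral_def)
  qed
  \<comment> \<open>The boundary term at distance R is at most 2 B exp(-R); letting R tend to
    infinity removes it.\<close>
  have lim: "\<bar>c\<bar> \<le> I" if "\<And>R. 0 \<le> R \<Longrightarrow> \<bar>c\<bar> \<le> exp (- R) * (2 * B) + I" for c :: real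
  proof (rule tendsto_lowerbound)
    have E: "((\<lambda>R::real. exp (- R)) \<longlongrightarrow> 0) at_top"
      using filterlim_compose[OF exp_at_bot filterlim_uminus_at_bot_at_top] .
    show "((\<lambda>R::real. exp (- R) * (2 * B) + I) \<longlongrightarrow> I) at_top"
      using tendsto_add[OF tendsto_mult_right[OF E, of "2 * B"] tendsto_const[of I]] by simp
    show "\<forall>\<^sub>F R in at_top. \<bar>c\<bar> \<le> exp (- R) * (2 * B) + I"
      using eventually_ge_at_top[of 0] by eventually_elim (rule that)
  qed simp
  have e: "\<bar>exp (- R) * (f z + \<sigma> * f1 z)\<bar> \<le> exp (- R) * (2 * B)" if "\<bar>\<sigma>\<bar> = 1" for R z \<sigma> :: real
  proof -
    have "\<bar>f z + \<sigma> * f1 z\<bar> \<le> \<bar>f z\<bar> + \<bar>\<sigma>\<bar> * \<bar>f1 z\<bar>" using abs_triangle_ineq[of "f z" "\<sigma> * f1 z"] by (simp add: abs_mult)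
    also have "\<dots> \<le> 2 * B" using bd[of z] that by simp
    finally show ?thesis by (simp add: abs_mult)
  qed
  have "\<bar>f x + f1 x\<bar> \<le> I"
  proof (rule lim)
    fix R :: real assume R: "0 \<le> R"
    have "((\<lambda>y. exp (x - y) * (f y - f2 y)) has_integral
        - exp (x - (x + R)) * (f (x + R) + f1 (x + R)) - - exp (x - x) * (f x + f1 x)) {x..x + R}"
    proof (rule fundamental_theorem_of_calculus)
      fix y
      have "((\<lambda>y. - exp (x - y) * (f y + f1 y)) has_real_derivative exp (x - y) * (f y - f2 y)) (at y)"
        by (auto intro!: derivative_eq_intros f simp: algebra_simps)
      then show "((\<lambda>y. - exp (x - y) * (f y + f1 y)) has_vector_derivative exp (x - y) * (f y - f2 y)) (at y within {x..x + R})"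
        by (auto simp: has_real_derivative_iff_has_vector_derivative[symmetric] intro: has_field_derivative_at_within)
    qed (use R in simp)
    then have "f x + f1 x = exp (- R) * (f (x + R) + 1 * f1 (x + R)) + integral {x..x + R} (\<lambda>y. exp (x - y) * (f y - f2 y))"
      by (simp add: integral_unique)
    moreover have "\<bar>integral {x..x + R} (\<lambda>y. exp (x - y) * (f y - f2 y))\<bar> \<le> I"
      by (rule part) (use w in \<open>auto intro!: continuous_intros fc simp: abs_mult\<close>)
    ultimately show "\<bar>f x + f1 x\<bar> \<le> exp (- R) * (2 * B) + I" using e[of 1 R "x + R"] by linarith
  qed
  moreover have "\<bar>f x - f1 x\<bar> \<le> I"
  proof (rule lim)
    fix R :: real assume R: "0 \<le> R"
    have "((\<lambda>y. exp (y - x) * (f y - f2 y)) has_integral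
        exp (x - x) * (f x - f1 x) - exp (x - R - x) * (f (x - R) - f1 (x - R))) {x - R..x}"
    proof (rule fundamental_theorem_of_calculus)
      fix y
      have "((\<lambda>y. exp (y - x) * (f y - f1 y)) has_real_derivative exp (y - x) * (f y - f2 y)) (at y)"
        by (auto intro!: derivative_eq_intros f simp: algebra_simps)
      then show "((\<lambda>y. exp (y - x) * (f y - f1 y)) has_vector_derivative exp (y - x) * (f y - f2 y)) (at y within {x - R..x})"
        by (auto simp: has_real_derivative_iff_has_vector_derivative[symmetric] intro: has_field_derivative_at_within)
    qed (use R in simp)
    then have "f x - f1 x = exp (- R) * (f (x - R) + (-1) * f1 (x - R)) + integral {x - R..x} (\<lambda>y. exp (y - x) * (f y - f2 y))"
      by (simp add: integral_unique)
    moreover have "\<bar>integral {x - R..x} (\<lambda>y. exp (y - x) * (f y - f2 y))\<bar> \<le> I"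
      by (rule part) (use w in \<open>auto intro!: continuous_intros fc simp: abs_mult\<close>)
    ultimately show "\<bar>f x - f1 x\<bar> \<le> exp (- R) * (2 * B) + I" using e[of "-1" R "x - R"] by linarith
  qed
  ultimately show "\<bar>f x\<bar> \<le> I" "\<bar>f1 x\<bar> \<le> I" by linarith+
qed

text \<open>Differentiation of the conservation law for \<open>\<rho>\<close> in space, from which the balance law for \<open>\<rho>\<^sub>x\<close>
  follows.\<close>

lemma conservation_law_pointwise:
  fixes q F Fx :: "real \<Rightarrow> real \<Rightarrow> real"
  assumes t: "0 \<le> t"
    and cont: "continuous_on ({0..t} \<times> UNIV) (\<lambda>(t, x). q t x)" "continuous_on ({0..t} \<times> UNIV) (\<lambda>(t, x). F t x)"
      "continuous_on ({0..t} \<times> UNIV) (\<lambda>(t, x). Fx t x)"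
    and F': "\<And>\<tau> x. \<tau> \<in> {0..t} \<Longrightarrow> DERIV (F \<tau>) x :> Fx \<tau> x"
    and law: "\<And>x1 x2. x1 < x2 \<Longrightarrow> integral {x1..x2} (\<lambda>x. q t x - q 0 x) = - integral {0..t} (\<lambda>\<tau>. F \<tau> x2 - F \<tau> x1)"
  shows "q t x - q 0 x = - integral {0..t} (\<lambda>\<tau>. Fx \<tau> x)"
proof -
  have ct: "continuous_on {0..t} (\<lambda>\<tau>. F \<tau> y)" for y
    by (rule continuous_on_pair_compose[OF cont(2)]) (auto intro!: continuous_intros)
  have qc: "continuous_on S (\<lambda>y. q t y - q 0 y)" for S
    by (intro continuous_on_diff continuous_on_pair_compose[OF cont(1)]) (use t in \<open>auto intro!: continuous_intros\<close>)
  define E where "E y = integral {0..t} (\<lambda>\<tau>. F \<tau> y)" for y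
  have Fi: "(\<lambda>\<tau>. F \<tau> y) integrable_on {0..t}" for y using ct by (rule integrable_continuous_real)
  have "((\<lambda>y. integral (cbox 0 t) (\<lambda>\<tau>. F \<tau> y)) has_field_derivative integral (cbox 0 t) (\<lambda>\<tau>. Fx \<tau> x)) (at x within UNIV)"
  proof (rule leibniz_rule_field_derivative)
    show "continuous_on (UNIV \<times> cbox 0 t) (\<lambda>(y, \<tau>). Fx \<tau> y)"
      unfolding case_prod_unfold
      by (rule continuous_on_pair_compose[OF cont(3)]) (auto intro!: continuous_intros)
  qed (use F' Fi in auto)
  then have E': "(E has_real_derivative integral {0..t} (\<lambda>\<tau>. Fx \<tau> x)) (at x)"
    by (simp add: E_def[abs_def])
  \<comment> \<open>The integrated law is read as an identity between functions of the right end
    point y, with left end x - 1, and both sides are differentiated at y = x.\<close>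
  have q': "((\<lambda>y. integral {x - 1..y} (\<lambda>y. q t y - q 0 y)) has_real_derivative q t x - q 0 x) (at x)"
    using integral_has_real_derivative[OF qc[of "{x - 1..x + 1}"], of x] at_within_Icc_at[of "x - 1" x "x + 1"] by simp
  have "((\<lambda>y. E (x - 1) - E y) has_real_derivative 0 - integral {0..t} (\<lambda>\<tau>. Fx \<tau> x)) (at x)"
    by (intro DERIV_diff DERIV_const E')
  moreover have "\<forall>\<^sub>F y in nhds x. integral {x - 1..y} (\<lambda>y. q t y - q 0 y) = E (x - 1) - E y"
    using eventually_nhds_in_open[of "{x - 1<..}" x]
  proof (rule eventually_mono)
    fix y assume "y \<in> {x - 1<..}"
    then show "integral {x - 1..y} (\<lambda>y. q t y - q 0 y) = E (x - 1) - E y"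
      using law[of "x - 1" y] by (simp add: E_def Henstock_Kurzweil_Integration.integral_diff[OF Fi Fi])
  qed auto
  ultimately have "((\<lambda>y. integral {x - 1..y} (\<lambda>y. q t y - q 0 y)) has_real_derivative - integral {0..t} (\<lambda>\<tau>. Fx \<tau> x)) (at x)"
    by (subst DERIV_cong_ev[OF refl _ refl]) auto
  with q' show ?thesis by (rule DERIV_unique)
qed

section \<open>Weighted bounds\<close>

text \<open>Taking the maximum with C turns the inequality into an almost everywhere equality of
  continuous functions.\<close>

lemma continuous_AE_le_imp_le:
  fixes g :: "real \<Rightarrow> real"
  assumes g: "continuous_on UNIV g" and ae: "AE x in lborel. g x \<le> C"
  shows "g x \<le> C"
proof -
  have "(\<lambda>x. max (g x) C) = (\<lambda>x. C)"
  proof (rule continuous_AE_eq_imp_eq)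
    show "continuous_on UNIV (\<lambda>x. max (g x) C)" by (intro continuous_intros g)
    show "AE x in lborel. max (g x) C = C" using ae by eventually_elim (simp add: max_def)
  qed simp
  then have "max (g x) C = C" by (rule fun_cong)
  then show ?thesis by simp
qed

abbreviation weight :: "real \<Rightarrow> real \<Rightarrow> real" where
  "weight \<beta> x \<equiv> (1 + \<beta> + \<bar>x\<bar>) powr \<beta>"

text \<open>For a function that is not measurable \<open>esssup\<close> takes the value infinity, so
  nonnegativity holds for every component of a tuple, measurable or not, and each component is
  dominated by the sum.\<close>

lemma Linf_norm_nonneg: "0 \<le> Linf_norm f"
proof (cases "f \<in> borel_measurable borel")
  case True
  then have [measurable]: "(\<lambda>x. ereal \<bar>f x\<bar>) \<in> borel_measurable lborel" by simp
  have "esssup lborel (\<lambda>x::real. 0::ereal) \<le> esssup lborel (\<lambda>x. ereal \<bar>f x\<bar>)"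
    by (rule esssup_mono) auto
  then show ?thesis by (simp add: Linf_norm_def esssup_const)
next
  case False
  then show ?thesis
    unfolding Linf_norm_def
    by (cases "(\<lambda>x. ereal \<bar>f x\<bar>) \<in> borel_measurable lborel")
      (auto simp: esssup_non_measurable intro: order_trans[OF _ esssup_mono[of "\<lambda>x::real. 0::ereal" lborel]] simp: esssup_const)
qed

lemma weighted_Linf_norm_member_le:
  assumes "f \<in> set fs"
  shows "Linf_norm (\<lambda>x. f x * weight \<beta> x) \<le> weighted_Linf_norm \<beta> fs"
proof -
  have "a \<in> set xs \<Longrightarrow> (\<forall>x\<in>set xs. 0 \<le> x) \<Longrightarrow> a \<le> sum_list xs" for a :: ereal and xs
  proof (induction xs)
    case (Cons y ys)
    have "0 \<le> sum_list ys" using Cons.prems(2) by (intro sum_list_nonneg) auto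
    then show ?case using Cons by (auto intro: add_increasing add_increasing2)
  qed simp
  then show ?thesis unfolding weighted_Linf_norm_def using assms by (auto simp: Linf_norm_nonneg)
qed

text \<open>Tracing a single characteristic calls for the bound at every point of the continuous
  representative rather than almost everywhere.\<close>

lemma weighted_Linf_norm_le_imp_le:
  assumes le: "weighted_Linf_norm \<beta> fs \<le> ereal C" and f: "f \<in> set fs"
    and F: "AE x in lborel. f x = F x" "continuous_on UNIV F" and \<beta>: "0 < \<beta>"
  shows "\<bar>F x\<bar> * weight \<beta> x \<le> C"
proof (rule continuous_AE_le_imp_le[where g="\<lambda>x. \<bar>F x\<bar> * weight \<beta> x"])
  have "1 + \<beta> + \<bar>x\<bar> \<noteq> 0" for x using \<beta> abs_ge_zero[of x] by linarith
  then show "continuous_on UNIV (\<lambda>x. \<bar>F x\<bar> * weight \<beta> x)"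
    by (intro continuous_intros F(2)) auto
  have "AE x in lborel. ereal \<bar>f x * weight \<beta> x\<bar> \<le> Linf_norm (\<lambda>x. f x * weight \<beta> x)"
    unfolding Linf_norm_def by (rule esssup_AE)
  then show "AE x in lborel. \<bar>F x\<bar> * weight \<beta> x \<le> C"
    using F(1)
  proof eventually_elim
    case (elim x)
    then have "ereal \<bar>f x * weight \<beta> x\<bar> \<le> ereal C"
      using weighted_Linf_norm_member_le[OF f, of \<beta>] le by (meson order_trans)
    then show ?case using elim by (simp add: abs_mult)
  qed
qed

lemma Linf_norm_weighted_leI:
  assumes f: "f \<in> borel_measurable borel" "AE x in lborel. f x = F x"
    and b: "\<And>x. \<bar>F x\<bar> * weight \<beta> x \<le> b"
  shows "Linf_norm (\<lambda>x. f x * weight \<beta> x) \<le> ereal b"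
  unfolding Linf_norm_def
proof (rule esssup_I)
  note [measurable] = f(1)
  show "(\<lambda>x. ereal \<bar>f x * weight \<beta> x\<bar>) \<in> borel_measurable lborel" by measurable
  show "AE x in lborel. ereal \<bar>f x * weight \<beta> x\<bar> \<le> ereal b"
    using f(2) by eventually_elim (use b in \<open>simp add: abs_mult\<close>)
qed

text \<open>As the base is at least 1, a shift by d multiplies it by at most 1 + d \<le> exp d; the
  power \<beta> makes this exp(\<beta> d) \<le> exp(1/2) \<le> 2.\<close>

lemma weight_comparable:
  fixes \<beta> d x y :: real
  assumes \<beta>: "0 < \<beta>" and d: "0 \<le> d" "\<beta> * d \<le> 1 / 2" and xy: "\<bar>x - y\<bar> \<le> d"
  shows "weight \<beta> x \<le> 2 * weight \<beta> y"
proof -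
  have "1 + \<beta> + \<bar>x\<bar> \<le> 1 + \<beta> + \<bar>y\<bar> + d" using xy by linarith
  also have "\<dots> \<le> (1 + \<beta> + \<bar>y\<bar>) * (1 + d)"
    using mult_right_mono[of 1 "1 + \<beta> + \<bar>y\<bar>" d] \<beta> d by (simp add: algebra_simps)
  also have "\<dots> \<le> (1 + \<beta> + \<bar>y\<bar>) * exp d"
    using \<beta> by (intro mult_left_mono exp_ge_add_one_self) auto
  finally have "weight \<beta> x \<le> ((1 + \<beta> + \<bar>y\<bar>) * exp d) powr \<beta>"
    using \<beta> by (intro powr_mono2) auto
  also have "\<dots> = weight \<beta> y * exp (\<beta> * d)"
    using \<beta> by (simp add: powr_mult exp_powr_real mult.commute)
  also have "\<dots> \<le> weight \<beta> y * 2"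
  proof (rule mult_left_mono)
    have "exp (\<beta> * d) \<le> exp (1 / 2)" using d by simp
    also have "exp (1 / 2) \<le> (2 :: real)"
    proof (rule power2_le_imp_le)
      have "(exp (1 / 2 :: real))\<^sup>2 = exp 1" by (simp flip: exp_double)
      then show "(exp (1 / 2 :: real))\<^sup>2 \<le> 2\<^sup>2" using exp_le by simp
    qed simp
    finally show "exp (\<beta> * d) \<le> 2" .
  qed simp
  finally show ?thesis by (simp add: mult.commute)
qed

text \<open>Truncation only lowers the weight, so f - f2 is at most D divided by the truncated
  weight; the kernel estimate and the defining inequality of \<open>C\<close> then give D times C.
  The last bound comes from f2 = f - (f - f2).\<close>

lemma weighted_bound_of_momentum:
  fixes f f1 f2 :: "real \<Rightarrow> real"
  assumes \<beta>: "0 < \<beta>" and C: "is_weight_constant \<beta> C"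
    and f: "\<And>x. DERIV f x :> f1 x" "\<And>x. DERIV f1 x :> f2 x" "continuous_on UNIV f2"
    and bd: "\<And>x. \<bar>f x\<bar> \<le> B" "\<And>x. \<bar>f1 x\<bar> \<le> B"
    and D: "\<And>y. \<bar>f y - f2 y\<bar> * weight \<beta> y \<le> D"
  shows "\<bar>f x\<bar> * weight \<beta> x \<le> D * C" "\<bar>f1 x\<bar> * weight \<beta> x \<le> D * C"
    "\<bar>f2 x\<bar> * weight \<beta> x \<le> D * C + D"
proof -
  \<comment> \<open>At level |x| + 1 the truncated weight at x equals the full weight. The
    inequality for \<open>C\<close> holds at every level, so the level may depend on x.\<close>
  define N where "N = \<bar>x\<bar> + 1"
  define \<phi> where "\<phi> y = weight \<beta> y" for y
  define tw where "tw = truncated_weight \<beta> N"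
  have N: "0 < N" "tw x = \<phi> x" by (auto simp: N_def tw_def truncated_weight_def \<phi>_def)
  have tw1: "1 \<le> tw y" for y
    using \<beta> N by (auto simp: tw_def truncated_weight_def intro!: ge_one_powr_ge_zero)
  have tw_le: "tw y \<le> \<phi> y" for y
    using \<beta> N by (auto simp: tw_def truncated_weight_def \<phi>_def intro!: powr_mono2)
  have D0: "0 \<le> D" using D[of 0] by (meson abs_ge_zero mult_nonneg_nonneg order_trans powr_ge_zero)
  have [measurable]: "tw \<in> borel_measurable borel"
    unfolding tw_def truncated_weight_def[abs_def] by measurable
  have i: "integrable lborel (\<lambda>y. exp (- \<bar>x - y\<bar>) / tw y)"
  proof (rule Bochner_Integration.integrable_bound[OF integrable_exp_neg_abs_diff])
    show "AE y in lborel. norm (exp (- \<bar>x - y\<bar>) / tw y) \<le> norm (exp (- \<bar>x - y\<bar>))"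
    proof (rule AE_I2)
      fix y
      have "exp (- \<bar>x - y\<bar>) / tw y \<le> exp (- \<bar>x - y\<bar>) / 1"
        using tw1[of y] by (intro divide_left_mono) auto
      then show "norm (exp (- \<bar>x - y\<bar>) / tw y) \<le> norm (exp (- \<bar>x - y\<bar>))"
        using tw1[of y] by simp
    qed
  qed measurable
  have w: "\<bar>f y - f2 y\<bar> \<le> D / tw y" for y
  proof -
    have "\<bar>f y - f2 y\<bar> * tw y \<le> \<bar>f y - f2 y\<bar> * \<phi> y" by (rule mult_left_mono[OF tw_le]) simp
    also have "\<dots> \<le> D" using D by (simp add: \<phi>_def)
    finally show ?thesis using tw1[of y] by (simp add: field_simps)
  qed
  have wi: "integrable lborel (\<lambda>y. exp (- \<bar>x - y\<bar>) * (D / tw y))"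
    using integrable_mult_right[OF i, of D] by (simp add: field_simps)
  have "(LINT y|lborel. exp (- \<bar>x - y\<bar>) * (D / tw y)) = (LINT y|lborel. D * (exp (- \<bar>x - y\<bar>) / tw y))"
    by (simp add: field_simps)
  also have "\<dots> = D * (LINT y|lborel. exp (- \<bar>x - y\<bar>) / tw y)" by (rule integral_mult_right_zero)
  finally have I: "(LINT y|lborel. exp (- \<bar>x - y\<bar>) * (D / tw y)) * \<phi> x = D * (tw x * (LINT y|lborel. exp (- \<bar>x - y\<bar>) / tw y))"
    by (simp add: N(2))
  have "tw x * (LINT y|lborel. exp (- \<bar>x - y\<bar>) / tw y) \<le> C"
    using C N(1) by (auto simp: is_weight_constant_def tw_def)
  then have I': "(LINT y|lborel. exp (- \<bar>x - y\<bar>) * (D / tw y)) * \<phi> x \<le> D * C"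
    unfolding I by (rule mult_left_mono[OF _ D0])
  have \<phi>0: "0 \<le> \<phi> x" by (simp add: \<phi>_def)
  note hb = helmholtz_bound[OF f bd w wi]
  show 1: "\<bar>f x\<bar> * weight \<beta> x \<le> D * C" "\<bar>f1 x\<bar> * weight \<beta> x \<le> D * C"
    using mult_right_mono[OF hb(1) \<phi>0] mult_right_mono[OF hb(2) \<phi>0] I' by (auto simp: \<phi>_def)
  have "\<bar>f2 x\<bar> \<le> \<bar>f x\<bar> + \<bar>f x - f2 x\<bar>" by linarith
  then have "\<bar>f2 x\<bar> * \<phi> x \<le> (\<bar>f x\<bar> + \<bar>f x - f2 x\<bar>) * \<phi> x" using \<phi>0 by (rule mult_right_mono)
  then show "\<bar>f2 x\<bar> * weight \<beta> x \<le> D * C + D"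
    using 1(1) D[of x] by (simp add: \<phi>_def distrib_right)
qed

section \<open>A priori estimates for the solution on a short time interval\<close>

lemma weak_deriv_twice_AE_eq:
  assumes f: "f \<in> borel_measurable borel" "AE x in lborel. f x = F x"
    and F: "\<And>x. DERIV F x :> F1 x" "\<And>x. DERIV F1 x :> F2 x" "continuous_on UNIV F2"
  shows "AE x in lborel. weak_deriv f x = F1 x" "weak_deriv f \<in> borel_measurable borel"
    "AE x in lborel. weak_deriv (weak_deriv f) x = F2 x" "weak_deriv (weak_deriv f) \<in> borel_measurable borel"
proof -
  have F1: "continuous_on UNIV F1" using F(2) by (meson DERIV_isCont continuous_at_imp_continuous_on)
  show 1: "AE x in lborel. weak_deriv f x = F1 x" "weak_deriv f \<in> borel_measurable borel"
    using weak_deriv_AE_eq[OF f F(1) F1] by auto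
  show "AE x in lborel. weak_deriv (weak_deriv f) x = F2 x" "weak_deriv (weak_deriv f) \<in> borel_measurable borel"
    using weak_deriv_AE_eq[OF 1(2,1) F(2,3)] by auto
qed

text \<open>The factors are those of the general bound 4 C + 2 D. For \<rho> the source is
  proportional to \<rho> itself, so D = 0 and the factor is 4. With D = 4 C from \<rho>, data
  bounded by C give 12 C for \<rho>_x, and data bounded by 2 C, as for a difference of two weighted
  terms, give 16 C for the momenta.\<close>

lemma solution_weighted_estimate:
  assumes s: "s > 5 / 2" and \<beta>: "0 < \<beta>" and T: "0 < T" and sol: "is_solution s T \<rho>0 u0 v0 \<rho> u v"
  obtains P0 P1 U0 U1 U2 V0 V1 V2 :: "real \<Rightarrow> real \<Rightarrow> real" and t0 B :: real where
    "0 < t0" "ereal t0 < T"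
    "\<And>t. t \<in> {0..t0} \<Longrightarrow> \<rho> t \<in> borel_measurable borel" "\<And>t. t \<in> {0..t0} \<Longrightarrow> AE x in lborel. \<rho> t x = P0 t x"
    "\<And>t x. t \<in> {0..t0} \<Longrightarrow> DERIV (P0 t) x :> P1 t x" "\<And>t. t \<in> {0..t0} \<Longrightarrow> continuous_on UNIV (P1 t)"
    "\<And>t. t \<in> {0..t0} \<Longrightarrow> u t \<in> borel_measurable borel" "\<And>t. t \<in> {0..t0} \<Longrightarrow> AE x in lborel. u t x = U0 t x"
    "\<And>t x. t \<in> {0..t0} \<Longrightarrow> DERIV (U0 t) x :> U1 t x" "\<And>t x. t \<in> {0..t0} \<Longrightarrow> DERIV (U1 t) x :> U2 t x"
    "\<And>t. t \<in> {0..t0} \<Longrightarrow> continuous_on UNIV (U2 t)"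
    "\<And>t. t \<in> {0..t0} \<Longrightarrow> v t \<in> borel_measurable borel" "\<And>t. t \<in> {0..t0} \<Longrightarrow> AE x in lborel. v t x = V0 t x"
    "\<And>t x. t \<in> {0..t0} \<Longrightarrow> DERIV (V0 t) x :> V1 t x" "\<And>t x. t \<in> {0..t0} \<Longrightarrow> DERIV (V1 t) x :> V2 t x"
    "\<And>t. t \<in> {0..t0} \<Longrightarrow> continuous_on UNIV (V2 t)"
    "\<And>t x. t \<in> {0..t0} \<Longrightarrow> \<bar>U0 t x\<bar> \<le> B \<and> \<bar>U1 t x\<bar> \<le> B \<and> \<bar>V0 t x\<bar> \<le> B \<and> \<bar>V1 t x\<bar> \<le> B"
    "\<And>C t x. (\<And>x. \<bar>P0 0 x\<bar> * weight \<beta> x \<le> C) \<Longrightarrow> t \<in> {0..t0} \<Longrightarrow>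
      \<bar>P0 t x\<bar> * weight \<beta> x \<le> 4 * C"
    "\<And>C t x. (\<And>x. \<bar>P0 0 x\<bar> * weight \<beta> x \<le> C) \<Longrightarrow> (\<And>x. \<bar>P1 0 x\<bar> * weight \<beta> x \<le> C) \<Longrightarrow>
      t \<in> {0..t0} \<Longrightarrow> \<bar>P1 t x\<bar> * weight \<beta> x \<le> 12 * C"
    "\<And>C t x. (\<And>x. \<bar>P0 0 x\<bar> * weight \<beta> x \<le> C) \<Longrightarrow>
      (\<And>x. \<bar>U0 0 x - U2 0 x\<bar> * weight \<beta> x \<le> 2 * C) \<Longrightarrow>
      t \<in> {0..t0} \<Longrightarrow> \<bar>U0 t x - U2 t x\<bar> * weight \<beta> x \<le> 16 * C"
    "\<And>C t x. (\<And>x. \<bar>P0 0 x\<bar> * weight \<beta> x \<le> C) \<Longrightarrow>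
      (\<And>x. \<bar>V0 0 x - V2 0 x\<bar> * weight \<beta> x \<le> 2 * C) \<Longrightarrow>
      t \<in> {0..t0} \<Longrightarrow> \<bar>V0 t x - V2 t x\<bar> * weight \<beta> x \<le> 16 * C"
proof -
  let ?I = "time_interval T"
  \<comment> \<open>s - 1 > 1 + 1/2 gives one continuous derivative of \<rho>, and s > 2 + 1/2 gives
    two of u and of v.\<close>
  obtain P \<delta>1 B1 where P: "\<And>t. t \<in> ?I \<Longrightarrow> \<rho> t \<in> borel_measurable borel"
    "\<And>t. t \<in> ?I \<Longrightarrow> AE x in lborel. \<rho> t x = P 0 t x"
    "\<And>t j x. t \<in> ?I \<Longrightarrow> j < 1 \<Longrightarrow> DERIV (P j t) x :> P (Suc j) t x"
    "\<And>j. j \<le> 1 \<Longrightarrow> continuous_on (?I \<times> UNIV) (\<lambda>(t, x). P j t x)"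
    "0 < \<delta>1" "ereal \<delta>1 < T" "\<And>t j x. t \<in> {0..\<delta>1} \<Longrightarrow> j \<le> 1 \<Longrightarrow> \<bar>P j t x\<bar> \<le> B1"
    by (rule continuous_in_sobolev_representative[of 1 "s - 1" T \<rho>]) (use s T sol in \<open>auto simp: is_solution_def\<close>)
  obtain U \<delta>2 B2 where U: "\<And>t. t \<in> ?I \<Longrightarrow> u t \<in> borel_measurable borel"
    "\<And>t. t \<in> ?I \<Longrightarrow> AE x in lborel. u t x = U 0 t x"
    "\<And>t j x. t \<in> ?I \<Longrightarrow> j < 2 \<Longrightarrow> DERIV (U j t) x :> U (Suc j) t x"
    "\<And>j. j \<le> 2 \<Longrightarrow> continuous_on (?I \<times> UNIV) (\<lambda>(t, x). U j t x)"
    "0 < \<delta>2" "ereal \<delta>2 < T" "\<And>t j x. t \<in> {0..\<delta>2} \<Longrightarrow> j \<le> 2 \<Longrightarrow> \<bar>U j t x\<bar> \<le> B2"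
    by (rule continuous_in_sobolev_representative[of 2 s T u]) (use s T sol in \<open>auto simp: is_solution_def\<close>)
  obtain V \<delta>3 B3 where V: "\<And>t. t \<in> ?I \<Longrightarrow> v t \<in> borel_measurable borel"
    "\<And>t. t \<in> ?I \<Longrightarrow> AE x in lborel. v t x = V 0 t x"
    "\<And>t j x. t \<in> ?I \<Longrightarrow> j < 2 \<Longrightarrow> DERIV (V j t) x :> V (Suc j) t x"
    "\<And>j. j \<le> 2 \<Longrightarrow> continuous_on (?I \<times> UNIV) (\<lambda>(t, x). V j t x)"
    "0 < \<delta>3" "ereal \<delta>3 < T" "\<And>t j x. t \<in> {0..\<delta>3} \<Longrightarrow> j \<le> 2 \<Longrightarrow> \<bar>V j t x\<bar> \<le> B3"
    by (rule continuous_in_sobolev_representative[of 2 s T v]) (use s T sol in \<open>auto simp: is_solution_def\<close>)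
  define P0 P1 U0 U1 U2 V0 V1 V2 where "P0 = P 0" "P1 = P 1" "U0 = U 0" "U1 = U 1" "U2 = U 2"
    "V0 = V 0" "V1 = V 1" "V2 = V 2"
  note defs = this
  have D: "DERIV (P0 t) x :> P1 t x" "DERIV (U0 t) x :> U1 t x" "DERIV (U1 t) x :> U2 t x"
    "DERIV (V0 t) x :> V1 t x" "DERIV (V1 t) x :> V2 t x" if "t \<in> ?I" for t x
    using P(3)[OF that, of 0 x] U(3)[OF that, of 0 x] U(3)[OF that, of 1 x] V(3)[OF that, of 0 x] V(3)[OF that, of 1 x]
    by (simp_all add: defs numeral_2_eq_2)
  have c: "continuous_on (?I \<times> UNIV) (\<lambda>p. P0 (fst p) (snd p))" "continuous_on (?I \<times> UNIV) (\<lambda>p. P1 (fst p) (snd p))"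
    "continuous_on (?I \<times> UNIV) (\<lambda>p. U0 (fst p) (snd p))" "continuous_on (?I \<times> UNIV) (\<lambda>p. U1 (fst p) (snd p))"
    "continuous_on (?I \<times> UNIV) (\<lambda>p. U2 (fst p) (snd p))"
    "continuous_on (?I \<times> UNIV) (\<lambda>p. V0 (fst p) (snd p))" "continuous_on (?I \<times> UNIV) (\<lambda>p. V1 (fst p) (snd p))"
    "continuous_on (?I \<times> UNIV) (\<lambda>p. V2 (fst p) (snd p))"
    using P(4)[of 0] P(4)[of 1] U(4)[of 0] U(4)[of 1] U(4)[of 2] V(4)[of 0] V(4)[of 1] V(4)[of 2]
    by (simp_all add: defs case_prod_unfold)
  define B where "B = max 1 (max B1 (max B2 B3))"
  have B: "1 \<le> B" "B1 \<le> B" "B2 \<le> B" "B3 \<le> B" by (auto simp: B_def)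
  \<comment> \<open>The velocity is at most B^2. The second entry makes B^2 t0 \<le> 1/8, so that 4
    B^2 t0 \<le> 1/2 for the largest growth rate 4 B^2 occurring below, and \<beta> B^2 t0 \<le>
    1/8, so that the weight changes at most by the factor 2 along a characteristic.\<close>
  define t0 where "t0 = min (min \<delta>1 (min \<delta>2 \<delta>3)) (1 / (8 * B\<^sup>2 * (1 + \<beta>)))"
  have t0: "0 < t0" "t0 \<le> \<delta>1" "t0 \<le> \<delta>2" "t0 \<le> \<delta>3" using P(5) U(5) V(5) B \<beta> by (auto simp: t0_def)
  have "t0 \<le> 1 / (8 * B\<^sup>2 * (1 + \<beta>))" by (simp add: t0_def)
  then have t0B: "8 * (B\<^sup>2 * t0) + 8 * (\<beta> * (B\<^sup>2 * t0)) \<le> 1"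
  proof -
    have "0 < 8 * B\<^sup>2 * (1 + \<beta>)" using B \<beta> by simp
    then have "t0 * (8 * B\<^sup>2 * (1 + \<beta>)) \<le> 1"
      using \<open>t0 \<le> 1 / (8 * B\<^sup>2 * (1 + \<beta>))\<close> by (simp only: pos_le_divide_eq)
    then show ?thesis by (simp add: algebra_simps)
  qed
  have "0 \<le> B\<^sup>2 * t0" "0 \<le> \<beta> * (B\<^sup>2 * t0)" using t0 \<beta> by auto
  with t0B have small: "B\<^sup>2 * t0 \<le> 1 / 8" "\<beta> * (B\<^sup>2 * t0) \<le> 1 / 8" by linarith+
  have t0T: "ereal t0 < T" using t0(2) P(6) by (meson ereal_less_eq(3) le_less_trans)
  have sub: "{0..t0} \<subseteq> ?I"
    using t0T by (auto simp: time_interval_def) (metis ereal_less_eq(3) le_less_trans)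
  have z: "0 \<in> ?I" using sub t0(1) by auto
  have Pb: "\<bar>P j t x\<bar> \<le> B" if "t \<in> {0..t0}" "j \<le> 1" for t j x
    using P(7)[of t j x] that t0(2) B(2) by simp
  have Ub: "\<bar>U j t x\<bar> \<le> B" if "t \<in> {0..t0}" "j \<le> 2" for t j x
    using U(7)[of t j x] that t0(3) B(3) by simp
  have Vb: "\<bar>V j t x\<bar> \<le> B" if "t \<in> {0..t0}" "j \<le> 2" for t j x
    using V(7)[of t j x] that t0(4) B(4) by simp
  have bd: "\<bar>P0 t x\<bar> \<le> B" "\<bar>P1 t x\<bar> \<le> B" "\<bar>U0 t x\<bar> \<le> B" "\<bar>U1 t x\<bar> \<le> B" "\<bar>U2 t x\<bar> \<le> B"
    "\<bar>V0 t x\<bar> \<le> B" "\<bar>V1 t x\<bar> \<le> B" "\<bar>V2 t x\<bar> \<le> B" if "t \<in> {0..t0}" for t x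
    unfolding defs by (rule Pb Ub Vb; use that in simp)+
  have cx: "continuous_on UNIV (P1 t)" "continuous_on UNIV (U2 t)" "continuous_on UNIV (V2 t)" if "t \<in> ?I" for t
    using continuous_on_pair_compose[OF P(4)[of 1], of UNIV "\<lambda>x. t" "\<lambda>x. x"]
      continuous_on_pair_compose[OF U(4)[of 2], of UNIV "\<lambda>x. t" "\<lambda>x. x"]
      continuous_on_pair_compose[OF V(4)[of 2], of UNIV "\<lambda>x. t" "\<lambda>x. x"] that by (auto simp: defs)
  have mul: "\<bar>p * q\<bar> \<le> b * d" if "\<bar>p\<bar> \<le> b" "\<bar>q\<bar> \<le> d" for p q b d :: real
    unfolding abs_mult using that by (intro mult_mono) (auto intro: order_trans[OF abs_ge_zero])
  define a where "a t x = U0 t x * V0 t x" for t x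
  define ax where "ax t x = U1 t x * V0 t x + U0 t x * V1 t x" for t x
  define axx where "axx t x = U2 t x * V0 t x + 2 * (U1 t x * V1 t x) + U0 t x * V2 t x" for t x
  define M where "M t x = U0 t x - U2 t x" for t x
  define N where "N t x = V0 t x - V2 t x" for t x
  \<comment> \<open>The law for m is in divergence form with flux a m, so its source contains -a_x
    m; along a characteristic this cancels the a_x m produced by the flux, and 3 v u_x m + \<rho>^2
    u remains.\<close>
  define gM where "gM t x = - ax t x * M t x + 3 * V0 t x * U1 t x * M t x + (P0 t x)\<^sup>2 * U0 t x" for t x
  define gN where "gN t x = - ax t x * N t x + 3 * V1 t x * U0 t x * N t x - (P0 t x)\<^sup>2 * V0 t x" for t x
  \<comment> \<open>gP is (a_x \<rho>)_x: differentiating the equation of \<rho> gives (a \<rho>)_xx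
    = (a \<rho>_x)_x + (a_x \<rho>)_x, where the first term is the flux of \<rho>_x.\<close>
  define gP where "gP t x = axx t x * P0 t x + ax t x * P1 t x" for t x
  have a': "DERIV (a t) x :> ax t x" "DERIV (ax t) x :> axx t x" if "t \<in> ?I" for t x
    unfolding a_def ax_def axx_def by (auto intro!: derivative_eq_intros D that)
  note cont_defs = a_def ax_def axx_def M_def N_def gM_def gN_def gP_def
  have c2: "continuous_on (?I \<times> UNIV) (\<lambda>(t, x). a t x)" "continuous_on (?I \<times> UNIV) (\<lambda>(t, x). ax t x)"
    "continuous_on (?I \<times> UNIV) (\<lambda>(t, x). P0 t x)" "continuous_on (?I \<times> UNIV) (\<lambda>(t, x). P1 t x)"
    "continuous_on (?I \<times> UNIV) (\<lambda>(t, x). M t x)" "continuous_on (?I \<times> UNIV) (\<lambda>(t, x). N t x)"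
    "continuous_on (?I \<times> UNIV) (\<lambda>(t, x). gM t x)" "continuous_on (?I \<times> UNIV) (\<lambda>(t, x). gN t x)"
    "continuous_on (?I \<times> UNIV) (\<lambda>(t, x). gP t x)"
    "continuous_on (?I \<times> UNIV) (\<lambda>(t, x). a t x * P0 t x)" "continuous_on (?I \<times> UNIV) (\<lambda>(t, x). a t x * M t x)"
    "continuous_on (?I \<times> UNIV) (\<lambda>(t, x). a t x * N t x)"
    "continuous_on (?I \<times> UNIV) (\<lambda>(t, x). ax t x * P0 t x + a t x * P1 t x)"
    unfolding cont_defs case_prod_unfold by (intro continuous_intros c)+
  have restr: "continuous_on ({0..t} \<times> UNIV) f" if "continuous_on (?I \<times> UNIV) f" "t \<le> t0" for f :: "real \<times> real \<Rightarrow> real" and t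
    by (rule continuous_on_subset[OF that(1)]) (use sub that(2) in auto)
  have ab: "\<bar>a t x\<bar> \<le> B\<^sup>2" "\<bar>ax t x\<bar> \<le> 2 * B\<^sup>2" "\<bar>axx t x\<bar> \<le> 4 * B\<^sup>2" "\<bar>M t x\<bar> \<le> 2 * B" "\<bar>N t x\<bar> \<le> 2 * B"
    "\<bar>V0 t x * U1 t x\<bar> \<le> B\<^sup>2" "\<bar>V1 t x * U0 t x\<bar> \<le> B\<^sup>2" "\<bar>P0 t x * U0 t x\<bar> \<le> B\<^sup>2" "\<bar>P0 t x * V0 t x\<bar> \<le> B\<^sup>2" if t: "t \<in> {0..t0}" for t x
  proof -
    note m = mul[where b=B and d=B, folded power2_eq_square]
    have "\<bar>U1 t x * V0 t x\<bar> \<le> B\<^sup>2" "\<bar>U0 t x * V1 t x\<bar> \<le> B\<^sup>2" "\<bar>U2 t x * V0 t x\<bar> \<le> B\<^sup>2" "\<bar>U1 t x * V1 t x\<bar> \<le> B\<^sup>2"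
      "\<bar>U0 t x * V2 t x\<bar> \<le> B\<^sup>2" "\<bar>U0 t x * V0 t x\<bar> \<le> B\<^sup>2" using bd[OF t] by (auto intro!: m)
    then show "\<bar>a t x\<bar> \<le> B\<^sup>2" "\<bar>ax t x\<bar> \<le> 2 * B\<^sup>2" "\<bar>axx t x\<bar> \<le> 4 * B\<^sup>2" unfolding cont_defs by linarith+
    show "\<bar>M t x\<bar> \<le> 2 * B" "\<bar>N t x\<bar> \<le> 2 * B" using bd[OF t, of x] unfolding cont_defs by linarith+
    show "\<bar>V0 t x * U1 t x\<bar> \<le> B\<^sup>2" "\<bar>V1 t x * U0 t x\<bar> \<le> B\<^sup>2" "\<bar>P0 t x * U0 t x\<bar> \<le> B\<^sup>2" "\<bar>P0 t x * V0 t x\<bar> \<le> B\<^sup>2"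
      using bd[OF t] by (auto intro!: m)
  qed
  have wu: "AE x in lborel. weak_deriv (u t) x = U1 t x" "weak_deriv (u t) \<in> borel_measurable borel"
    "AE x in lborel. weak_deriv (weak_deriv (u t)) x = U2 t x" "weak_deriv (weak_deriv (u t)) \<in> borel_measurable borel"
    if "t \<in> ?I" for t
    using weak_deriv_twice_AE_eq[OF U(1,2)[OF that], folded defs, OF D(2,3)[OF that] cx(2)[OF that]] by auto
  have wv: "AE x in lborel. weak_deriv (v t) x = V1 t x" "weak_deriv (v t) \<in> borel_measurable borel"
    "AE x in lborel. weak_deriv (weak_deriv (v t)) x = V2 t x" "weak_deriv (weak_deriv (v t)) \<in> borel_measurable borel"
    if "t \<in> ?I" for t
    using weak_deriv_twice_AE_eq[OF V(1,2)[OF that], folded defs, OF D(4,5)[OF that] cx(3)[OF that]] by auto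
  have AEu: "AE x in lborel. u t x = U0 t x" and AEv: "AE x in lborel. v t x = V0 t x"
    and AEr: "AE x in lborel. \<rho> t x = P0 t x" if "t \<in> ?I" for t
    using U(2)[OF that] V(2)[OF that] P(2)[OF that] by (simp_all add: defs)
  have wuv: "AE x in lborel. weak_deriv (\<lambda>y. u t y * v t y) x = ax t x"
    "weak_deriv (\<lambda>y. u t y * v t y) \<in> borel_measurable borel" if t: "t \<in> ?I" for t
  proof -
    note [measurable] = U(1)[OF t] V(1)[OF t]
    have 1: "(\<lambda>y. u t y * v t y) \<in> borel_measurable borel" by measurable
    have 2: "AE x in lborel. u t x * v t x = a t x"
      using AEu[OF t] AEv[OF t] by eventually_elim (simp add: a_def)
    have 3: "continuous_on UNIV (ax t)"
      using a'(2)[OF t] by (meson DERIV_isCont continuous_at_imp_continuous_on)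
    show "AE x in lborel. weak_deriv (\<lambda>y. u t y * v t y) x = ax t x"
      "weak_deriv (\<lambda>y. u t y * v t y) \<in> borel_measurable borel"
      using weak_deriv_AE_eq[OF 1 2 a'(1)[OF t] 3] by auto
  qed
  have mom: "AE x in lborel. momentum u t x = M t x" "AE x in lborel. momentum v t x = N t x"
    "momentum u t \<in> borel_measurable borel" "momentum v t \<in> borel_measurable borel" if t: "t \<in> ?I" for t
  proof -
    show "AE x in lborel. momentum u t x = M t x"
      using AEu[OF t] wu(3)[OF t] by eventually_elim (simp add: momentum_def M_def)
    show "AE x in lborel. momentum v t x = N t x"
      using AEv[OF t] wv(3)[OF t] by eventually_elim (simp add: momentum_def N_def)
    note [measurable] = U(1)[OF t] V(1)[OF t] wu(4)[OF t] wv(4)[OF t]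
    show "momentum u t \<in> borel_measurable borel" "momentum v t \<in> borel_measurable borel"
      unfolding momentum_def[abs_def] by measurable
  qed
  have lawP: "integral {x1..x2} (\<lambda>x. P0 t x - P0 0 x) =
      - integral {0..t} (\<lambda>\<tau>. a \<tau> x2 * P0 \<tau> x2 - a \<tau> x1 * P0 \<tau> x1 + integral {x1..x2} (\<lambda>x. 0))"
    if t: "t \<in> {0..t0}" and x: "x1 < x2" for t x1 x2
  proof (rule weak_balance_law_integrated[where Q=P0 and F="\<lambda>t x. a t x * P0 t x" and G="\<lambda>t x. 0"])
    show "weak_balance_law T \<rho> (\<lambda>t x. \<rho> t x * u t x * v t x) (\<lambda>t x. 0)" using sol by (simp add: is_solution_def)
    show "AE x in lborel. \<rho> t x * u t x * v t x = a t x * P0 t x" if "t \<in> ?I" for t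
      using AEu[OF that] AEv[OF that] AEr[OF that] by eventually_elim (simp add: a_def)
    show "(\<lambda>x. \<rho> t x * u t x * v t x) \<in> borel_measurable borel" if "t \<in> ?I" for t
    proof -
      note [measurable] = U(1)[OF that] V(1)[OF that] P(1)[OF that]
      show ?thesis by measurable
    qed
  qed (use t x sub P(1) AEr c2 in \<open>auto simp: case_prod_unfold\<close>)
  have lawM: "integral {x1..x2} (\<lambda>x. M t x - M 0 x) =
      - integral {0..t} (\<lambda>\<tau>. a \<tau> x2 * M \<tau> x2 - a \<tau> x1 * M \<tau> x1 + integral {x1..x2} (gM \<tau>))"
    if t: "t \<in> {0..t0}" and x: "x1 < x2" for t x1 x2
  proof (rule weak_balance_law_integrated[where Q=M and F="\<lambda>t x. a t x * M t x" and G=gM])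
    show "weak_balance_law T (momentum u) (\<lambda>t x. u t x * v t x * momentum u t x)
       (\<lambda>t x. - weak_deriv (\<lambda>y. u t y * v t y) x * momentum u t x
              + 3 * v t x * weak_deriv (u t) x * momentum u t x + (\<rho> t x)\<^sup>2 * u t x)" using sol by (simp add: is_solution_def)
    show "AE x in lborel. u t x * v t x * momentum u t x = a t x * M t x" if "t \<in> ?I" for t
      using AEu[OF that] AEv[OF that] mom(1)[OF that] by eventually_elim (simp add: a_def)
    show "AE x in lborel. - weak_deriv (\<lambda>y. u t y * v t y) x * momentum u t x
              + 3 * v t x * weak_deriv (u t) x * momentum u t x + (\<rho> t x)\<^sup>2 * u t x = gM t x" if "t \<in> ?I" for t
      using AEu[OF that] AEv[OF that] AEr[OF that] mom(1)[OF that] wuv(1)[OF that] wu(1)[OF that]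
      by eventually_elim (simp add: gM_def)
    show "(\<lambda>x. u t x * v t x * momentum u t x) \<in> borel_measurable borel"
      "(\<lambda>x. - weak_deriv (\<lambda>y. u t y * v t y) x * momentum u t x
              + 3 * v t x * weak_deriv (u t) x * momentum u t x + (\<rho> t x)\<^sup>2 * u t x) \<in> borel_measurable borel"
      if "t \<in> ?I" for t
    proof -
      note [measurable] = U(1)[OF that] V(1)[OF that] P(1)[OF that] mom(3)[OF that] wuv(2)[OF that] wu(2)[OF that]
      show "(\<lambda>x. u t x * v t x * momentum u t x) \<in> borel_measurable borel"
        "(\<lambda>x. - weak_deriv (\<lambda>y. u t y * v t y) x * momentum u t x
              + 3 * v t x * weak_deriv (u t) x * momentum u t x + (\<rho> t x)\<^sup>2 * u t x) \<in> borel_measurable borel"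
        by measurable
    qed
  qed (use t x sub mom c2 in auto)
  have lawN: "integral {x1..x2} (\<lambda>x. N t x - N 0 x) =
      - integral {0..t} (\<lambda>\<tau>. a \<tau> x2 * N \<tau> x2 - a \<tau> x1 * N \<tau> x1 + integral {x1..x2} (gN \<tau>))"
    if t: "t \<in> {0..t0}" and x: "x1 < x2" for t x1 x2
  proof (rule weak_balance_law_integrated[where Q=N and F="\<lambda>t x. a t x * N t x" and G=gN])
    show "weak_balance_law T (momentum v) (\<lambda>t x. u t x * v t x * momentum v t x)
       (\<lambda>t x. - weak_deriv (\<lambda>y. u t y * v t y) x * momentum v t x
              + 3 * weak_deriv (v t) x * u t x * momentum v t x - (\<rho> t x)\<^sup>2 * v t x)" using sol by (simp add: is_solution_def)
    show "AE x in lborel. u t x * v t x * momentum v t x = a t x * N t x" if "t \<in> ?I" for t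
      using AEu[OF that] AEv[OF that] mom(2)[OF that] by eventually_elim (simp add: a_def)
    show "AE x in lborel. - weak_deriv (\<lambda>y. u t y * v t y) x * momentum v t x
              + 3 * weak_deriv (v t) x * u t x * momentum v t x - (\<rho> t x)\<^sup>2 * v t x = gN t x" if "t \<in> ?I" for t
      using AEu[OF that] AEv[OF that] AEr[OF that] mom(2)[OF that] wuv(1)[OF that] wv(1)[OF that]
      by eventually_elim (simp add: gN_def)
    show "(\<lambda>x. u t x * v t x * momentum v t x) \<in> borel_measurable borel"
      "(\<lambda>x. - weak_deriv (\<lambda>y. u t y * v t y) x * momentum v t x
              + 3 * weak_deriv (v t) x * u t x * momentum v t x - (\<rho> t x)\<^sup>2 * v t x) \<in> borel_measurable borel"
      if "t \<in> ?I" for t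
    proof -
      note [measurable] = U(1)[OF that] V(1)[OF that] P(1)[OF that] mom(4)[OF that] wuv(2)[OF that] wv(2)[OF that]
      show "(\<lambda>x. u t x * v t x * momentum v t x) \<in> borel_measurable borel"
        "(\<lambda>x. - weak_deriv (\<lambda>y. u t y * v t y) x * momentum v t x
              + 3 * weak_deriv (v t) x * u t x * momentum v t x - (\<rho> t x)\<^sup>2 * v t x) \<in> borel_measurable borel"
        by measurable
    qed
  qed (use t x sub mom c2 in auto)
  have pw: "P0 t x - P0 0 x = - integral {0..t} (\<lambda>\<tau>. ax \<tau> x * P0 \<tau> x + a \<tau> x * P1 \<tau> x)"
    if t: "t \<in> {0..t0}" for t x
  proof (rule conservation_law_pointwise[where F="\<lambda>t x. a t x * P0 t x"])
    show "DERIV (\<lambda>x. a \<tau> x * P0 \<tau> x) x :> ax \<tau> x * P0 \<tau> x + a \<tau> x * P1 \<tau> x" if "\<tau> \<in> {0..t}" for \<tau> x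
    proof -
      have "\<tau> \<in> ?I" using that t sub by auto
      then show ?thesis using DERIV_mult[OF a'(1) D(1), of \<tau> \<tau> x] by (simp add: ac_simps)
    qed
    show "integral {x1..x2} (\<lambda>x. P0 t x - P0 0 x) = - integral {0..t} (\<lambda>\<tau>. a \<tau> x2 * P0 \<tau> x2 - a \<tau> x1 * P0 \<tau> x1)"
      if "x1 < x2" for x1 x2 using lawP[OF t that] by simp
  qed (use t c2 in \<open>auto intro!: restr\<close>)
  \<comment> \<open>\<rho>_x need not be differentiable in x. Instead the pointwise law for \<rho>
    at x2 and at x1 is subtracted, and the differences of \<rho> and of a_x \<rho> are rewritten as
    integrals over [x1, x2].\<close>
  have lawP1: "integral {x1..x2} (\<lambda>x. P1 t x - P1 0 x) =
      - integral {0..t} (\<lambda>\<tau>. a \<tau> x2 * P1 \<tau> x2 - a \<tau> x1 * P1 \<tau> x1 + integral {x1..x2} (gP \<tau>))"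
    if t: "t \<in> {0..t0}" and x: "x1 < x2" for t x1 x2
  proof -
    have tI: "t \<in> ?I" using t sub by auto
    have "((\<lambda>x. P1 t x - P1 0 x) has_integral (P0 t x2 - P0 0 x2) - (P0 t x1 - P0 0 x1)) {x1..x2}"
    proof (rule fundamental_theorem_of_calculus)
      show "((\<lambda>x. P0 t x - P0 0 x) has_vector_derivative P1 t y - P1 0 y) (at y within {x1..x2})" for y
        using DERIV_diff[OF D(1)[OF tI] D(1)[OF z], of y]
        by (auto simp: has_real_derivative_iff_has_vector_derivative[symmetric] intro: has_field_derivative_at_within)
    qed (use x in simp)
    then have "integral {x1..x2} (\<lambda>x. P1 t x - P1 0 x) = (P0 t x2 - P0 0 x2) - (P0 t x1 - P0 0 x1)"
      by (rule integral_unique)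
    also have "\<dots> = - (integral {0..t} (\<lambda>\<tau>. ax \<tau> x2 * P0 \<tau> x2 + a \<tau> x2 * P1 \<tau> x2)
        - integral {0..t} (\<lambda>\<tau>. ax \<tau> x1 * P0 \<tau> x1 + a \<tau> x1 * P1 \<tau> x1))"
      by (simp add: pw[OF t])
    also have "\<dots> = - integral {0..t} (\<lambda>\<tau>. (ax \<tau> x2 * P0 \<tau> x2 + a \<tau> x2 * P1 \<tau> x2) - (ax \<tau> x1 * P0 \<tau> x1 + a \<tau> x1 * P1 \<tau> x1))"
    proof -
      have "(\<lambda>\<tau>. ax \<tau> y * P0 \<tau> y + a \<tau> y * P1 \<tau> y) integrable_on {0..t}" for y
        by (rule integrable_continuous_real, rule continuous_on_pair_compose[OF restr[OF c2(13)]])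
          (use t in \<open>auto intro!: continuous_intros\<close>)
      then show ?thesis by (simp only: Henstock_Kurzweil_Integration.integral_diff)
    qed
    also have "integral {0..t} (\<lambda>\<tau>. (ax \<tau> x2 * P0 \<tau> x2 + a \<tau> x2 * P1 \<tau> x2) - (ax \<tau> x1 * P0 \<tau> x1 + a \<tau> x1 * P1 \<tau> x1))
      = integral {0..t} (\<lambda>\<tau>. a \<tau> x2 * P1 \<tau> x2 - a \<tau> x1 * P1 \<tau> x1 + integral {x1..x2} (gP \<tau>))"
    proof (rule integral_cong)
      fix \<tau> assume "\<tau> \<in> {0..t}"
      then have \<tau>: "\<tau> \<in> ?I" using t sub by auto
      have "(gP \<tau> has_integral ax \<tau> x2 * P0 \<tau> x2 - ax \<tau> x1 * P0 \<tau> x1) {x1..x2}"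
      proof (rule fundamental_theorem_of_calculus)
        show "((\<lambda>x. ax \<tau> x * P0 \<tau> x) has_vector_derivative gP \<tau> y) (at y within {x1..x2})" for y
          using DERIV_mult[OF a'(2)[OF \<tau>] D(1)[OF \<tau>], of y]
          by (auto simp: gP_def ac_simps has_real_derivative_iff_has_vector_derivative[symmetric] intro: has_field_derivative_at_within)
      qed (use x in simp)
      then show "(ax \<tau> x2 * P0 \<tau> x2 + a \<tau> x2 * P1 \<tau> x2) - (ax \<tau> x1 * P0 \<tau> x1 + a \<tau> x1 * P1 \<tau> x1)
         = a \<tau> x2 * P1 \<tau> x2 - a \<tau> x1 * P1 \<tau> x1 + integral {x1..x2} (gP \<tau>)"
        by (simp add: integral_unique)
    qed
    finally show ?thesis .
  qed
  define \<phi> where "\<phi> x = weight \<beta> x" for x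
  have \<phi>: "0 < \<phi> x" "\<bar>x - y\<bar> \<le> B\<^sup>2 * t0 \<Longrightarrow> \<phi> x \<le> 2 * \<phi> y" for x y
    using \<beta> small t0(1) weight_comparable[OF \<beta>, of "B\<^sup>2 * t0" x y] by (auto simp: \<phi>_def)
  have sm: "2 * B\<^sup>2 * t0 \<le> 1 / 2" "3 * B\<^sup>2 * t0 \<le> 1 / 2" "4 * B\<^sup>2 * t0 \<le> 1 / 2" "0 \<le> 2 * B\<^sup>2" "0 \<le> 3 * B\<^sup>2" "0 \<le> 4 * B\<^sup>2"
    using small t0 by auto
  have cr: "continuous_on ({0..t0} \<times> UNIV) f" if "continuous_on (?I \<times> UNIV) f" for f :: "real \<times> real \<Rightarrow> real"
    using restr[OF that order_refl] .
  note wb = balance_law_weighted_bound[where a=a and ax=ax and A="B\<^sup>2" and L="2 * B\<^sup>2" and \<phi>=\<phi>,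
      OF cr[OF c2(1)] cr[OF c2(2)]]
  have a'0: "DERIV (a t) x :> ax t x" if "t \<in> {0..t0}" for t x using a'(1) that sub by auto
  \<comment> \<open>11 = 4 + 6 + 1 counts the terms of gM and of gN; the bound may be crude because
    it only serves to dominate the sources in the limit along characteristics.\<close>
  have gb: "\<bar>gM t x\<bar> \<le> 11 * (B^3)" "\<bar>gN t x\<bar> \<le> 11 * (B^3)" "\<bar>gP t x\<bar> \<le> 11 * (B^3)"
    if t: "t \<in> {0..t0}" for t x
  proof -
    have 1: "\<bar>ax t x * M t x\<bar> \<le> 2 * B\<^sup>2 * (2 * B)" "\<bar>V0 t x * U1 t x * M t x\<bar> \<le> B\<^sup>2 * (2 * B)"
      "\<bar>P0 t x * U0 t x * P0 t x\<bar> \<le> B\<^sup>2 * B" by (rule mul ab[OF t] bd[OF t])+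
    have 2: "\<bar>ax t x * N t x\<bar> \<le> 2 * B\<^sup>2 * (2 * B)" "\<bar>V1 t x * U0 t x * N t x\<bar> \<le> B\<^sup>2 * (2 * B)"
      "\<bar>P0 t x * V0 t x * P0 t x\<bar> \<le> B\<^sup>2 * B" by (rule mul ab[OF t] bd[OF t])+
    have 3: "\<bar>axx t x * P0 t x\<bar> \<le> 4 * B\<^sup>2 * B" "\<bar>ax t x * P1 t x\<bar> \<le> 2 * B\<^sup>2 * B" by (rule mul ab[OF t] bd[OF t])+
    have B3: "B\<^sup>2 * B = B^3" by (simp add: power2_eq_square power3_eq_cube)
    have "0 \<le> B^3" using B by simp
    have e: "gM t x = - (ax t x * M t x) + 3 * (V0 t x * U1 t x * M t x) + P0 t x * U0 t x * P0 t x"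
      "gN t x = - (ax t x * N t x) + 3 * (V1 t x * U0 t x * N t x) - P0 t x * V0 t x * P0 t x"
      by (simp_all add: gM_def gN_def power2_eq_square)
    show "\<bar>gM t x\<bar> \<le> 11 * (B^3)" using 1 \<open>0 \<le> B^3\<close> unfolding e B3[symmetric] by linarith
    show "\<bar>gN t x\<bar> \<le> 11 * (B^3)" using 2 \<open>0 \<le> B^3\<close> unfolding e B3[symmetric] by linarith
    show "\<bar>gP t x\<bar> \<le> 11 * (B^3)" using 3 \<open>0 \<le> B^3\<close> unfolding gP_def B3[symmetric] by linarith
  qed
  have divw: "\<bar>y\<bar> \<le> D / \<phi> x" if "\<bar>y\<bar> * \<phi> x \<le> D" for x y D using that \<phi>(1)[of x] by (simp add: field_simps)
  have estP: "\<bar>P0 t x\<bar> * \<phi> x \<le> 4 * C"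
    if i: "\<And>x. \<bar>P0 0 x\<bar> * \<phi> x \<le> C" and t: "t \<in> {0..t0}" for C t x
  proof -
    have "\<bar>P0 t x\<bar> * \<phi> x \<le> 4 * C + 2 * 0"
    proof (rule wb[where q=P0 and g="\<lambda>t x. 0" and K="2 * B\<^sup>2" and Bq=B and Bg=0, OF cr[OF c2(3)] _ a'0 ab(1,2) bd(1)])
      show "\<bar>ax t x * P0 t x + 0\<bar> \<le> 2 * B\<^sup>2 * (\<bar>P0 t x\<bar> + 0 / \<phi> x)" if "t \<in> {0..t0}" for t x
        using ab(2)[OF that, of x] by (simp add: abs_mult mult_right_mono)
    qed (use lawP \<phi> sm i t in auto)
    then show ?thesis by simp
  qed
  have C0: "0 \<le> C" if "\<And>x. \<bar>P0 0 x\<bar> * \<phi> x \<le> C" for C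
    using that[of 0] \<phi>(1)[of 0] by (meson abs_ge_zero less_imp_le mult_nonneg_nonneg order_trans)
  have estM: "\<bar>M t x\<bar> * \<phi> x \<le> 16 * C"
    if i: "\<And>x. \<bar>P0 0 x\<bar> * \<phi> x \<le> C" "\<And>x. \<bar>M 0 x\<bar> * \<phi> x \<le> 2 * C" and t: "t \<in> {0..t0}" for C t x
  proof -
    have "\<bar>M t x\<bar> * \<phi> x \<le> 4 * (2 * C) + 2 * (4 * C)"
    proof (rule wb[where q=M and g=gM and K="3 * B\<^sup>2" and Bq="2 * B" and Bg="11 * B^3",
          OF cr[OF c2(5)] cr[OF c2(7)] a'0 ab(1,2,4) gb(1)])
      show "\<bar>ax t x * M t x + gM t x\<bar> \<le> 3 * B\<^sup>2 * (\<bar>M t x\<bar> + 4 * C / \<phi> x)" if t: "t \<in> {0..t0}" for t x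
      proof -
        \<comment> \<open>After the cancellation of a_x m the rest is 3 v u_x m, of rate 3 B^2, and
          \<rho>^2 u, read as (\<rho> u) \<rho>: the first factor is bounded by B^2 and only the
          second is measured with the weight.\<close>
        have e: "ax t x * M t x + gM t x = 3 * (V0 t x * U1 t x * M t x) + P0 t x * U0 t x * P0 t x"
          by (simp add: gM_def power2_eq_square)
        have 1: "\<bar>V0 t x * U1 t x * M t x\<bar> \<le> B\<^sup>2 * \<bar>M t x\<bar>" using ab[OF t] by (intro mul) auto
        have 2: "\<bar>P0 t x * U0 t x * P0 t x\<bar> \<le> B\<^sup>2 * (4 * C / \<phi> x)"
          using ab[OF t] divw[OF estP[OF i(1) t]] by (intro mul) auto
        then have "0 \<le> B\<^sup>2 * (4 * C / \<phi> x)" by linarith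
        with 1 2 show ?thesis unfolding e distrib_left mult.assoc by linarith
      qed
    qed (use lawM \<phi> sm i C0[OF i(1)] t in auto)
    then show ?thesis by simp
  qed
  have estN: "\<bar>N t x\<bar> * \<phi> x \<le> 16 * C"
    if i: "\<And>x. \<bar>P0 0 x\<bar> * \<phi> x \<le> C" "\<And>x. \<bar>N 0 x\<bar> * \<phi> x \<le> 2 * C" and t: "t \<in> {0..t0}" for C t x
  proof -
    have "\<bar>N t x\<bar> * \<phi> x \<le> 4 * (2 * C) + 2 * (4 * C)"
    proof (rule wb[where q=N and g=gN and K="3 * B\<^sup>2" and Bq="2 * B" and Bg="11 * B^3",
          OF cr[OF c2(6)] cr[OF c2(8)] a'0 ab(1,2,5) gb(2)])
      show "\<bar>ax t x * N t x + gN t x\<bar> \<le> 3 * B\<^sup>2 * (\<bar>N t x\<bar> + 4 * C / \<phi> x)" if t: "t \<in> {0..t0}" for t x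
      proof -
        have e: "ax t x * N t x + gN t x = 3 * (V1 t x * U0 t x * N t x) - P0 t x * V0 t x * P0 t x"
          by (simp add: gN_def power2_eq_square)
        have 1: "\<bar>V1 t x * U0 t x * N t x\<bar> \<le> B\<^sup>2 * \<bar>N t x\<bar>" using ab[OF t] by (intro mul) auto
        have 2: "\<bar>P0 t x * V0 t x * P0 t x\<bar> \<le> B\<^sup>2 * (4 * C / \<phi> x)"
          using ab[OF t] divw[OF estP[OF i(1) t]] by (intro mul) auto
        then have "0 \<le> B\<^sup>2 * (4 * C / \<phi> x)" by linarith
        with 1 2 show ?thesis unfolding e distrib_left mult.assoc by linarith
      qed
    qed (use lawN \<phi> sm i C0[OF i(1)] t in auto)
    then show ?thesis by simp
  qed
  have estP1: "\<bar>P1 t x\<bar> * \<phi> x \<le> 12 * C"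
    if i: "\<And>x. \<bar>P0 0 x\<bar> * \<phi> x \<le> C" "\<And>x. \<bar>P1 0 x\<bar> * \<phi> x \<le> C" and t: "t \<in> {0..t0}" for C t x
  proof -
    have "\<bar>P1 t x\<bar> * \<phi> x \<le> 4 * C + 2 * (4 * C)"
    proof (rule wb[where q=P1 and g=gP and K="4 * B\<^sup>2" and Bq=B and Bg="11 * B^3",
          OF cr[OF c2(4)] cr[OF c2(9)] a'0 ab(1,2) bd(2) gb(3)])
      show "\<bar>ax t x * P1 t x + gP t x\<bar> \<le> 4 * B\<^sup>2 * (\<bar>P1 t x\<bar> + 4 * C / \<phi> x)" if t: "t \<in> {0..t0}" for t x
      proof -
        \<comment> \<open>The term a_x \<rho>_x appears twice, from the flux and from gP; with |a_x|
          \<le> 2 B^2 this is the rate 4 B^2, which also covers the coefficient of the driving term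
          a_xx \<rho>.\<close>
        have e: "ax t x * P1 t x + gP t x = 2 * (ax t x * P1 t x) + axx t x * P0 t x"
          by (simp add: gP_def)
        have 1: "\<bar>ax t x * P1 t x\<bar> \<le> (2 * B\<^sup>2) * \<bar>P1 t x\<bar>" using ab[OF t] by (intro mul) auto
        have 2: "\<bar>axx t x * P0 t x\<bar> \<le> (4 * B\<^sup>2) * (4 * C / \<phi> x)"
          using ab[OF t] divw[OF estP[OF i(1) t]] by (intro mul) auto
        from 1 2 show ?thesis unfolding e distrib_left mult.assoc by linarith
      qed
    qed (use lawP1 \<phi> sm i C0[OF i(1)] t in auto)
    then show ?thesis by simp
  qed
  have inI: "t \<in> ?I" if "t \<in> {0..t0}" for t using that sub by auto
  show ?thesis
    by (rule that[OF t0(1) t0T P(1)[OF inI] AEr[OF inI] D(1)[OF inI] cx(1)[OF inI] U(1)[OF inI] AEu[OF inI]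
          D(2)[OF inI] D(3)[OF inI] cx(2)[OF inI] V(1)[OF inI] AEv[OF inI] D(4)[OF inI] D(5)[OF inI] cx(3)[OF inI] _
          estP[unfolded \<phi>_def] estP1[unfolded \<phi>_def] estM[unfolded \<phi>_def M_def] estN[unfolded \<phi>_def N_def], of B])
      (use bd in auto)
qed

section \<open>From pointwise estimates to weighted norms\<close>

lemma weighted_Linf_norm_leI:
  assumes "\<And>f. f \<in> set fs \<Longrightarrow> Linf_norm (\<lambda>x. f x * weight \<beta> x) \<le> ereal b"
  shows "weighted_Linf_norm \<beta> fs \<le> ereal (real (length fs) * b)"
  using assms
proof (induction fs)
  case (Cons f fs)
  have "weighted_Linf_norm \<beta> (f # fs) = Linf_norm (\<lambda>x. f x * weight \<beta> x) + weighted_Linf_norm \<beta> fs"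
    by (simp add: weighted_Linf_norm_def)
  also have "\<dots> \<le> ereal b + ereal (real (length fs) * b)"
    using Cons by (intro add_mono) auto
  finally show ?case by (simp add: algebra_simps)
qed (simp add: weighted_Linf_norm_def)

theorem theorem1p8:
  fixes s :: real
  assumes "s > 5 / 2"
  shows "\<exists>C1 :: real \<Rightarrow> real \<Rightarrow> real \<Rightarrow> real.
    \<forall>(\<beta>::real) (C\<beta>::real) (C0::real) (\<rho>0::real \<Rightarrow> real) (u0::real \<Rightarrow> real) (v0::real \<Rightarrow> real)
      (T::ereal) (\<rho>::real \<Rightarrow> real \<Rightarrow> real) (u::real \<Rightarrow> real \<Rightarrow> real) (v::real \<Rightarrow> real \<Rightarrow> real).
      0 < \<beta> \<and> is_weight_constant \<beta> C\<beta> \<and>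
      in_sobolev (s - 1) \<rho>0 \<and> in_sobolev s u0 \<and> in_sobolev s v0 \<and>
      T = lifespan s \<rho>0 u0 v0 \<and> 0 < T \<and> is_solution s T \<rho>0 u0 v0 \<rho> u v \<longrightarrow>
      (weighted_Linf_norm \<beta>
          [\<rho>0, u0, weak_deriv u0, weak_deriv (weak_deriv u0),
           v0, weak_deriv v0, weak_deriv (weak_deriv v0)] \<le> ereal C0 \<longrightarrow>
        (\<exists>T0>0. ereal T0 < T \<and>
          (\<forall>t\<in>{0..T0}.
            weighted_Linf_norm \<beta>
              [\<rho> t, u t, weak_deriv (u t), weak_deriv (weak_deriv (u t)),
               v t, weak_deriv (v t), weak_deriv (weak_deriv (v t))]
            \<le> ereal (C1 (sobolev_bound s T0 \<rho> u v) C\<beta> C0)))) \<and>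
      (weighted_Linf_norm \<beta>
          [\<rho>0, weak_deriv \<rho>0, u0, weak_deriv u0, weak_deriv (weak_deriv u0),
           v0, weak_deriv v0, weak_deriv (weak_deriv v0)] \<le> ereal C0 \<longrightarrow>
        (\<exists>T0>0. ereal T0 < T \<and>
          (\<forall>t\<in>{0..T0}.
            weighted_Linf_norm \<beta>
              [\<rho> t, weak_deriv (\<rho> t), u t, weak_deriv (u t), weak_deriv (weak_deriv (u t)),
               v t, weak_deriv (v t), weak_deriv (weak_deriv (v t))]
            \<le> ereal (C1 (sobolev_bound s T0 \<rho> u v) C\<beta> C0))))"
\<comment> \<open>128 = 8 * 16: at most eight components, each bounded by 16 (1 +
  |\<open>C\<beta>\<close>|) C0. The absolute values give a witness for arbitrary reals; C0 \<ge> 0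
  follows once the hypothesis on the data holds.\<close>
proof (intro exI[of _ "\<lambda>M C\<beta> C0. 128 * (1 + \<bar>C\<beta>\<bar>) * \<bar>C0\<bar>"] allI impI, elim conjE)
  fix \<beta> C\<beta> C0 :: real and \<rho>0 u0 v0 :: "real \<Rightarrow> real" and T :: ereal and \<rho> u v :: "real \<Rightarrow> real \<Rightarrow> real"
  assume \<beta>: "0 < \<beta>" and wc: "is_weight_constant \<beta> C\<beta>"
    and init: "in_sobolev (s - 1) \<rho>0" "in_sobolev s u0" "in_sobolev s v0"
    and T: "0 < T" and sol: "is_solution s T \<rho>0 u0 v0 \<rho> u v"
  show "(weighted_Linf_norm \<beta>
          [\<rho>0, u0, weak_deriv u0, weak_deriv (weak_deriv u0),
           v0, weak_deriv v0, weak_deriv (weak_deriv v0)] \<le> ereal C0 \<longrightarrow>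
        (\<exists>T0>0. ereal T0 < T \<and>
          (\<forall>t\<in>{0..T0}.
            weighted_Linf_norm \<beta>
              [\<rho> t, u t, weak_deriv (u t), weak_deriv (weak_deriv (u t)),
               v t, weak_deriv (v t), weak_deriv (weak_deriv (v t))]
            \<le> ereal (128 * (1 + \<bar>C\<beta>\<bar>) * \<bar>C0\<bar>)))) \<and>
      (weighted_Linf_norm \<beta>
          [\<rho>0, weak_deriv \<rho>0, u0, weak_deriv u0, weak_deriv (weak_deriv u0),
           v0, weak_deriv v0, weak_deriv (weak_deriv v0)] \<le> ereal C0 \<longrightarrow>
        (\<exists>T0>0. ereal T0 < T \<and>
          (\<forall>t\<in>{0..T0}.
            weighted_Linf_norm \<beta>
              [\<rho> t, weak_deriv (\<rho> t), u t, weak_deriv (u t), weak_deriv (weak_deriv (u t)),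
               v t, weak_deriv (v t), weak_deriv (weak_deriv (v t))]
            \<le> ereal (128 * (1 + \<bar>C\<beta>\<bar>) * \<bar>C0\<bar>))))" (is ?goal)
  proof (rule solution_weighted_estimate[OF assms \<beta> T sol])
    fix P0 P1 U0 U1 U2 V0 V1 V2 :: "real \<Rightarrow> real \<Rightarrow> real" and t0 B :: real
      assume t0: "0 < t0" "ereal t0 < T"
      and \<rho>: "\<And>t. t \<in> {0..t0} \<Longrightarrow> \<rho> t \<in> borel_measurable borel" "\<And>t. t \<in> {0..t0} \<Longrightarrow> AE x in lborel. \<rho> t x = P0 t x"
      "\<And>t x. t \<in> {0..t0} \<Longrightarrow> DERIV (P0 t) x :> P1 t x" "\<And>t. t \<in> {0..t0} \<Longrightarrow> continuous_on UNIV (P1 t)"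
      and u: "\<And>t. t \<in> {0..t0} \<Longrightarrow> u t \<in> borel_measurable borel" "\<And>t. t \<in> {0..t0} \<Longrightarrow> AE x in lborel. u t x = U0 t x"
      "\<And>t x. t \<in> {0..t0} \<Longrightarrow> DERIV (U0 t) x :> U1 t x" "\<And>t x. t \<in> {0..t0} \<Longrightarrow> DERIV (U1 t) x :> U2 t x"
      "\<And>t. t \<in> {0..t0} \<Longrightarrow> continuous_on UNIV (U2 t)"
      and v: "\<And>t. t \<in> {0..t0} \<Longrightarrow> v t \<in> borel_measurable borel" "\<And>t. t \<in> {0..t0} \<Longrightarrow> AE x in lborel. v t x = V0 t x"
      "\<And>t x. t \<in> {0..t0} \<Longrightarrow> DERIV (V0 t) x :> V1 t x" "\<And>t x. t \<in> {0..t0} \<Longrightarrow> DERIV (V1 t) x :> V2 t x"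
      "\<And>t. t \<in> {0..t0} \<Longrightarrow> continuous_on UNIV (V2 t)"
      and bd: "\<And>t x. t \<in> {0..t0} \<Longrightarrow> \<bar>U0 t x\<bar> \<le> B \<and> \<bar>U1 t x\<bar> \<le> B \<and> \<bar>V0 t x\<bar> \<le> B \<and> \<bar>V1 t x\<bar> \<le> B"
      and est: "\<And>C t x. (\<And>x. \<bar>P0 0 x\<bar> * weight \<beta> x \<le> C) \<Longrightarrow> t \<in> {0..t0} \<Longrightarrow>
        \<bar>P0 t x\<bar> * weight \<beta> x \<le> 4 * C"
      "\<And>C t x. (\<And>x. \<bar>P0 0 x\<bar> * weight \<beta> x \<le> C) \<Longrightarrow> (\<And>x. \<bar>P1 0 x\<bar> * weight \<beta> x \<le> C) \<Longrightarrow>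
        t \<in> {0..t0} \<Longrightarrow> \<bar>P1 t x\<bar> * weight \<beta> x \<le> 12 * C"
      "\<And>C t x. (\<And>x. \<bar>P0 0 x\<bar> * weight \<beta> x \<le> C) \<Longrightarrow>
        (\<And>x. \<bar>U0 0 x - U2 0 x\<bar> * weight \<beta> x \<le> 2 * C) \<Longrightarrow>
        t \<in> {0..t0} \<Longrightarrow> \<bar>U0 t x - U2 t x\<bar> * weight \<beta> x \<le> 16 * C"
      "\<And>C t x. (\<And>x. \<bar>P0 0 x\<bar> * weight \<beta> x \<le> C) \<Longrightarrow>
        (\<And>x. \<bar>V0 0 x - V2 0 x\<bar> * weight \<beta> x \<le> 2 * C) \<Longrightarrow>
        t \<in> {0..t0} \<Longrightarrow> \<bar>V0 t x - V2 t x\<bar> * weight \<beta> x \<le> 16 * C"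
    have z: "0 \<in> {0..t0}" using t0(1) by simp
    have ae0: "AE x in lborel. \<rho> 0 x = \<rho>0 x \<and> u 0 x = u0 x \<and> v 0 x = v0 x"
      using sol by (simp add: is_solution_def)
    \<comment> \<open>The data are separate functions, equal almost everywhere to the solution at
      time 0, so its representatives at that time serve for them too.\<close>
    have ae: "AE x in lborel. \<rho>0 x = P0 0 x" "AE x in lborel. u0 x = U0 0 x" "AE x in lborel. v0 x = V0 0 x"
      using ae0 \<rho>(2)[OF z] by (eventually_elim, simp) (use ae0 u(2)[OF z] in \<open>eventually_elim, simp\<close>, use ae0 v(2)[OF z] in \<open>eventually_elim, simp\<close>)
    have d_cont: "continuous_on UNIV f" if "\<And>x. DERIV f x :> f' x" for f f' :: "real \<Rightarrow> real"
      using that by (meson DERIV_isCont continuous_at_imp_continuous_on)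
    note wd\<rho>0 = weak_deriv_AE_eq[OF in_sobolev_measurable[OF init(1)] ae(1) \<rho>(3,4)[OF z]]
    note wdu0 = weak_deriv_twice_AE_eq[OF in_sobolev_measurable[OF init(2)] ae(2) u(3,4,5)[OF z]]
    note wdv0 = weak_deriv_twice_AE_eq[OF in_sobolev_measurable[OF init(3)] ae(3) v(3,4,5)[OF z]]
    \<comment> \<open>The list \<open>fs\<close> stands for either hypothesis on the data: both
      contain the seven common components, and the bound for \<rho>_x is claimed when
      \<open>weak_deriv \<rho>0\<close> is a member as well.\<close>
    have main: "(\<forall>f\<in>{\<rho> t, u t, weak_deriv (u t), weak_deriv (weak_deriv (u t)),
        v t, weak_deriv (v t), weak_deriv (weak_deriv (v t))}.
          Linf_norm (\<lambda>x. f x * weight \<beta> x) \<le> ereal (16 * (1 + \<bar>C\<beta>\<bar>) * C0)) \<and> 0 \<le> C0 \<and>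
        (weak_deriv \<rho>0 \<in> set fs \<longrightarrow>
          Linf_norm (\<lambda>x. weak_deriv (\<rho> t) x * weight \<beta> x) \<le> ereal (16 * (1 + \<bar>C\<beta>\<bar>) * C0))"
      if fs: "weighted_Linf_norm \<beta> fs \<le> ereal C0"
        "{\<rho>0, u0, weak_deriv u0, weak_deriv (weak_deriv u0), v0, weak_deriv v0, weak_deriv (weak_deriv v0)} \<subseteq> set fs"
        and t: "t \<in> {0..t0}" for fs t
    proof -
      note le = weighted_Linf_norm_le_imp_le[OF fs(1) _ _ _ \<beta>]
      have P0i: "\<bar>P0 0 x\<bar> * weight \<beta> x \<le> C0" for x
        by (rule le[OF _ ae(1) d_cont[OF \<rho>(3)[OF z]]]) (use fs in simp)
      have i: "\<bar>U0 0 x\<bar> * weight \<beta> x \<le> C0" "\<bar>U2 0 x\<bar> * weight \<beta> x \<le> C0"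
        "\<bar>V0 0 x\<bar> * weight \<beta> x \<le> C0" "\<bar>V2 0 x\<bar> * weight \<beta> x \<le> C0" for x
        using le[OF _ ae(2) d_cont[OF u(3)[OF z]]] le[OF _ wdu0(3) u(5)[OF z]]
          le[OF _ ae(3) d_cont[OF v(3)[OF z]]] le[OF _ wdv0(3) v(5)[OF z]] fs(2) by simp_all
      have sub: "\<bar>p - q\<bar> * w \<le> 2 * C0" if "\<bar>p\<bar> * w \<le> C0" "\<bar>q\<bar> * w \<le> C0" "0 \<le> w" for p q w :: real
      proof -
        have "\<bar>p - q\<bar> * w \<le> (\<bar>p\<bar> + \<bar>q\<bar>) * w" by (rule mult_right_mono[OF _ that(3)]) linarith
        then show ?thesis using that by (simp add: distrib_right)
      qed
      have C0: "0 \<le> C0" using P0i[of 0] by (meson abs_ge_zero mult_nonneg_nonneg order_trans powr_ge_zero)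
      have bC: "16 * C0 * C\<beta> \<le> 16 * C0 * \<bar>C\<beta>\<bar>" "0 \<le> C0 * \<bar>C\<beta>\<bar>" using C0 by (auto intro: mult_left_mono)
      \<comment> \<open>One constant majorises the four bounds: 4 C0 for \<rho>, 12 C0 for \<rho>_x,
        16 C0 \<open>C\<beta>\<close> for u, u_x, v, v_x, and 16 C0 \<open>C\<beta>\<close> + 16 C0
        for the second derivatives.\<close>
      have b: "4 * C0 \<le> 16 * (1 + \<bar>C\<beta>\<bar>) * C0" "12 * C0 \<le> 16 * (1 + \<bar>C\<beta>\<bar>) * C0"
        "16 * C0 * C\<beta> \<le> 16 * (1 + \<bar>C\<beta>\<bar>) * C0" "16 * C0 * C\<beta> + 16 * C0 \<le> 16 * (1 + \<bar>C\<beta>\<bar>) * C0"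
        using bC C0 by (simp_all add: algebra_simps)
      have eP: "\<bar>P0 t x\<bar> * weight \<beta> x \<le> 4 * C0" for x by (rule est(1)[OF P0i t])
      have eM: "\<bar>U0 t x - U2 t x\<bar> * weight \<beta> x \<le> 16 * C0" for x
        by (rule est(3)[OF P0i sub[OF i(1,2)] t]) simp
      have eN: "\<bar>V0 t x - V2 t x\<bar> * weight \<beta> x \<le> 16 * C0" for x
        by (rule est(4)[OF P0i sub[OF i(3,4)] t]) simp
      have bt: "\<bar>U0 t x\<bar> \<le> B" "\<bar>U1 t x\<bar> \<le> B" "\<bar>V0 t x\<bar> \<le> B" "\<bar>V1 t x\<bar> \<le> B" for x using bd[OF t, of x] by auto
      note eU = weighted_bound_of_momentum[OF \<beta> wc u(3,4,5)[OF t] bt(1,2) eM]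
      note eV = weighted_bound_of_momentum[OF \<beta> wc v(3,4,5)[OF t] bt(3,4) eN]
      note wdu = weak_deriv_twice_AE_eq[OF u(1,2,3,4,5)[OF t]]
      note wdv = weak_deriv_twice_AE_eq[OF v(1,2,3,4,5)[OF t]]
      note wd\<rho> = weak_deriv_AE_eq[OF \<rho>(1,2,3,4)[OF t]]
      have "Linf_norm (\<lambda>x. \<rho> t x * weight \<beta> x) \<le> ereal (16 * (1 + \<bar>C\<beta>\<bar>) * C0)"
        by (rule Linf_norm_weighted_leI[OF \<rho>(1,2)[OF t] order_trans[OF eP b(1)]])
      moreover have "Linf_norm (\<lambda>x. u t x * weight \<beta> x) \<le> ereal (16 * (1 + \<bar>C\<beta>\<bar>) * C0)"
        by (rule Linf_norm_weighted_leI[OF u(1,2)[OF t] order_trans[OF eU(1) b(3)]])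
      moreover have "Linf_norm (\<lambda>x. weak_deriv (u t) x * weight \<beta> x) \<le> ereal (16 * (1 + \<bar>C\<beta>\<bar>) * C0)"
        by (rule Linf_norm_weighted_leI[OF wdu(2,1) order_trans[OF eU(2) b(3)]])
      moreover have "Linf_norm (\<lambda>x. weak_deriv (weak_deriv (u t)) x * weight \<beta> x) \<le> ereal (16 * (1 + \<bar>C\<beta>\<bar>) * C0)"
        by (rule Linf_norm_weighted_leI[OF wdu(4,3) order_trans[OF eU(3) b(4)]])
      moreover have "Linf_norm (\<lambda>x. v t x * weight \<beta> x) \<le> ereal (16 * (1 + \<bar>C\<beta>\<bar>) * C0)"
        by (rule Linf_norm_weighted_leI[OF v(1,2)[OF t] order_trans[OF eV(1) b(3)]])
      moreover have "Linf_norm (\<lambda>x. weak_deriv (v t) x * weight \<beta> x) \<le> ereal (16 * (1 + \<bar>C\<beta>\<bar>) * C0)"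
        by (rule Linf_norm_weighted_leI[OF wdv(2,1) order_trans[OF eV(2) b(3)]])
      moreover have "Linf_norm (\<lambda>x. weak_deriv (weak_deriv (v t)) x * weight \<beta> x) \<le> ereal (16 * (1 + \<bar>C\<beta>\<bar>) * C0)"
        by (rule Linf_norm_weighted_leI[OF wdv(4,3) order_trans[OF eV(3) b(4)]])
      moreover have "Linf_norm (\<lambda>x. weak_deriv (\<rho> t) x * weight \<beta> x) \<le> ereal (16 * (1 + \<bar>C\<beta>\<bar>) * C0)"
        if m: "weak_deriv \<rho>0 \<in> set fs"
      proof -
        have P1i: "\<bar>P1 0 x\<bar> * weight \<beta> x \<le> C0" for x
          by (rule le[OF m wd\<rho>0(1) \<rho>(4)[OF z]])
        show ?thesis
          by (rule Linf_norm_weighted_leI[OF wd\<rho>(2,1) order_trans[OF est(2)[OF P0i P1i t] b(2)]])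
      qed
      ultimately show ?thesis using C0 by simp
    qed
    have fin: "weighted_Linf_norm \<beta> gs \<le> ereal (128 * (1 + \<bar>C\<beta>\<bar>) * \<bar>C0\<bar>)"
      if "0 \<le> C0" "length gs \<le> 8"
        "\<And>f. f \<in> set gs \<Longrightarrow> Linf_norm (\<lambda>x. f x * weight \<beta> x) \<le> ereal (16 * (1 + \<bar>C\<beta>\<bar>) * C0)" for gs
    proof -
      have "weighted_Linf_norm \<beta> gs \<le> ereal (real (length gs) * (16 * (1 + \<bar>C\<beta>\<bar>) * C0))"
        by (rule weighted_Linf_norm_leI) (rule that(3))
      also have "real (length gs) * (16 * (1 + \<bar>C\<beta>\<bar>) * C0) \<le> 8 * (16 * (1 + \<bar>C\<beta>\<bar>) * C0)"
        using that by (intro mult_right_mono) auto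
      also have "8 * (16 * (1 + \<bar>C\<beta>\<bar>) * C0) = 128 * (1 + \<bar>C\<beta>\<bar>) * \<bar>C0\<bar>" using that(1) by simp
      finally show ?thesis by simp
    qed
    show ?goal
    proof (intro conjI impI exI[of _ t0] ballI t0)
      fix t assume *: "weighted_Linf_norm \<beta> [\<rho>0, u0, weak_deriv u0, weak_deriv (weak_deriv u0),
             v0, weak_deriv v0, weak_deriv (weak_deriv v0)] \<le> ereal C0" "t \<in> {0..t0}"
      show "weighted_Linf_norm \<beta> [\<rho> t, u t, weak_deriv (u t), weak_deriv (weak_deriv (u t)),
                 v t, weak_deriv (v t), weak_deriv (weak_deriv (v t))]
              \<le> ereal (128 * (1 + \<bar>C\<beta>\<bar>) * \<bar>C0\<bar>)"
        using main[OF *(1) _ *(2)] by (intro fin) auto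
    next
      fix t assume *: "weighted_Linf_norm \<beta> [\<rho>0, weak_deriv \<rho>0, u0, weak_deriv u0, weak_deriv (weak_deriv u0),
             v0, weak_deriv v0, weak_deriv (weak_deriv v0)] \<le> ereal C0" "t \<in> {0..t0}"
      show "weighted_Linf_norm \<beta> [\<rho> t, weak_deriv (\<rho> t), u t, weak_deriv (u t), weak_deriv (weak_deriv (u t)),
                 v t, weak_deriv (v t), weak_deriv (weak_deriv (v t))]
              \<le> ereal (128 * (1 + \<bar>C\<beta>\<bar>) * \<bar>C0\<bar>)"
        using main[OF *(1) _ *(2)] by (intro fin) auto
    qed
  qed
qed

end
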